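(* Let $\mathcal M\subset\mathbb R^N$ be an $n$-dimensional algebraic manifold and let $f\colon\mathcal M\to\mathbb R_{\ge0}$ be a measurable function with finite integral over $\mathcal M$. Assume that $|f(x)|$ and $\|x\|$ are bounded on $\mathcal M$. Let $\varphi$ be the density on $\mathbb R^{n\times N}\times\mathbb R^n$ for which all entries of $(A,b)$ are i.i.d. standard Gaussian, and let $\overline f$ be as defined in the context. Then the variance $\sigma^2(\overline f)$ of $\overline f(A,b)$, where $(A,b)\sim\varphi$, is finite, and for every $\varepsilon>0$ and every positive integer $k$ we have $$\mathrm{Prob}\left\{\left|\mathrm E(f,k)-\int_{\mathcal M}f(x)\,\mathrm dx\right|\ge\varepsilon\right\}\le\frac{\sigma^2(\overline f)}{\varepsilon^2k},$$ where $\mathrm E(f,k)=\frac1k\left(\overline f(A_1,b_1)+\cdots+\overline f(A_k,b_k)\right)$ is the empirical mean of $\overline f$ over a sample of $k$ independent pairs $(A_1,b_1),\dots,(A_k,b_k)$ drawn from $\varphi$.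
   Context: A (real affine) algebraic variety in $\mathbb R^N$ is the common zero set of a set of real polynomials in $N$ variables. An algebraic manifold is an open submanifold of the manifold of nonsingular points of a real affine algebraic variety in $\mathbb R^N$. $\mathcal M$ carries the Riemannian metric induced from the Euclidean metric of $\mathbb R^N$, and $\mathrm dx$ is the associated volume measure. $\langle\cdot,\cdot\rangle$ and $\|\cdot\|$ are the Euclidean inner product and norm. For $(A,b)\in\mathbb R^{n\times N}\times\mathbb R^n$ put $\mathcal L_{A,b}=\{x\in\mathbb R^N: Ax=b\}$. For $x\in\mathcal M$ let $\mathrm N_x\mathcal M$ be the normal space of $\mathcal M$ at $x$ (the orthogonal complement in $\mathbb R^N$ of the tangent space $\mathrm T_x\mathcal M$), let $\Pi_{\mathrm N_x\mathcal M}\colon\mathbb R^N\to\mathrm N_x\mathcal M$ be the orthogonal projection, and define $$\alpha(x)=\frac{\sqrt{1+\langle x,\Pi_{\mathrm N_x\mathcal M}x\rangle}}{(1+\|x\|^2)^{\frac{n+1}{2}}}\cdot\frac{\Gamma\left(\frac{n+1}{2}\right)}{\sqrt{\pi}^{\,n+1}},\qquad \overline f(A,b)=\sum_{x\in\mathcal M\cap\mathcal L_{A,b}}\frac{f(x)}{\alpha(x)}.$$ The intersection $\mathcal M\cap\mathcal L_{A,b}$ is finite for almost all $(A,b)$, so $\overline f$ is defined almost everywhere; an empty sum is $0$. *)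

theory Defs
  imports "HOL-Probability.Probability"
begin

section \<open>Real algebraic varieties and algebraic manifolds\<close>

definition algebraic_variety :: "(real ^ 'N) set \<Rightarrow> bool" where
  "algebraic_variety V \<longleftrightarrow>
     (\<exists>P. (\<forall>p\<in>P. real_polynomial_function p) \<and> V = {x. \<forall>p\<in>P. p x = 0})"

text \<open>
  The usual notion for real varieties (Akbulut--King; Bochnak--Coste--Roy): near \<open>x\<close> the variety
  is cut out by \<open>N - d\<close> polynomials from its vanishing ideal whose gradients at \<open>x\<close> are linearly
  independent.  The variety may be reducible, with components of different dimensions; \<open>d\<close> is the
  local dimension at \<open>x\<close>.
\<close>

definition nonsingular_of_dim :: "nat \<Rightarrow> (real ^ 'N) set \<Rightarrow> real ^ 'N \<Rightarrow> bool" where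
  "nonsingular_of_dim d V x \<longleftrightarrow> x \<in> V \<and>
     (\<exists>k p g U. k + d = CARD('N) \<and>
        (\<forall>i<k. real_polynomial_function (p i) \<and> (\<forall>y\<in>V. p i y = 0)) \<and>
        open U \<and> x \<in> U \<and> V \<inter> U = {y. \<forall>i<k. p i y = 0} \<inter> U \<and>
        (\<forall>i<k. GDERIV (p i) x :> g i) \<and>
        inj_on g {..<k} \<and> independent (g ` {..<k}))"

definition nonsingular_points :: "(real ^ 'N) set \<Rightarrow> (real ^ 'N) set" where
  "nonsingular_points V = {x. \<exists>d. nonsingular_of_dim d V x}"

definition algebraic_manifold :: "nat \<Rightarrow> (real ^ 'N) set \<Rightarrow> bool" where
  "algebraic_manifold n M \<longleftrightarrow>
     (\<exists>V. algebraic_variety V \<and>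
        openin (top_of_set (nonsingular_points V)) M \<and>
        (\<forall>x\<in>M. nonsingular_of_dim n V x))"

section \<open>Tangent and normal spaces\<close>

definition tangent_space :: "(real ^ 'N) set \<Rightarrow> real ^ 'N \<Rightarrow> (real ^ 'N) set" where
  "tangent_space M x =
     {v. \<exists>\<gamma> e. 0 < e \<and> \<gamma> C1_differentiable_on {-e<..<e} \<and> \<gamma> ` {-e<..<e} \<subseteq> M \<and>
         \<gamma> 0 = x \<and> (\<gamma> has_vector_derivative v) (at 0)}"

definition normal_space :: "(real ^ 'N) set \<Rightarrow> real ^ 'N \<Rightarrow> (real ^ 'N) set" where
  "normal_space M x = orthogonal_comp (tangent_space M x)"

definition orth_proj :: "(real ^ 'N) set \<Rightarrow> real ^ 'N \<Rightarrow> real ^ 'N" where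
  "orth_proj W x = (THE y. y \<in> W \<and> x - y \<in> orthogonal_comp W)"

section \<open>The Riemannian volume measure\<close>

text \<open>\<open>J u\<close> is the Jacobian matrix of the parametrization \<open>\<phi>\<close> at \<open>u\<close>.\<close>

definition local_parametrization ::
  "(real ^ 'N) set \<Rightarrow> (real ^ 'n) set \<Rightarrow> (real ^ 'n \<Rightarrow> real ^ 'N) \<Rightarrow>
   (real ^ 'n \<Rightarrow> real ^ 'n ^ 'N) \<Rightarrow> bool" where
  "local_parametrization M U \<phi> J \<longleftrightarrow>
     open U \<and> openin (top_of_set M) (\<phi> ` U) \<and>
     (\<exists>\<psi>. homeomorphism U (\<phi> ` U) \<phi> \<psi>) \<and>
     (\<forall>u\<in>U. (\<phi> has_derivative (\<lambda>h. J u *v h)) (at u)) \<and>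
     continuous_on U J \<and>
     (\<forall>u\<in>U. inj (\<lambda>h. J u *v h))"

text \<open>
  In local coordinates the metric induced from the Euclidean one has the Gram matrix
  \<open>J\<^sup>T J\<close>, so that the volume measure has density \<open>sqrt (det (J\<^sup>T J))\<close>.
  The type variable \<open>'n\<close> supplies the coordinate space and with it the dimension of \<open>M\<close>.
\<close>

definition is_volume_measure :: "'n::finite itself \<Rightarrow> (real ^ 'N) set \<Rightarrow> (real ^ 'N) measure \<Rightarrow> bool" where
  "is_volume_measure _ M \<mu> \<longleftrightarrow>
     space \<mu> = M \<and> sets \<mu> = sets (restrict_space borel M) \<and>
     (\<forall>(U :: (real ^ 'n) set) \<phi> J. local_parametrization M U \<phi> J \<longrightarrow>
        (\<forall>B\<in>sets \<mu>. B \<subseteq> \<phi> ` U \<longrightarrow>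
           emeasure \<mu> B =
             (\<integral>\<^sup>+u. ennreal (sqrt (det (transpose (J u) ** J u))) * indicator {u\<in>U. \<phi> u \<in> B} u
                \<partial>lborel)))"

text \<open>
  The completion admits Lebesgue measurable functions; on Borel functions it changes neither
  measurability nor integrals.
\<close>

definition volume_measure :: "'n::finite itself \<Rightarrow> (real ^ 'N) set \<Rightarrow> (real ^ 'N) measure" where
  "volume_measure n M = completion (THE \<mu>. is_volume_measure n M \<mu>)"

section \<open>Random affine subspaces\<close>

definition affine_slice :: "(real ^ 'N ^ 'n) \<times> (real ^ 'n) \<Rightarrow> (real ^ 'N) set" where
  "affine_slice = (\<lambda>(A, b). {x. A *v x = b})"

definition gaussian_density :: "(real ^ 'N ^ 'n) \<times> (real ^ 'n) \<Rightarrow> real" where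
  "gaussian_density = (\<lambda>(A, b).
     (\<Prod>i\<in>UNIV. \<Prod>j\<in>UNIV. std_normal_density (A $ i $ j)) * (\<Prod>i\<in>UNIV. std_normal_density (b $ i)))"

text \<open>
  Completed, because the random variables considered below are only determined almost everywhere.
\<close>

definition gaussian_measure :: "((real ^ 'N ^ 'n) \<times> (real ^ 'n)) measure" where
  "gaussian_measure = completion (density lborel (\<lambda>\<omega>. ennreal (gaussian_density \<omega>)))"

definition alpha :: "nat \<Rightarrow> (real ^ 'N) set \<Rightarrow> real ^ 'N \<Rightarrow> real" where
  "alpha n M x =
     sqrt (1 + inner x (orth_proj (normal_space M x) x)) /
       (1 + (norm x)\<^sup>2) powr ((real n + 1) / 2) *
     (Gamma ((real n + 1) / 2) / sqrt pi ^ (n + 1))"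

text \<open>
  For the null set of \<open>(A, b)\<close> with infinite intersection the value is \<open>0\<close>, by the convention for
  sums over infinite sets.
\<close>

definition f_bar ::
  "(real ^ 'N) set \<Rightarrow> (real ^ 'N \<Rightarrow> real) \<Rightarrow> (real ^ 'N ^ 'n) \<times> (real ^ 'n) \<Rightarrow> real" where
  "f_bar M f \<omega> = (\<Sum>x\<in>M \<inter> affine_slice \<omega>. f x / alpha CARD('n) M x)"

definition empirical_mean ::
  "(real ^ 'N) set \<Rightarrow> (real ^ 'N \<Rightarrow> real) \<Rightarrow> nat \<Rightarrow>
   (nat \<Rightarrow> (real ^ 'N ^ 'n) \<times> (real ^ 'n)) \<Rightarrow> real" where
  "empirical_mean M f k \<omega> = (\<Sum>i=1..k. f_bar M f (\<omega> i)) / real k"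

end

theory Submission
  imports Defs "HOL-Library.Function_Algebras"
begin

text \<open>
  A kinematic formula carries the proof: for Borel \<open>B\<close> in \<open>M\<close> the expected number of points of
  \<open>B\<close> on the random affine subspace \<open>A x = b\<close> is \<open>\<integral>\<^sub>B alpha\<close>.  In a chart \<open>\<phi>\<close> with Jacobian matrix \<open>J\<close>,
  and for fixed \<open>A\<close>, substituting \<open>b = A \<phi>(u)\<close>, with Jacobian determinant \<open>det (A J(u))\<close>, leaves a
  Gaussian integral over \<open>A\<close>, which the orthogonal invariance of the Gaussian reduces to \<open>alpha\<close>.  Hence
  \<open>f_bar\<close> has expectation \<open>\<integral>\<^sub>M f\<close>.

  Almost every subspace meets \<open>M\<close> only transversally, and a Bezout-type bound limits the number of
  transversal intersection points uniformly.  Since \<open>f\<close> is bounded and \<open>alpha\<close> is bounded below on the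
  bounded set \<open>M\<close>, \<open>f_bar\<close> is essentially bounded, so its variance is finite and Chebyshev's
  inequality applies.
\<close>

text \<open>The volume measure is defined by a description operator, so its existence has to be
  proved before it can be computed. Gluing chart integrals along transition maps is avoided: the
  expected number of points on a random subspace is a measure on all of \<open>M\<close> from the
  outset, and giving it the density \<open>1 / alpha\<close> produces the volume measure. Charts
  only serve to evaluate it.

  The uniform bound on intersection points meets the obstacle that nonsingularity provides equations
  depending on the point. Hilbert's basis theorem replaces them by finitely many polynomials whose
  gradients determine the tangent space at every point of \<open>M\<close>. With the affine
  equations they form a possibly overdetermined system, and each transversal point is a
  nondegenerate zero of some square subsystem.

  The constant in \<open>alpha\<close> is the normalizing constant of the Cauchy density. Since
  \<open>f\<close> is only measurable for the completed volume measure, almost every subspace must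
  also be shown to miss a given null set; the counting formula gives this as well.\<close>

section \<open>Change of variables in Euclidean spaces\<close>

text \<open>
  The library's change of variables theorem needs a well-ordered index type, which \<open>'n::finite\<close> is
  not; \<open>coord\<close> provides one.
\<close>

typedef (overloaded) ('a::euclidean_space) coord = "{..<DIM('a)}"
  by (auto intro: exI[of _ 0])

instance coord :: (euclidean_space) finite
proof
  have "finite (Rep_coord ` (UNIV :: 'a coord set))"
    by (rule finite_subset[of _ "{..<DIM('a)}"]) (use Rep_coord in auto)
  then show "finite (UNIV :: 'a coord set)"
    by (rule finite_imageD) (simp add: inj_on_def Rep_coord_inject)
qed

instantiation coord :: (euclidean_space) wellorder
begin

definition "a \<le> b \<longleftrightarrow> Rep_coord a \<le> Rep_coord b"
definition "a < b \<longleftrightarrow> Rep_coord a < Rep_coord b"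

instance
proof
  fix P :: "'a coord \<Rightarrow> bool" and a
  assume step: "\<And>x. (\<And>y. y < x \<Longrightarrow> P y) \<Longrightarrow> P x"
  show "P a"
    by (induction a rule: measure_induct_rule[of Rep_coord]) (rule step, simp add: less_coord_def)
qed (auto simp: less_eq_coord_def less_coord_def Rep_coord_inject)

end

lemma CARD_coord: "CARD('a::euclidean_space coord) = DIM('a)"
  using type_definition.card[OF type_definition_coord] by simp

lemma ex_coord_basis: "\<exists>b. bij_betw b (UNIV :: 'a::euclidean_space coord set) (Basis :: 'a set)"
  by (rule finite_same_card_bij) (auto simp: CARD_coord)

definition coord_basis :: "'a::euclidean_space coord \<Rightarrow> 'a" where
  "coord_basis = (SOME b. bij_betw b UNIV Basis)"

lemma bij_coord_basis: "bij_betw (coord_basis :: 'a::euclidean_space coord \<Rightarrow> 'a) UNIV Basis"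
  unfolding coord_basis_def using ex_coord_basis by (rule someI_ex)

definition to_coords :: "'a::euclidean_space \<Rightarrow> real ^ 'a coord" where
  "to_coords x = (\<chi> i. x \<bullet> coord_basis i)"

definition of_coords :: "real ^ 'a coord \<Rightarrow> 'a::euclidean_space" where
  "of_coords v = (\<Sum>i\<in>UNIV. v $ i *\<^sub>R coord_basis i)"

lemma of_to_coords [simp]: "of_coords (to_coords x) = x"
  unfolding of_coords_def to_coords_def
  using sum.reindex_bij_betw[OF bij_coord_basis, of "\<lambda>b. (x \<bullet> b) *\<^sub>R b"]
  by (simp add: euclidean_representation)

lemma inner_coord_basis: "coord_basis i \<bullet> coord_basis j = (if i = j then 1 else 0)"
proof -
  have "inj (coord_basis :: 'a coord \<Rightarrow> 'a)" "\<And>i :: 'a coord. coord_basis i \<in> Basis"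
    using bij_coord_basis[where ?'a='a] by (auto simp: bij_betw_def)
  then show ?thesis by (simp add: inner_Basis inj_eq)
qed

lemma ball_Basis_coord:
  fixes P :: "'a::euclidean_space \<Rightarrow> bool"
  shows "(\<forall>b\<in>Basis. P b) \<longleftrightarrow> (\<forall>i. P (coord_basis i))"
  by (subst bij_betw_imp_surj_on[OF bij_coord_basis, symmetric]) simp

lemma to_of_coords [simp]: "to_coords (of_coords v) = v"
  by (simp add: of_coords_def to_coords_def vec_eq_iff inner_sum_left inner_coord_basis
      if_distrib cong: if_cong)

lemma mem_image_to_coords: "y \<in> to_coords ` S \<longleftrightarrow> of_coords y \<in> S"
proof
  show "of_coords y \<in> S" if "y \<in> to_coords ` S"
    using that by auto
  show "y \<in> to_coords ` S" if "of_coords y \<in> S"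
    using imageI[OF that, of to_coords] by simp
qed

lemma linear_to_coords: "linear to_coords"
  by (auto intro!: linearI simp: to_coords_def vec_eq_iff inner_add_left)

lemma linear_of_coords: "linear of_coords"
  by (auto intro!: linearI simp: of_coords_def scaleR_add_left sum.distrib scaleR_sum_right)

lemma inner_to_coords: "to_coords x \<bullet> to_coords y = x \<bullet> y"
  using sum.reindex_bij_betw[OF bij_coord_basis, of "\<lambda>b. (x \<bullet> b) * (y \<bullet> b)"]
  by (simp add: to_coords_def inner_vec_def euclidean_inner[of x y])

lemma inner_of_coords: "of_coords v \<bullet> of_coords w = v \<bullet> w"
  by (metis inner_to_coords to_of_coords)

lemma borel_measurable_to_coords [measurable]: "to_coords \<in> borel_measurable borel"
  by (intro borel_measurable_continuous_onI linear_continuous_on linear_conv_bounded_linear[THEN iffD1] linear_to_coords)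

lemma borel_measurable_of_coords [measurable]: "of_coords \<in> borel_measurable borel"
  by (intro borel_measurable_continuous_onI linear_continuous_on linear_conv_bounded_linear[THEN iffD1] linear_of_coords)

lemma to_coords_coord_basis: "to_coords (coord_basis i) = axis i 1"
  by (auto simp: to_coords_def vec_eq_iff inner_coord_basis axis_def)

lemma of_coords_axis: "of_coords (axis i 1) = coord_basis i"
  by (metis of_to_coords to_coords_coord_basis)

text \<open>Lebesgue measure is determined by its values on boxes, and the preimage of a box under
  \<open>of_coords\<close> is a box with the same side lengths.\<close>

lemma lborel_distr_of_coords: "distr lborel borel (of_coords :: _ \<Rightarrow> 'a::euclidean_space) = lborel"
proof (rule lborel_eqI[symmetric])
  fix l u :: 'a assume le: "\<And>b. b \<in> Basis \<Longrightarrow> l \<bullet> b \<le> u \<bullet> b"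
  have in_basis: "coord_basis i \<in> Basis" for i :: "'a coord"
    using bij_coord_basis by (auto simp: bij_betw_def)
  have "of_coords v \<bullet> coord_basis i = v $ i" for v :: "real ^ 'a coord" and i
    by (metis to_coords_def to_of_coords vec_lambda_beta)
  then have eq: "of_coords -` box l u = box (to_coords l) (to_coords u)"
    by (auto simp: box_def[of l] ball_Basis_coord mem_box_cart to_coords_def)
  have "emeasure (distr lborel borel of_coords) (box l u) = emeasure lborel (box (to_coords l) (to_coords u))"
    by (simp add: emeasure_distr eq)
  also have "\<dots> = (\<Prod>b\<in>Basis. (to_coords u - to_coords l) \<bullet> b)"
    using le in_basis by (subst emeasure_lborel_box) (auto simp: Basis_vec_def to_coords_def inner_axis)
  also have "(\<Prod>b\<in>Basis. (to_coords u - to_coords l) \<bullet> b) = (\<Prod>i\<in>UNIV. (u - l) \<bullet> coord_basis i)"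
  proof -
    have B: "(Basis :: (real ^ 'a coord) set) = range (\<lambda>i. axis i 1)"
      by (auto simp: Basis_vec_def)
    have "inj (\<lambda>i::'a coord. axis i (1::real))"
      by (auto simp: inj_on_def axis_eq_axis)
    then have "(\<Prod>b\<in>Basis. (to_coords u - to_coords l) \<bullet> b)
        = (\<Prod>i\<in>UNIV. (to_coords u - to_coords l) \<bullet> axis i 1)"
      unfolding B by (simp only: prod.reindex comp_def)
    then show ?thesis by (simp only: inner_axis) (simp add: to_coords_def inner_diff_left)
  qed
  also have "\<dots> = (\<Prod>b\<in>Basis. (u - l) \<bullet> b)"
    by (rule prod.reindex_bij_betw[OF bij_coord_basis])
  finally show "emeasure (distr lborel borel of_coords) (box l u) = (\<Prod>b\<in>Basis. (u - l) \<bullet> b)" .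
qed simp

lemma lborel_distr_to_coords: "distr lborel borel to_coords = lborel"
  by (subst lborel_distr_of_coords[symmetric]) (simp add: distr_distr comp_def distr_id2)

text \<open>Conjugation by \<open>h\<close> maps the permutations of one index type bijectively onto
  those of the other and preserves signs, so the two Leibniz sums agree term by term.\<close>

lemma det_reindex:
  fixes A :: "'a::comm_ring_1 ^ 'n ^ 'n" and h :: "'m::finite \<Rightarrow> 'n::finite"
  assumes h: "bij h"
  shows "det (\<chi> i j. A $ h i $ h j) = det A"
proof -
  have inj: "inj h" using h by (simp add: bij_is_inj)
  have inv [simp]: "inv_into UNIV h (h i) = i" "h (inv_into UNIV h k) = k" for i k
    using h by (auto simp: bij_is_inj bij_is_surj surj_f_inv_f)
  have mp: "map_permutation UNIV h p = h \<circ> p \<circ> inv_into UNIV h" for p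
    using h by (auto simp: map_permutation_def restrict_id_def fun_eq_iff bij_def)
  have bb: "bij_betw (map_permutation UNIV h) {p. p permutes UNIV} {p. p permutes UNIV}"
  proof -
    have "map_permutation UNIV h = (\<lambda>p x. h (p (inv_into UNIV h x)))"
      by (simp add: fun_eq_iff mp)
    then show ?thesis using bij_betw_permutations[of h UNIV UNIV] h by simp
  qed
  have "det A = (\<Sum>p | p permutes (UNIV::'m set). of_int (sign (map_permutation UNIV h p)) *
      (\<Prod>i\<in>UNIV. A $ i $ map_permutation UNIV h p i))"
    unfolding det_def by (rule sum.reindex_bij_betw[OF bb, symmetric])
  also have "\<dots> = (\<Sum>p | p permutes (UNIV::'m set). of_int (sign p) * (\<Prod>i\<in>UNIV. A $ h i $ h (p i)))"
  proof (rule sum.cong)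
    fix p :: "'m \<Rightarrow> 'm" assume p: "p \<in> {p. p permutes UNIV}"
    have "(\<Prod>i\<in>UNIV. A $ i $ map_permutation UNIV h p i) = (\<Prod>i\<in>UNIV. A $ h i $ map_permutation UNIV h p (h i))"
      by (rule prod.reindex_bij_betw[symmetric]) (use h in simp)
    then show "of_int (sign (map_permutation UNIV h p)) * (\<Prod>i\<in>UNIV. A $ i $ map_permutation UNIV h p i)
       = of_int (sign p) * (\<Prod>i\<in>UNIV. A $ h i $ h (p i))"
      using p inj sign_map_permutation[of h UNIV p] by (simp add: mp)
  qed simp
  finally show ?thesis by (simp add: det_def)
qed

text \<open>On a Cartesian space \<open>coord_basis\<close> merely enumerates the axis vectors;
  passing to coordinates therefore permutes the rows and the columns of the matrix by the same
  bijection.\<close>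

lemma det_matrix_coords:
  fixes f :: "real ^ 'n \<Rightarrow> real ^ 'n"
  shows "det (matrix (to_coords \<circ> f \<circ> of_coords)) = det (matrix f)"
proof -
  define h :: "(real ^ 'n) coord \<Rightarrow> 'n" where "h i = (SOME k. coord_basis i = axis k 1)" for i
  have "\<exists>k. coord_basis i = (axis k 1 :: real^'n)" for i
    using bij_coord_basis[where ?'a="real^'n"] by (auto simp: bij_betw_def Basis_vec_def)
  then have h: "coord_basis i = axis (h i) 1" for i
    unfolding h_def by (rule someI_ex)
  have "bij h"
    unfolding bij_def
  proof
    show "inj h"
      by (rule injI) (metis bij_betw_def bij_coord_basis h inj_eq)
    show "surj h"
    proof -
      have "\<exists>i. h i = k" for k
      proof -
        have "axis k 1 \<in> (Basis :: (real^'n) set)" by (auto simp: Basis_vec_def)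
        then obtain i where "coord_basis i = (axis k 1 :: real^'n)"
          using bij_coord_basis[where ?'a="real^'n"] by (metis bij_betw_def imageE)
        then show ?thesis using h[of i] by (auto simp: axis_eq_axis)
      qed
      then show ?thesis by (metis surjI)
    qed
  qed
  have "matrix (to_coords \<circ> f \<circ> of_coords) = (\<chi> i j. matrix f $ h i $ h j)"
    by (simp add: matrix_def vec_eq_iff of_coords_axis to_coords_def h inner_axis)
  then show ?thesis using det_reindex[OF \<open>bij h\<close>] by metis
qed

lemma coords_has_derivative:
  fixes f :: "'a::euclidean_space \<Rightarrow> 'b::euclidean_space"
  assumes "(f has_derivative f') (at x within S)"
  shows "((to_coords \<circ> f \<circ> of_coords) has_derivative (to_coords \<circ> f' \<circ> of_coords))
     (at (to_coords x) within to_coords ` S)"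
proof -
  have 1: "(of_coords has_derivative of_coords) (at (to_coords x) within to_coords ` S)"
    by (simp add: linear_of_coords linear_imp_has_derivative)
  have 2: "(to_coords has_derivative to_coords) (at (f x) within f ` S)"
    by (simp add: linear_to_coords linear_imp_has_derivative)
  have "((to_coords \<circ> f) has_derivative (to_coords \<circ> f')) (at x within S)"
    by (rule diff_chain_within) (use assms 2 in auto)
  then have 3: "((to_coords \<circ> f) has_derivative (to_coords \<circ> f'))
      (at (of_coords (to_coords x)) within of_coords ` to_coords ` S)"
    by (simp add: image_image)
  show ?thesis
    using diff_chain_within[OF 1 3] by (simp add: comp_def)
qed

text \<open>A Lebesgue set is a Borel set together with part of a null set. The Borel part is
  governed by \<open>lborel_distr_of_coords\<close>, and null sets go to null sets.\<close>

lemma emeasure_lebesgue_to_coords: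
  assumes "S \<in> sets lebesgue"
  shows "to_coords ` S \<in> sets lebesgue" "emeasure lebesgue (to_coords ` S) = emeasure lebesgue S"
proof -
  have eq: "to_coords ` X = of_coords -` X" for X :: "'a set"
    by (auto simp: mem_image_to_coords)
  have m: "to_coords ` X \<in> sets borel" "emeasure lborel (to_coords ` X) = emeasure lborel X"
    if "X \<in> sets borel" for X :: "'a set"
  proof -
    show "to_coords ` X \<in> sets borel"
      unfolding eq using measurable_sets[OF borel_measurable_of_coords that] by simp
    show "emeasure lborel (to_coords ` X) = emeasure lborel X"
      unfolding eq by (subst (2) lborel_distr_of_coords[symmetric]) (simp add: emeasure_distr that)
  qed
  obtain B N N' where B: "S = B \<union> N" "N \<subseteq> N'" "N' \<in> null_sets lborel" "B \<in> sets lborel"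
    using assms by (auto elim: sets_completionE)
  have N': "to_coords ` N' \<in> null_sets lborel"
    using m[of N'] B by (auto simp: null_sets_def)
  show "to_coords ` S \<in> sets lebesgue"
    unfolding B image_Un using m[of B] B N' by (intro sets_completionI[OF refl _ N']) auto
  have a: "emeasure lebesgue S = emeasure lebesgue B"
    unfolding B using B by (intro emeasure_Un_null_set)
      (auto intro: null_sets_completion_subset null_sets_completionI)
  have b: "emeasure lebesgue (to_coords ` S) = emeasure lebesgue (to_coords ` B)"
    unfolding B image_Un using B m[of B] N'
    by (intro emeasure_Un_null_set) (auto intro!: null_sets_completion_subset[OF _ null_sets_completionI[OF N']])
  show "emeasure lebesgue (to_coords ` S) = emeasure lebesgue S"
    using a b m[of B] B by (simp add: emeasure_completion)
qed

lemma negligible_to_coords_iff: "negligible (to_coords ` S) \<longleftrightarrow> negligible S"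
proof
  assume "negligible (to_coords ` S)"
  then obtain N where N: "N \<in> null_sets lborel" "to_coords ` S \<subseteq> N"
    by (auto simp: negligible_iff_null_sets null_sets_completion_iff2)
  have "to_coords -` N \<in> null_sets lborel"
    using N emeasure_distr[of to_coords lborel borel N] measurable_sets[OF borel_measurable_to_coords, of N]
    by (auto simp: null_sets_def lborel_distr_to_coords)
  with N show "negligible S"
    by (auto simp: negligible_iff_null_sets null_sets_completion_iff2 intro!: bexI[of _ "to_coords -` N"])
next
  assume "negligible S"
  then show "negligible (to_coords ` S)"
    using emeasure_lebesgue_to_coords[of S] by (auto simp: negligible_iff_null_sets null_sets_def)
qed

text \<open>\<open>has_measure_differentiable_image\<close> equates finite values on the two sides.
  Finiteness of either side thus forces finiteness of the other, and the identity extends to the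
  value infinity.\<close>

lemma emeasure_differentiable_image_wellorder:
  fixes f :: "real^'n::{finite,wellorder} \<Rightarrow> real^'n::_"
  assumes S: "S \<in> sets lebesgue"
    and der: "\<And>x. x \<in> S \<Longrightarrow> (f has_derivative f' x) (at x within S)"
    and inj: "inj_on f S"
    and meas: "(\<lambda>x. indicator S x * \<bar>det (matrix (f' x))\<bar>) \<in> borel_measurable lebesgue"
  shows "emeasure lebesgue (f ` S) = (\<integral>\<^sup>+x. ennreal (indicator S x * \<bar>det (matrix (f' x))\<bar>) \<partial>lebesgue)"
proof -
  let ?g = "\<lambda>x. indicator S x * \<bar>det (matrix (f' x))\<bar>"
  have iff: "((\<lambda>x. \<bar>det (matrix (f' x))\<bar>) has_integral m) S \<longleftrightarrow> (?g has_integral m) UNIV" for m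
  proof -
    have "?g = (\<lambda>x. if x \<in> S then \<bar>det (matrix (f' x))\<bar> else 0)"
      by (simp add: fun_eq_iff indicator_def)
    then show ?thesis by (simp only: has_integral_restrict_UNIV)
  qed
  have fS: "f ` S \<in> sets lebesgue"
    by (rule differentiable_image_in_sets_lebesgue[OF S])
      (use der in \<open>auto simp: differentiable_on_def differentiable_def\<close>)
  show ?thesis
  proof (cases "(\<integral>\<^sup>+x. ennreal (?g x) \<partial>lebesgue) = \<infinity>")
    case False
    then obtain m where m: "0 \<le> m" "(\<integral>\<^sup>+x. ennreal (?g x) \<partial>lebesgue) = ennreal m"
      by (cases "(\<integral>\<^sup>+x. ennreal (?g x) \<partial>lebesgue)") auto
    then have "(?g has_integral m) UNIV"
      using has_integral_iff_nn_integral_lebesgue[of ?g m] meas by auto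
    then have "f ` S \<in> lmeasurable \<and> measure lebesgue (f ` S) = m"
      using has_measure_differentiable_image[OF S der inj, of m] iff by blast
    then show ?thesis using m by (simp add: emeasure_eq_measure2 fmeasurableD2)
  next
    case True
    have "emeasure lebesgue (f ` S) = \<infinity>"
    proof (rule ccontr)
      assume "emeasure lebesgue (f ` S) \<noteq> \<infinity>"
      then have "f ` S \<in> lmeasurable" using fS by (auto simp: fmeasurable_def top.not_eq_extremum)
      then have "(?g has_integral measure lebesgue (f ` S)) UNIV"
        using has_measure_differentiable_image[OF S der inj, of "measure lebesgue (f ` S)"] iff by blast
      then show False
        using True has_integral_iff_nn_integral_lebesgue[of ?g "measure lebesgue (f ` S)"] by auto
    qed
    then show ?thesis using True by simp
  qed
qed

text \<open>The well-ordered case transported along \<open>to_coords\<close>, which respects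
  measure, derivatives and the determinant.\<close>

lemma emeasure_differentiable_image:
  fixes f :: "real^'n \<Rightarrow> real^'n"
  assumes S: "S \<in> sets borel"
    and der: "\<And>x. x \<in> S \<Longrightarrow> (f has_derivative f' x) (at x within S)"
    and inj: "inj_on f S"
    and meas: "(\<lambda>x. indicator S x * \<bar>det (matrix (f' x))\<bar>) \<in> borel_measurable borel"
  shows "emeasure lebesgue (f ` S) = (\<integral>\<^sup>+x. ennreal (indicator S x * \<bar>det (matrix (f' x))\<bar>) \<partial>lborel)"
proof -
  let ?g = "to_coords \<circ> f \<circ> of_coords" and ?g' = "\<lambda>y. to_coords \<circ> f' (of_coords y) \<circ> of_coords"
  let ?T = "to_coords ` S"
  let ?d = "\<lambda>x. indicator S x * \<bar>det (matrix (f' x))\<bar>"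
  have fS: "f ` S \<in> sets lebesgue"
    by (rule differentiable_image_in_sets_lebesgue)
      (use S der in \<open>auto simp: differentiable_on_def differentiable_def\<close>)
  have eq: "indicator ?T y * \<bar>det (matrix (?g' y))\<bar> = ?d (of_coords y)" for y
    by (simp add: indicator_def det_matrix_coords mem_image_to_coords)
  have m: "(\<lambda>y. ?d (of_coords y)) \<in> borel_measurable borel"
    using meas by measurable
  have "emeasure lebesgue (?g ` ?T) = (\<integral>\<^sup>+y. ennreal (indicator ?T y * \<bar>det (matrix (?g' y))\<bar>) \<partial>lebesgue)"
  proof (rule emeasure_differentiable_image_wellorder)
    show "?T \<in> sets lebesgue" using S by (intro emeasure_lebesgue_to_coords) auto
    show "(?g has_derivative ?g' y) (at y within ?T)" if "y \<in> ?T" for y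
      using that coords_has_derivative[OF der] by auto
    show "inj_on ?g ?T"
    proof (rule inj_onI)
      fix y z assume "y \<in> ?T" "z \<in> ?T" "?g y = ?g z"
      then obtain a b where "a \<in> S" "b \<in> S" "y = to_coords a" "z = to_coords b"
        "to_coords (f a) = to_coords (f b)"
        by auto
      moreover from this(5) have "f a = f b"
        using of_to_coords by metis
      ultimately show "y = z" using inj by (auto dest: inj_onD)
    qed
    show "(\<lambda>y. indicator ?T y * \<bar>det (matrix (?g' y))\<bar>) \<in> borel_measurable lebesgue"
      unfolding eq using m by (intro measurable_completion) simp
  qed
  also have "?g ` ?T = to_coords ` (f ` S)" by (auto simp: image_image)
  also have "emeasure lebesgue \<dots> = emeasure lebesgue (f ` S)"
    by (rule emeasure_lebesgue_to_coords[OF fS])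
  also have "(\<integral>\<^sup>+y. ennreal (indicator ?T y * \<bar>det (matrix (?g' y))\<bar>) \<partial>lebesgue)
      = (\<integral>\<^sup>+y. ennreal (?d (of_coords y)) \<partial>lborel)"
    unfolding eq by (simp add: nn_integral_completion)
  also have "\<dots> = (\<integral>\<^sup>+x. ennreal (?d x) \<partial>distr lborel borel of_coords)"
    using meas by (subst nn_integral_distr) auto
  also have "\<dots> = (\<integral>\<^sup>+x. ennreal (?d x) \<partial>lborel)"
    by (simp add: lborel_distr_of_coords)
  finally show ?thesis .
qed

lemma negligible_critical_image:
  fixes f :: "real^'n \<Rightarrow> real^'n"
  assumes der: "\<And>x. x \<in> S \<Longrightarrow> (f has_derivative f' x) (at x within S)"
    and det: "\<And>x. x \<in> S \<Longrightarrow> det (matrix (f' x)) = 0"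
  shows "negligible (f ` S)"
proof -
  have "negligible ((to_coords \<circ> f \<circ> of_coords) ` (to_coords ` S))"
  proof (rule baby_Sard[where f' = "\<lambda>y. to_coords \<circ> f' (of_coords y) \<circ> of_coords"])
    fix y assume y: "y \<in> to_coords ` S"
    show "((to_coords \<circ> f \<circ> of_coords) has_derivative to_coords \<circ> f' (of_coords y) \<circ> of_coords) (at y within to_coords ` S)"
      using y coords_has_derivative[OF der] by auto
    have "det (matrix (to_coords \<circ> f' (of_coords y) \<circ> of_coords)) = 0"
      using y det by (auto simp: det_matrix_coords)
    then show "rank (matrix (to_coords \<circ> f' (of_coords y) \<circ> of_coords)) < CARD((real, 'n) vec coord)"
      by (simp add: det_eq_0_rank)
  qed simp
  then have "negligible (to_coords ` (f ` S))" by (simp add: image_image)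
  then show ?thesis by (simp add: negligible_to_coords_iff)
qed

text \<open>Two measures on the target are compared: Lebesgue measure on the image of
  \<open>S\<close>, and the image under \<open>f\<close> of the measure whose density is the
  absolute Jacobian. They agree on a Borel set \<open>B\<close> by the measure formula for the part
  of \<open>S\<close> that \<open>f\<close> maps into \<open>B\<close>; equality of measures then
  handles every \<open>h\<close> at once.\<close>

lemma nn_integral_differentiable_image:
  fixes f :: "real^'n \<Rightarrow> real^'n" and h :: "real^'n \<Rightarrow> ennreal"
  assumes S: "S \<in> sets borel" and fS: "f ` S \<in> sets borel"
    and der: "\<And>x. x \<in> S \<Longrightarrow> (f has_derivative f' x) (at x within S)"
    and inj: "inj_on f S"
    and meas: "(\<lambda>x. indicator S x * \<bar>det (matrix (f' x))\<bar>) \<in> borel_measurable borel"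
    and h[measurable]: "h \<in> borel_measurable borel"
  shows "(\<integral>\<^sup>+y. h y * indicator (f ` S) y \<partial>lborel) =
     (\<integral>\<^sup>+x. h (f x) * ennreal \<bar>det (matrix (f' x))\<bar> * indicator S x \<partial>lborel)"
proof -
  let ?d = "\<lambda>x. indicator S x * \<bar>det (matrix (f' x))\<bar>"
  note [measurable] = S fS meas
  \<comment> \<open>Extended by 0 so as to be measurable on the whole space; the density used below
    vanishes off \<open>S\<close>.\<close>
  define f0 where "f0 x = (if x \<in> S then f x else 0)" for x
  have "continuous_on S f"
    using der by (auto simp: continuous_on_eq_continuous_within intro: has_derivative_continuous)
  then have f0m[measurable]: "f0 \<in> borel_measurable borel"
    unfolding f0_def[abs_def] using S
    by (intro borel_measurable_continuous_on_if) auto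
  have eq: "density lborel (indicator (f ` S)) = distr (density lborel (\<lambda>x. ennreal (?d x))) borel f0"
    (is "?M = ?N")
  proof (rule measure_eqI)
    fix B assume "B \<in> sets ?M"
    then have B[measurable]: "B \<in> sets borel" by simp
    let ?S = "S \<inter> f0 -` B"
    have m2: "?S \<in> sets borel" using measurable_sets[OF f0m B] S by auto
    have im: "f ` ?S = B \<inter> f ` S" by (auto simp: f0_def)
    have eqd: "indicator ?S x * \<bar>det (matrix (f' x))\<bar> = indicator ?S x * ?d x" for x
      by (auto simp: indicator_def)
    have "emeasure lebesgue (f ` ?S) = (\<integral>\<^sup>+x. ennreal (indicator ?S x * \<bar>det (matrix (f' x))\<bar>) \<partial>lborel)"
    proof (rule emeasure_differentiable_image[OF m2])
      show "(f has_derivative f' x) (at x within ?S)" if "x \<in> ?S" for x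
        using that der by (auto intro: has_derivative_subset)
      show "inj_on f ?S" using inj by (auto simp: inj_on_def)
      show "(\<lambda>x. indicator ?S x * \<bar>det (matrix (f' x))\<bar>) \<in> borel_measurable borel"
        unfolding eqd using m2 by measurable
    qed
    also have "\<dots> = (\<integral>\<^sup>+x. ennreal (?d x) * indicator (f0 -` B) x \<partial>lborel)"
      by (intro nn_integral_cong) (auto simp: indicator_def)
    finally have "emeasure lborel (B \<inter> f ` S) = \<dots>"
      unfolding im by (simp add: emeasure_completion)
    moreover have "emeasure ?M B = emeasure lborel (B \<inter> f ` S)"
      by (subst emeasure_density) (auto simp: indicator_inter_arith[symmetric] mult.commute)
    moreover have "emeasure ?N B = (\<integral>\<^sup>+x. ennreal (?d x) * indicator (f0 -` B) x \<partial>lborel)"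
      using measurable_sets[OF f0m B] by (subst emeasure_distr) (auto simp: emeasure_density)
    ultimately show "emeasure ?M B = emeasure ?N B" by simp
  qed simp
  have "(\<integral>\<^sup>+y. h y * indicator (f ` S) y \<partial>lborel) = (\<integral>\<^sup>+y. h y \<partial>?M)"
    by (subst nn_integral_density) (auto simp: mult.commute)
  also have "\<dots> = (\<integral>\<^sup>+x. h (f0 x) \<partial>density lborel (\<lambda>x. ennreal (?d x)))"
    unfolding eq by (subst nn_integral_distr) auto
  also have "\<dots> = (\<integral>\<^sup>+x. ennreal (?d x) * h (f0 x) \<partial>lborel)"
    by (subst nn_integral_density) auto
  also have "\<dots> = (\<integral>\<^sup>+x. h (f x) * ennreal \<bar>det (matrix (f' x))\<bar> * indicator S x \<partial>lborel)"
    by (intro nn_integral_cong) (auto simp: indicator_def f0_def mult.commute)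
  finally show ?thesis .
qed

text \<open>The preimage of a box is its image under the inverse map, which is again orthogonal; in
  coordinates its determinant has absolute value 1.\<close>

lemma lborel_distr_orthogonal:
  fixes f :: "'a::euclidean_space \<Rightarrow> 'a"
  assumes f: "orthogonal_transformation f"
  shows "distr lborel borel f = lborel"
proof -
  have lin: "linear f" using f by (simp add: orthogonal_transformation_def)
  have fm[measurable]: "f \<in> borel_measurable borel"
    by (intro borel_measurable_continuous_onI linear_continuous_on linear_conv_bounded_linear[THEN iffD1] lin)
  let ?g = "to_coords \<circ> inv f \<circ> of_coords"
  have of': "orthogonal_transformation (inv f)" by (rule orthogonal_transformation_inv[OF f])
  have bij: "bij f" by (rule orthogonal_transformation_bij[OF f])
  have og: "orthogonal_transformation ?g"
    using of' by (auto simp: orthogonal_transformation_def inner_to_coords inner_of_coords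
        intro!: linear_compose linear_to_coords linear_of_coords)
  have ling: "linear ?g" using og by (simp add: orthogonal_transformation_def)
  have detg: "\<bar>det (matrix ?g)\<bar> = 1"
    using orthogonal_transformation_det[OF og] .
  show ?thesis
  proof (rule lborel_eqI[symmetric])
    fix l u :: 'a assume le: "\<And>b. b \<in> Basis \<Longrightarrow> l \<bullet> b \<le> u \<bullet> b"
    have bl: "box l u \<in> sets lebesgue" by simp
    have "f -` box l u = inv f ` box l u"
      using bij by (simp add: bij_vimage_eq_inv_image)
    then have 1: "to_coords ` (f -` box l u) = ?g ` (to_coords ` box l u)"
      by (auto simp: image_image)
    have fin: "to_coords ` box l u \<in> lmeasurable"
      using emeasure_lebesgue_to_coords[OF bl] by (auto simp: fmeasurable_def emeasure_lborel_box_eq)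
    have vm: "f -` box l u \<in> sets borel" using measurable_sets[OF fm, of "box l u"] by simp
    have "emeasure (distr lborel borel f) (box l u) = emeasure lebesgue (f -` box l u)"
      using vm by (simp add: emeasure_distr)
    also have "\<dots> = emeasure lebesgue (?g ` (to_coords ` box l u))"
      using emeasure_lebesgue_to_coords(2)[of "f -` box l u"] vm 1 by simp
    also have "\<dots> = emeasure lebesgue (to_coords ` box l u)"
      using measure_linear_image[OF ling fin] measurable_linear_image[OF ling fin] fin detg
      by (simp add: emeasure_eq_measure2 fmeasurableD2)
    also have "\<dots> = emeasure lebesgue (box l u)" by (rule emeasure_lebesgue_to_coords(2)[OF bl])
    also have "\<dots> = (\<Prod>b\<in>Basis. (u - l) \<bullet> b)" using le by simp
    finally show "emeasure (distr lborel borel f) (box l u) = (\<Prod>b\<in>Basis. (u - l) \<bullet> b)" .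
  qed simp
qed

section \<open>The standard Gaussian measure\<close>

text \<open>Stated on any Euclidean space, so that one constant serves the vectors \<open>b\<close>,
  the matrices \<open>A\<close>, the pairs \<open>(A, b)\<close> and their projections.\<close>

definition gauss_dens :: "'a::euclidean_space \<Rightarrow> real" where
  "gauss_dens x = exp (- (norm x)\<^sup>2 / 2) / sqrt (2 * pi) ^ DIM('a)"

definition gauss :: "'a::euclidean_space measure" where
  "gauss = density lborel (\<lambda>x. ennreal (gauss_dens x))"

lemma gauss_dens_pos: "gauss_dens x > 0"
  by (simp add: gauss_dens_def)

lemma gauss_dens_nonneg [simp]: "gauss_dens x \<ge> 0"
  using gauss_dens_pos[of x] by simp

lemma borel_measurable_gauss_dens [measurable]: "gauss_dens \<in> borel_measurable borel"
  unfolding gauss_dens_def[abs_def] by measurable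

lemma sets_gauss [measurable_cong, simp]: "sets gauss = sets borel"
  by (simp add: gauss_def)

lemma space_gauss [simp]: "space gauss = UNIV"
  by (simp add: gauss_def)

lemma gauss_dens_prod: "gauss_dens (x :: 'a::euclidean_space) = (\<Prod>b\<in>Basis. std_normal_density (x \<bullet> b))"
proof -
  have "(\<Prod>b\<in>Basis. std_normal_density (x \<bullet> b)) = (\<Prod>b\<in>Basis. exp (- (x \<bullet> b)\<^sup>2 / 2)) / sqrt (2 * pi) ^ DIM('a)"
    by (simp add: std_normal_density_def prod_dividef)
  also have "(\<Prod>b\<in>Basis. exp (- (x \<bullet> b)\<^sup>2 / 2)) = exp (- (norm x)\<^sup>2 / 2)"
    by (subst power2_norm_eq_inner, subst euclidean_inner)
       (simp add: exp_sum[symmetric] sum_divide_distrib sum_negf power2_eq_square)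
  finally show ?thesis by (simp add: gauss_dens_def)
qed

lemma gauss_dens_Pair:
  "gauss_dens (x :: 'a::euclidean_space, y :: 'b::euclidean_space) = gauss_dens x * gauss_dens y"
  by (simp add: gauss_dens_def norm_Pair power_add exp_add[symmetric] add_divide_distrib)

lemma sum_norm_vec: "(norm (x :: 'a::euclidean_space ^ 'n))\<^sup>2 = (\<Sum>i\<in>UNIV. (norm (x $ i))\<^sup>2)"
  by (simp add: power2_norm_eq_inner inner_vec_def)

lemma gauss_dens_vec:
  "gauss_dens (x :: 'a::euclidean_space ^ 'n) = (\<Prod>i\<in>UNIV. gauss_dens (x $ i))"
  by (simp add: gauss_dens_def prod_dividef sum_norm_vec exp_sum[symmetric] sum_negf
      sum_divide_distrib power_mult mult.commute)

lemma gaussian_density_eq: "gaussian_density = (gauss_dens :: (real ^ 'N ^ 'n) \<times> (real ^ 'n) \<Rightarrow> real)"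
proof
  fix \<omega> :: "(real ^ 'N ^ 'n) \<times> (real ^ 'n)"
  have *: "gauss_dens (t :: real) = std_normal_density t" for t
    by (simp add: gauss_dens_def std_normal_density_def)
  show "gaussian_density \<omega> = gauss_dens \<omega>"
    by (cases \<omega>) (simp add: gaussian_density_def gauss_dens_Pair gauss_dens_vec *)
qed

lemma gaussian_measure_eq: "gaussian_measure = completion gauss"
  by (simp add: gaussian_measure_def gaussian_density_eq gauss_def)

lemma PiM_density_lborel:
  fixes g :: "real \<Rightarrow> ennreal"
  assumes I: "finite I" and g[measurable]: "g \<in> borel_measurable borel"
    and p: "prob_space (density lborel g)"
  shows "density (PiM I (\<lambda>_. lborel)) (\<lambda>x. \<Prod>i\<in>I. g (x i)) = PiM I (\<lambda>_. density lborel g)"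
proof (rule product_sigma_finite.PiM_eqI)
  interpret p: prob_space "density lborel g" by fact
  show "product_sigma_finite (\<lambda>_. density lborel g)"
    by (simp add: product_sigma_finite_def p.sigma_finite_measure_axioms)
  show "finite I" by fact
  show "sets (density (PiM I (\<lambda>_. lborel)) (\<lambda>x. \<Prod>i\<in>I. g (x i))) = sets (PiM I (\<lambda>_. density lborel g))"
    by (simp cong: sets_PiM_cong)
  fix A assume A: "\<And>i. i \<in> I \<Longrightarrow> A i \<in> sets (density lborel g)"
  interpret q: product_sigma_finite "\<lambda>_. lborel :: real measure"
    by (simp add: product_sigma_finite_def sigma_finite_lborel)
  have [measurable]: "Pi\<^sub>E I A \<in> sets (PiM I (\<lambda>_. lborel))"
    using A I by (intro sets_PiM_I_finite) auto
  have "emeasure (density (PiM I (\<lambda>_. lborel)) (\<lambda>x. \<Prod>i\<in>I. g (x i))) (Pi\<^sub>E I A)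
     = (\<integral>\<^sup>+x. (\<Prod>i\<in>I. g (x i)) * indicator (Pi\<^sub>E I A) x \<partial>PiM I (\<lambda>_. lborel))"
    by (subst emeasure_density) auto
  also have "\<dots> = (\<integral>\<^sup>+x. (\<Prod>i\<in>I. g (x i) * indicator (A i) (x i)) \<partial>PiM I (\<lambda>_. lborel))"
  proof (rule nn_integral_cong)
    fix x :: "'a \<Rightarrow> real" assume x: "x \<in> space (PiM I (\<lambda>_. lborel))"
    have "indicator (Pi\<^sub>E I A) x = (\<Prod>i\<in>I. indicator (A i) (x i) :: ennreal)"
    proof (cases "x \<in> Pi\<^sub>E I A")
      case True
      then show ?thesis by (auto intro!: prod.neutral[symmetric] simp: indicator_def PiE_iff)
    next
      case False
      then obtain i where "i \<in> I" "x i \<notin> A i" using x by (auto simp: space_PiM PiE_iff)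
      then have "(\<Prod>i\<in>I. indicator (A i) (x i) :: ennreal) = 0"
        using I by (intro prod_zero) (auto intro!: bexI[of _ i])
      then show ?thesis using False by simp
    qed
    then show "(\<Prod>i\<in>I. g (x i)) * indicator (Pi\<^sub>E I A) x = (\<Prod>i\<in>I. g (x i) * indicator (A i) (x i))"
      by (simp add: prod.distrib)
  qed
  also have "\<dots> = (\<Prod>i\<in>I. \<integral>\<^sup>+t. g t * indicator (A i) t \<partial>lborel)"
    using A I by (intro q.product_nn_integral_prod) auto
  also have "\<dots> = (\<Prod>i\<in>I. emeasure (density lborel g) (A i))"
    using A by (intro prod.cong) (auto simp: emeasure_density)
  finally show "emeasure (density (PiM I (\<lambda>_. lborel)) (\<lambda>x. \<Prod>i\<in>I. g (x i))) (Pi\<^sub>E I A) = \<dots>" .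
qed

text \<open>Independence of the coordinates, expressed as a product measure. It yields total mass 1
  and allows projections to be computed by forgetting coordinates.\<close>

lemma gauss_eq_PiM:
  "(gauss :: 'a::euclidean_space measure) =
     distr (\<Pi>\<^sub>M b\<in>Basis. density lborel std_normal_density) borel (\<lambda>f. \<Sum>b\<in>Basis. f b *\<^sub>R b)"
proof -
  have p: "prob_space (density lborel (\<lambda>x. ennreal (std_normal_density x)))"
    using prob_space_normal_density[of 1 0] by simp
  have [measurable]: "(\<lambda>f. \<Sum>b\<in>Basis. f b *\<^sub>R b :: 'a) \<in> borel_measurable (\<Pi>\<^sub>M b\<in>Basis. lborel :: real measure)"
    by measurable
  have eq: "ennreal (gauss_dens (\<Sum>b\<in>Basis. f b *\<^sub>R b :: 'a)) = (\<Prod>b\<in>Basis. ennreal (std_normal_density (f b)))" for f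
    by (simp add: gauss_dens_prod prod_ennreal inner_sum_left inner_Basis if_distrib sum.delta cong: if_cong)
  have "(gauss :: 'a measure) = density (distr (\<Pi>\<^sub>M b\<in>Basis. lborel) borel (\<lambda>f. \<Sum>b\<in>Basis. f b *\<^sub>R b)) (\<lambda>x. ennreal (gauss_dens x))"
    unfolding gauss_def by (subst lborel_eq) simp
  also have "\<dots> = distr (density (\<Pi>\<^sub>M b\<in>Basis. lborel) (\<lambda>f. ennreal (gauss_dens (\<Sum>b\<in>Basis. f b *\<^sub>R b :: 'a)))) borel (\<lambda>f. \<Sum>b\<in>Basis. f b *\<^sub>R b)"
    by (subst density_distr) auto
  also have "density (\<Pi>\<^sub>M b\<in>Basis. lborel) (\<lambda>f. ennreal (gauss_dens (\<Sum>b\<in>Basis. f b *\<^sub>R b :: 'a))) = (\<Pi>\<^sub>M b\<in>Basis. density lborel std_normal_density)"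
    unfolding eq by (rule PiM_density_lborel) (use p in auto)
  finally show ?thesis .
qed

lemma prob_space_gauss: "prob_space (gauss :: 'a::euclidean_space measure)"
  unfolding gauss_eq_PiM
  using prob_space_normal_density[of 1 0]
  by (intro prob_space.prob_space_distr prob_space_PiM) (auto cong: measurable_cong_sets)

lemma gauss_distr_orthogonal:
  fixes f :: "'a::euclidean_space \<Rightarrow> 'a"
  assumes f: "orthogonal_transformation f"
  shows "distr gauss borel f = gauss"
proof -
  have lin: "linear f" using f by (simp add: orthogonal_transformation_def)
  have fm[measurable]: "f \<in> borel_measurable borel"
    by (intro borel_measurable_continuous_onI linear_continuous_on linear_conv_bounded_linear[THEN iffD1] lin)
  have "gauss_dens (f x) = gauss_dens x" for x
    using f by (simp add: gauss_dens_def orthogonal_transformation)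
  then have "distr gauss borel f = distr (density lborel (\<lambda>x. ennreal (gauss_dens (f x)))) borel f"
    by (simp add: gauss_def)
  also have "\<dots> = density (distr lborel borel f) (\<lambda>x. ennreal (gauss_dens x))"
    by (subst density_distr) auto
  finally show ?thesis by (simp add: lborel_distr_orthogonal[OF f] gauss_def)
qed

lemma orthonormal_extend:
  fixes S :: "'a::euclidean_space set"
  assumes orth: "pairwise orthogonal S" and norm: "\<And>x. x \<in> S \<Longrightarrow> norm x = 1"
  obtains B where "S \<subseteq> B" "pairwise orthogonal B" "\<And>x. x \<in> B \<Longrightarrow> norm x = 1"
    "finite B" "card B = DIM('a)" "span B = UNIV"
proof -
  have S0: "0 \<notin> S" using norm by fastforce
  obtain U where U: "pairwise orthogonal U" "S \<subseteq> U" "0 \<notin> U" "span U = UNIV"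
  proof -
    obtain U where U: "U \<inter> insert 0 S = {}" "pairwise orthogonal (S \<union> U)" "span (S \<union> U) = span (S \<union> UNIV)"
      using orthogonal_extension_strong[OF orth, of UNIV] by metis
    show ?thesis
      by (rule that[of "S \<union> U"]) (use U S0 in auto)
  qed
  let ?n = "\<lambda>x :: 'a. x /\<^sub>R norm x"
  let ?B = "?n ` U"
  have orthB: "pairwise orthogonal ?B"
    using U(1) by (auto simp: pairwise_def orthogonal_def)
  have normB: "norm x = 1" if xB: "x \<in> ?B" for x
  proof -
    obtain u where u: "u \<in> U" "x = ?n u" using xB by (rule imageE)
    then have "u \<noteq> 0" using U(3) by auto
    then show ?thesis using u by simp
  qed
  have "0 \<notin> ?B" using normB[of 0] by (metis norm_zero zero_neq_one)
  then have ind: "independent ?B" using orthB by (intro pairwise_orthogonal_independent)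
  have "span ?B = UNIV"
  proof -
    have "U \<subseteq> span ?B"
    proof
      fix u assume u: "u \<in> U"
      then have "u \<noteq> 0" using U(3) by auto
      then have eq: "norm u *\<^sub>R ?n u = u" by simp
      have "?n u \<in> span ?B" by (intro span_base imageI u)
      then have "norm u *\<^sub>R ?n u \<in> span ?B" by (rule span_scale)
      then show "u \<in> span ?B" by (simp only: eq)
    qed
    then show ?thesis using U(4) span_minimal[of U "span ?B"] by auto
  qed
  moreover have "finite ?B" using ind by (rule independent_imp_finite)
  moreover have "card ?B = DIM('a)"
    using ind \<open>span ?B = UNIV\<close> by (metis dim_UNIV dim_span_eq_card_independent)
  moreover have "S \<subseteq> ?B"
    using U(2) norm by (force simp: image_iff)
  ultimately show ?thesis using that[of ?B] orthB normB by blast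
qed

lemma orthonormal_representation:
  fixes B :: "'a::euclidean_space set"
  assumes B: "pairwise orthogonal B" "\<And>x. x \<in> B \<Longrightarrow> norm x = 1" "finite B" and x: "x \<in> span B"
  shows "(\<Sum>b\<in>B. (x \<bullet> b) *\<^sub>R b) = x"
proof -
  have bb: "b \<bullet> c = (if b = c then 1 else 0)" if "b \<in> B" "c \<in> B" for b c
    using B(1,2) that by (auto simp: pairwise_def orthogonal_def norm_eq_1)
  let ?z = "x - (\<Sum>b\<in>B. (x \<bullet> b) *\<^sub>R b)"
  have "orthogonal ?z c" if "c \<in> B" for c
    using that B(3) by (simp add: orthogonal_def inner_diff_left inner_sum_left bb if_distrib sum.delta cong: if_cong)
  moreover have "?z \<in> span B"
    by (intro span_diff span_sum span_scale x) (auto intro: span_base)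
  ultimately have "orthogonal ?z ?z"
    using orthogonal_to_span[of ?z B ?z] by auto
  then show ?thesis by (simp add: orthogonal_self)
qed

lemma orthonormal_sum_inner:
  fixes B :: "'a::euclidean_space set"
  assumes B: "pairwise orthogonal B" "\<And>x. x \<in> B \<Longrightarrow> norm x = 1" "finite B" "span B = UNIV"
  shows "(\<Sum>b\<in>B. (x \<bullet> b) * (y \<bullet> b)) = x \<bullet> y"
proof -
  have "x \<bullet> y = (\<Sum>b\<in>B. (x \<bullet> b) *\<^sub>R b) \<bullet> y"
    using orthonormal_representation[of B x] B by simp
  then show ?thesis by (simp add: inner_sum_left inner_commute[of y])
qed

text \<open>The map takes coordinates with respect to an orthonormal system \<open>v\<close>.
  Completing the system to an orthonormal basis and rotating that basis onto the standard one turns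
  the map into a selection of standard coordinates, and a subfamily of independent standard normal
  coordinates is again standard Gaussian.\<close>

lemma gauss_distr_coisometry:
  fixes v :: "'b::euclidean_space \<Rightarrow> 'a::euclidean_space"
  assumes v: "\<And>b c. b \<in> Basis \<Longrightarrow> c \<in> Basis \<Longrightarrow> v b \<bullet> v c = (if b = c then 1 else 0)"
  shows "distr gauss borel (\<lambda>a. \<Sum>b\<in>Basis. (a \<bullet> v b) *\<^sub>R b) = (gauss :: 'b measure)"
proof -
  have inj: "inj_on v Basis"
    by (rule inj_onI) (metis v zero_neq_one)
  obtain B where B: "v ` Basis \<subseteq> B" "pairwise orthogonal B" "\<And>x. x \<in> B \<Longrightarrow> norm x = 1"
    "finite B" "card B = DIM('a)" "span B = UNIV"
    by (rule orthonormal_extend[of "v ` Basis"]) (use v in \<open>auto simp: pairwise_def orthogonal_def norm_eq_1\<close>)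
  obtain h where h: "bij_betw h B (Basis :: 'a set)"
    using finite_same_card_bij[OF B(4) finite_Basis] B(5) by auto
  have hB: "h b \<in> Basis" if "b \<in> B" for b using h that by (auto simp: bij_betw_def)
  have hinj: "h b = h c \<longleftrightarrow> b = c" if "b \<in> B" "c \<in> B" for b c
    using h that by (auto simp: bij_betw_def inj_on_def)
  \<comment> \<open>The rotation that carries the orthonormal basis \<open>B\<close> to the standard
    basis.\<close>
  define Q where "Q x = (\<Sum>b\<in>B. (x \<bullet> b) *\<^sub>R h b)" for x :: 'a
  have linQ: "linear Q"
    by (auto intro!: linearI simp: Q_def inner_add_left scaleR_add_left sum.distrib scaleR_sum_right)
  have Qh: "Q x \<bullet> h b = x \<bullet> b" if "b \<in> B" for x b
    using that B(4) hB hinj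
    by (simp add: Q_def inner_sum_left inner_Basis if_distrib sum.delta cong: if_cong)
  have QQ: "Q x \<bullet> Q y = x \<bullet> y" for x y
  proof -
    have "Q x \<bullet> Q y = (\<Sum>b\<in>B. (y \<bullet> b) * (Q x \<bullet> h b))"
      by (simp add: Q_def[of y] inner_sum_right)
    also have "\<dots> = (\<Sum>b\<in>B. (y \<bullet> b) * (x \<bullet> b))" by (simp add: Qh)
    also have "\<dots> = y \<bullet> x" by (rule orthonormal_sum_inner) (use B in auto)
    finally show ?thesis by (simp add: inner_commute)
  qed
  have orthQ: "orthogonal_transformation Q"
    using linQ QQ by (simp add: orthogonal_transformation_def)
  define \<iota> where "\<iota> b = h (v b)" for b
  have \<iota>: "inj_on \<iota> Basis" "\<iota> \<in> Basis \<rightarrow> Basis"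
    using inj hinj hB B(1) by (auto simp: \<iota>_def inj_on_def image_subset_iff)
  have fm[measurable]: "Q \<in> borel_measurable borel"
    by (intro borel_measurable_continuous_onI linear_continuous_on linear_conv_bounded_linear[THEN iffD1] linQ)
  have LQ: "(\<Sum>b\<in>Basis. (a \<bullet> v b) *\<^sub>R b) = (\<Sum>b\<in>Basis. (Q a \<bullet> \<iota> b) *\<^sub>R b)" for a
    using B(1) by (intro sum.cong) (auto simp: \<iota>_def Qh)
  let ?L = "\<lambda>a :: 'a. \<Sum>b\<in>Basis. (a \<bullet> \<iota> b) *\<^sub>R b :: 'b"
  let ?N = "density lborel std_normal_density"
  have p: "prob_space ?N" using prob_space_normal_density[of 1 0] by simp
  have "distr gauss borel (\<lambda>a. \<Sum>b\<in>Basis. (a \<bullet> v b) *\<^sub>R b) = distr (distr gauss borel Q) borel ?L"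
    unfolding LQ by (subst distr_distr) (auto simp: comp_def)
  also have "\<dots> = distr gauss borel ?L"
    by (simp add: gauss_distr_orthogonal[OF orthQ])
  also have "\<dots> = distr (\<Pi>\<^sub>M b\<in>Basis. ?N) borel (\<lambda>f. ?L (\<Sum>b\<in>Basis. f b *\<^sub>R b))"
    unfolding gauss_eq_PiM by (subst distr_distr) (auto simp: comp_def cong: measurable_cong_sets)
  also have "(\<lambda>f. ?L (\<Sum>b\<in>Basis. f b *\<^sub>R b)) = (\<lambda>f. \<Sum>b\<in>Basis. f (\<iota> b) *\<^sub>R b)"
    using \<iota>(2) by (intro ext sum.cong refl)
      (auto simp: inner_sum_left inner_Basis if_distrib sum.delta Pi_iff cong: if_cong)
  also have "distr (\<Pi>\<^sub>M b\<in>Basis. ?N) borel (\<lambda>f. \<Sum>b\<in>Basis. f (\<iota> b) *\<^sub>R b)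
     = distr (distr (\<Pi>\<^sub>M b\<in>Basis. ?N) (\<Pi>\<^sub>M b\<in>Basis. ?N) (\<lambda>\<omega>. \<lambda>b\<in>Basis. \<omega> (\<iota> b))) borel (\<lambda>f. \<Sum>b\<in>Basis. f b *\<^sub>R (b::'b))"
    using \<iota>(2) by (subst distr_distr) (auto intro!: measurable_restrict measurable_component_singleton
        simp: comp_def cong: measurable_cong_sets)
  also have "distr (\<Pi>\<^sub>M b\<in>(Basis::'a set). ?N) (\<Pi>\<^sub>M b\<in>(Basis::'b set). ?N) (\<lambda>\<omega>. \<lambda>b\<in>Basis. \<omega> (\<iota> b)) = (\<Pi>\<^sub>M b\<in>(Basis::'b set). ?N)"
    by (rule distr_PiM_reindex) (use p \<iota> in auto)
  finally show ?thesis by (simp add: gauss_eq_PiM)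
qed


lemma gauss_distr_Pair:
  "(gauss :: 'a::euclidean_space measure) \<Otimes>\<^sub>M (gauss :: 'b::euclidean_space measure) = gauss"
proof -
  have "(gauss :: 'a measure) \<Otimes>\<^sub>M (gauss :: 'b measure)
      = density (lborel \<Otimes>\<^sub>M lborel) (\<lambda>(x, y). ennreal (gauss_dens x) * ennreal (gauss_dens y))"
    unfolding gauss_def
    using prob_space_gauss[where ?'a='b] unfolding gauss_def
    by (intro pair_measure_density) (auto intro: prob_space_imp_sigma_finite sigma_finite_lborel)
  also have "(\<lambda>(x :: 'a, y :: 'b). ennreal (gauss_dens x) * ennreal (gauss_dens y)) = (\<lambda>z. ennreal (gauss_dens z))"
    by (auto simp: fun_eq_iff gauss_dens_Pair ennreal_mult)
  finally show ?thesis by (simp add: lborel_prod gauss_def)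
qed

lemma nn_integral_gauss:
  assumes [measurable]: "f \<in> borel_measurable borel"
  shows "(\<integral>\<^sup>+x. f x \<partial>gauss) = (\<integral>\<^sup>+x. ennreal (gauss_dens x) * f x \<partial>lborel)"
  unfolding gauss_def by (subst nn_integral_density) auto

lemma nn_integral_gauss_dens: "(\<integral>\<^sup>+x. ennreal (gauss_dens (x :: 'a::euclidean_space)) \<partial>lborel) = 1"
  using prob_space.emeasure_space_1[OF prob_space_gauss[where ?'a='a]]
  by (simp add: gauss_def emeasure_density)

text \<open>By symmetry of the Gaussian this is the density at \<open>c\<close> of a sum of two
  independent centered Gaussians with variances 1 and \<open>q\<^sup>2\<close> in each direction,
  hence of a Gaussian with variance \<open>1 + q\<^sup>2\<close>.\<close>

lemma nn_integral_gauss_dens_affine: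
  fixes c :: "'a::euclidean_space"
  shows "(\<integral>\<^sup>+y. ennreal (gauss_dens (c + q *\<^sub>R y)) \<partial>gauss)
     = ennreal (gauss_dens (c /\<^sub>R sqrt (1 + q\<^sup>2)) / sqrt (1 + q\<^sup>2) ^ DIM('a))"
proof -
  define s where "s = sqrt (1 + q\<^sup>2)"
  have "1 + q\<^sup>2 > 0" by (simp add: add_pos_nonneg)
  then have s: "s > 0" "s\<^sup>2 = 1 + q\<^sup>2" "s \<noteq> 0" by (auto simp: s_def)
  \<comment> \<open>Completing the square in \<open>y\<close>: the product splits into a factor
    depending on \<open>c\<close> alone and a shifted Gaussian in
    \<open>s *\<^sub>R y\<close>.\<close>
  have key: "gauss_dens y * gauss_dens (c + q *\<^sub>R y) = gauss_dens (c /\<^sub>R s) * gauss_dens (s *\<^sub>R y + (q / s) *\<^sub>R c)" for y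
  proof -
    have "(norm y)\<^sup>2 + (norm (c + q *\<^sub>R y))\<^sup>2 = (norm (c /\<^sub>R s))\<^sup>2 + (norm (s *\<^sub>R y + (q / s) *\<^sub>R c))\<^sup>2"
    proof -
      have "(norm (c /\<^sub>R s))\<^sup>2 + (norm (s *\<^sub>R y + (q / s) *\<^sub>R c))\<^sup>2
          = (c \<bullet> c) * ((1 + q\<^sup>2) / s\<^sup>2) + s\<^sup>2 * (y \<bullet> y) + 2 * q * (y \<bullet> c)"
        using s(3) unfolding power2_norm_eq_inner
        by (simp add: inner_add_left inner_add_right inner_commute power2_eq_square field_simps)
      also have "\<dots> = (c \<bullet> c) + (1 + q\<^sup>2) * (y \<bullet> y) + 2 * q * (y \<bullet> c)"
        using s by (simp add: s(2)[symmetric])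
      also have "\<dots> = (norm y)\<^sup>2 + (norm (c + q *\<^sub>R y))\<^sup>2"
        unfolding power2_norm_eq_inner
        by (simp add: inner_add_left inner_add_right inner_commute power2_eq_square algebra_simps)
      finally show ?thesis ..
    qed
    then show ?thesis
      by (simp add: gauss_dens_def exp_add[symmetric] add_divide_distrib[symmetric])
  qed
  have eq: "(lborel :: 'a measure) = density (distr lborel borel (\<lambda>x. (- q / s\<^sup>2) *\<^sub>R c + (1 / s) *\<^sub>R x)) (\<lambda>_. \<bar>1 / s\<bar> ^ DIM('a))"
    using s by (intro lborel_affine) auto
  have "(\<integral>\<^sup>+y. ennreal (gauss_dens (c + q *\<^sub>R y)) \<partial>gauss)
     = (\<integral>\<^sup>+y. ennreal (gauss_dens (c /\<^sub>R s)) * ennreal (gauss_dens (s *\<^sub>R y + (q / s) *\<^sub>R c)) \<partial>lborel)"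
    by (subst nn_integral_gauss) (auto simp: key ennreal_mult[symmetric])
  also have "\<dots> = ennreal (gauss_dens (c /\<^sub>R s)) * (\<integral>\<^sup>+y. ennreal (gauss_dens (s *\<^sub>R y + (q / s) *\<^sub>R c)) \<partial>lborel)"
    by (subst nn_integral_cmult) auto
  also have "(\<integral>\<^sup>+y. ennreal (gauss_dens (s *\<^sub>R y + (q / s) *\<^sub>R c)) \<partial>lborel)
     = (\<integral>\<^sup>+x. ennreal (\<bar>1 / s\<bar> ^ DIM('a)) * ennreal (gauss_dens (x :: 'a)) \<partial>lborel)"
    using s(3)
    by (subst eq) (simp add: nn_integral_density nn_integral_distr algebra_simps power2_eq_square)
  also have "\<dots> = ennreal (\<bar>1 / s\<bar> ^ DIM('a))"
    by (subst nn_integral_cmult) (auto simp: nn_integral_gauss_dens)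
  finally show ?thesis using s(1)
    by (simp add: s_def[symmetric] ennreal_mult[symmetric] power_divide power_one_over)
qed

section \<open>Gaussian matrices and their determinants\<close>

lemma borel_measurable_det [measurable]:
  "(\<lambda>G :: real ^ 'n ^ 'n. det G) \<in> borel_measurable borel"
proof -
  have [measurable]: "(\<lambda>G :: real ^ 'n ^ 'n. G $ i $ j) \<in> borel_measurable borel" for i j
    by (intro borel_measurable_continuous_onI continuous_intros)
  show ?thesis unfolding det_def by measurable
qed

lemma borel_measurable_matrix_vector_mult [measurable]:
  "(\<lambda>A :: real ^ 'm ^ 'n. A *v x) \<in> borel_measurable borel"
  by (intro borel_measurable_continuous_onI linear_continuous_on linear_conv_bounded_linear[THEN iffD1])
     (auto intro!: linearI simp: matrix_vector_mult_add_rdistrib scaleR_matrix_vector_assoc)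

lemma borel_measurable_matrix_matrix_mult [measurable]:
  "(\<lambda>A :: real ^ 'm ^ 'n. A ** (B :: real ^ 'k ^ 'm)) \<in> borel_measurable borel"
  by (intro borel_measurable_continuous_onI linear_continuous_on linear_conv_bounded_linear[THEN iffD1])
     (auto intro!: linearI simp: vec_eq_iff matrix_matrix_mult_def sum_distrib_left mult.assoc distrib_right sum.distrib)

text \<open>The value at \<open>t = 0\<close> of the integral in
  \<open>nn_integral_gauss_det\<close>: the expectation of the absolute determinant times
  \<open>gauss_dens 0\<close>.\<close>

definition det_moment :: "'n::finite itself \<Rightarrow> ennreal" where
  "det_moment _ = (\<integral>\<^sup>+G. ennreal \<bar>det (G :: real ^ 'n ^ 'n)\<bar> \<partial>gauss) / ennreal (sqrt (2 * pi) ^ CARD('n))"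

text \<open>Right multiplication by \<open>transpose Q\<close> applies \<open>Q\<close> to every
  row, and the inner product of matrices is the sum over rows.\<close>

lemma orthogonal_transformation_mult_matrix:
  fixes Q :: "real ^ 'n ^ 'n"
  assumes Q: "orthogonal_matrix Q"
  shows "orthogonal_transformation (\<lambda>G :: real ^ 'n ^ 'm. G ** transpose Q)"
proof -
  have lin: "linear (\<lambda>G :: real ^ 'n ^ 'm. G ** transpose Q)"
    by (auto intro!: linearI simp: vec_eq_iff matrix_matrix_mult_def sum_distrib_left mult.assoc distrib_right sum.distrib)
  have oQ: "orthogonal_transformation (\<lambda>v. Q *v v)"
    using Q by (simp add: orthogonal_transformation_matrix)
  have row: "(G ** transpose Q) $ i = Q *v (G $ i)" for G :: "real ^ 'n ^ 'm" and i
    by (simp add: vec_eq_iff matrix_matrix_mult_def matrix_vector_mult_def transpose_def mult.commute)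
  have "(G ** transpose Q) \<bullet> (H ** transpose Q) = G \<bullet> H" for G H :: "real ^ 'n ^ 'm"
    using oQ by (simp add: inner_vec_def[of "G ** transpose Q"] inner_vec_def[of G] row orthogonal_transformation_def
        del: inner_vec_def)
  then show ?thesis using lin by (simp add: orthogonal_transformation_def)
qed

lemma prod_Basis_matrix:
  "(\<Prod>b\<in>(Basis :: (real ^ 'n ^ 'm) set). g b) = (\<Prod>i\<in>UNIV. \<Prod>j\<in>UNIV. g (axis i (axis j 1)))"
proof -
  have 1: "(Basis :: (real ^ 'n ^ 'm) set) = (\<lambda>(i, j). axis i (axis j 1)) ` (UNIV \<times> UNIV)"
    by (auto simp: Basis_vec_def)
  have 2: "inj_on (\<lambda>(i, j). axis i (axis j 1) :: real ^ 'n ^ 'm) (UNIV \<times> UNIV)"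
    by (auto simp: inj_on_def axis_eq_axis)
  show ?thesis
    unfolding 1 by (subst prod.reindex[OF 2]) (simp add: prod.cartesian_product comp_def split_beta)
qed

lemma det_scale_column:
  fixes G :: "real ^ 'n ^ 'n"
  shows "det (\<chi> i j. (if j = a then s else 1) * G $ i $ j) = s * det G"
proof -
  have "det (\<chi> i j. (if j = a then s else 1) * G $ i $ j)
      = det (transpose (\<chi> i j. (if j = a then s else 1) * G $ i $ j))" by simp
  also have "transpose (\<chi> i j. (if j = a then s else 1) * G $ i $ j)
      = (\<chi> j. (if j = a then s *s row a (transpose G) else row j (transpose G)))"
    by (simp add: vec_eq_iff transpose_def row_def)
  also have "det \<dots> = s * det (\<chi> j. (if j = a then row a (transpose G) else row j (transpose G)))"
    by (rule det_row_mul)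
  also have "(\<chi> j. (if j = a then row a (transpose G) else row j (transpose G))) = transpose G"
    by (simp add: vec_eq_iff transpose_def row_def)
  finally show ?thesis by simp
qed

text \<open>\<open>G *v axis a r\<close> is \<open>r\<close> times column \<open>a\<close>, so the
  extra factor only changes the variance of that column. Rescaling the column by \<open>s\<close>
  restores the standard Gaussian; the substitution contributes one factor \<open>s\<close> for each
  entry of the column and one more through the determinant, which explains the exponent
  \<open>CARD('n) + 1\<close>.\<close>

lemma nn_integral_gauss_det_axis:
  fixes a :: "'n::finite" and r :: real
  shows "(\<integral>\<^sup>+G. ennreal (gauss_dens (G *v axis a r)) * ennreal \<bar>det (G :: real ^ 'n ^ 'n)\<bar> \<partial>gauss)
    = det_moment TYPE('n) / ennreal (sqrt (1 + r\<^sup>2) ^ (CARD('n) + 1))"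
proof -
  define s where "s = 1 / sqrt (1 + r\<^sup>2)"
  have s0: "s > 0" and s2: "s\<^sup>2 * (1 + r\<^sup>2) = 1"
    by (auto simp: s_def power_divide add_pos_nonneg add_nonneg_eq_0_iff)
  define T where "T G = (\<chi> i j. (if j = a then s else 1) * G $ i $ j)" for G :: "real ^ 'n ^ 'n"
  define c where "c b = (if \<exists>i. b = axis i (axis a 1) then s else 1)" for b :: "real ^ 'n ^ 'n"
  have c_axis: "c (axis i (axis j 1)) = (if j = a then s else 1)" for i j
    by (auto simp: c_def axis_eq_axis)
  have T: "T G = 0 + (\<Sum>b\<in>Basis. (c b * (G \<bullet> b)) *\<^sub>R b)" for G
  proof -
    have "c b * (G \<bullet> b) = T G \<bullet> b" if "b \<in> Basis" for b
    proof -
      obtain i j where b: "b = axis i (axis j 1)" using \<open>b \<in> Basis\<close> by (auto simp: Basis_vec_def)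
      show ?thesis unfolding b by (simp add: c_axis inner_axis T_def)
    qed
    then have "(\<Sum>b\<in>Basis. (c b * (G \<bullet> b)) *\<^sub>R b) = (\<Sum>b\<in>Basis. (T G \<bullet> b) *\<^sub>R b)"
      by (intro sum.cong) auto
    then show ?thesis by (simp add: euclidean_representation)
  qed
  have TT: "T = (\<lambda>G. 0 + (\<Sum>b\<in>Basis. (c b * (G \<bullet> b)) *\<^sub>R b))"
    by (rule ext) (rule T)
  have "lborel = density (distr lborel borel (\<lambda>G. 0 + (\<Sum>b\<in>Basis. (c b * (G \<bullet> b)) *\<^sub>R b))) (\<lambda>_. (\<Prod>b\<in>Basis. \<bar>c b\<bar>))"
    using s0 by (intro lborel_affine_euclidean) (auto simp: c_def)
  also have "(\<Prod>b\<in>Basis. \<bar>c b\<bar>) = s ^ CARD('n)"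
    unfolding prod_Basis_matrix using s0 by (simp add: c_axis if_distrib prod.delta cong: if_cong)
  finally have lb: "(lborel :: (real ^ 'n ^ 'n) measure) = density (distr lborel borel T) (\<lambda>_. ennreal (s ^ CARD('n)))"
    by (simp only: TT)
  have Tm[measurable]: "T \<in> borel_measurable borel"
    unfolding TT by measurable
  have key: "gauss_dens (T G) * gauss_dens (T G *v axis a r) = gauss_dens G / sqrt (2 * pi) ^ CARD('n)" for G
  proof -
    have mv: "(H *v axis a r) $ i = r * H $ i $ a" for H :: "real ^ 'n ^ 'n" and i
      by (simp add: matrix_vector_mult_def axis_def sum.delta if_distrib cong: if_cong)
    have "(norm (T G $ i))\<^sup>2 + (r * T G $ i $ a)\<^sup>2 = (norm (G $ i))\<^sup>2" for i
    proof -
      have "(norm (T G $ i))\<^sup>2 = (\<Sum>j\<in>UNIV. (if j = a then s\<^sup>2 else 1) * (G $ i $ j)\<^sup>2)"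
        unfolding sum_norm_vec by (intro sum.cong) (auto simp: T_def power_mult_distrib)
      also have "\<dots> = s\<^sup>2 * (G $ i $ a)\<^sup>2 + (\<Sum>j\<in>UNIV - {a}. (G $ i $ j)\<^sup>2)"
        by (subst sum.remove[of _ a]) (auto intro!: sum.cong)
      finally have "(norm (T G $ i))\<^sup>2 + (r * T G $ i $ a)\<^sup>2
         = (s\<^sup>2 * (1 + r\<^sup>2)) * (G $ i $ a)\<^sup>2 + (\<Sum>j\<in>UNIV - {a}. (G $ i $ j)\<^sup>2)"
        by (simp add: T_def power_mult_distrib algebra_simps)
      also have "\<dots> = (norm (G $ i))\<^sup>2"
        unfolding sum_norm_vec s2 by (subst (2) sum.remove[of _ a]) auto
      finally show ?thesis .
    qed
    then have "(norm (T G))\<^sup>2 + (norm (T G *v axis a r))\<^sup>2 = (norm G)\<^sup>2"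
      unfolding sum_norm_vec[of "T G"] sum_norm_vec[of "T G *v axis a r"] sum_norm_vec[of G]
      by (simp add: mv sum.distrib[symmetric] del: norm_vec_def)
    then show ?thesis
      by (simp add: gauss_dens_def exp_add[symmetric] add_divide_distrib[symmetric])
  qed
  have "(\<integral>\<^sup>+G. ennreal (gauss_dens (G *v axis a r)) * ennreal \<bar>det (G :: real ^ 'n ^ 'n)\<bar> \<partial>gauss)
     = (\<integral>\<^sup>+G. ennreal (gauss_dens G * gauss_dens (G *v axis a r) * \<bar>det (G :: real ^ 'n ^ 'n)\<bar>) \<partial>lborel)"
    by (subst nn_integral_gauss) (auto simp: ennreal_mult mult.assoc)
  also have "\<dots> = (\<integral>\<^sup>+G. ennreal (s ^ CARD('n)) *
       ennreal (gauss_dens (T G) * gauss_dens (T G *v axis a r) * \<bar>det (T G)\<bar>) \<partial>lborel)"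
    by (subst lb) (simp add: nn_integral_density nn_integral_distr)
  also have "\<dots> = (\<integral>\<^sup>+G. ennreal (s ^ (CARD('n) + 1)) / ennreal (sqrt (2 * pi) ^ CARD('n)) *
       (ennreal (gauss_dens G) * ennreal \<bar>det (G :: real ^ 'n ^ 'n)\<bar>) \<partial>lborel)"
  proof (rule nn_integral_cong)
    fix G :: "real ^ 'n ^ 'n"
    have "det (T G) = s * det G" unfolding T_def by (rule det_scale_column)
    then have "s ^ CARD('n) * (gauss_dens (T G) * gauss_dens (T G *v axis a r) * \<bar>det (T G)\<bar>)
      = s ^ (CARD('n) + 1) / (sqrt (2 * pi) ^ CARD('n)) * (gauss_dens G * \<bar>det G\<bar>)"
      using s0 by (simp add: key abs_mult)
    then show "ennreal (s ^ CARD('n)) * ennreal (gauss_dens (T G) * gauss_dens (T G *v axis a r) * \<bar>det (T G)\<bar>)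
      = ennreal (s ^ (CARD('n) + 1)) / ennreal (sqrt (2 * pi) ^ CARD('n)) * (ennreal (gauss_dens G) * ennreal \<bar>det G\<bar>)"
      using s0 by (simp add: ennreal_mult[symmetric] divide_ennreal)
  qed
  also have "\<dots> = ennreal (s ^ (CARD('n) + 1)) / ennreal (sqrt (2 * pi) ^ CARD('n)) *
      (\<integral>\<^sup>+G. ennreal \<bar>det (G :: real ^ 'n ^ 'n)\<bar> \<partial>gauss)"
    by (subst nn_integral_cmult) (auto simp: nn_integral_gauss)
  also have "\<dots> = det_moment TYPE('n) * ennreal (s ^ (CARD('n) + 1))"
    by (simp add: det_moment_def divide_ennreal_def ac_simps)
  also have "ennreal (s ^ (CARD('n) + 1)) = inverse (ennreal (sqrt (1 + r\<^sup>2) ^ (CARD('n) + 1)))"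
    by (subst inverse_ennreal) (auto simp: s_def power_one_over add_pos_nonneg divide_inverse power_inverse simp del: power_Suc)
  finally show ?thesis by (simp add: divide_ennreal_def)
qed

text \<open>Rotating the rows of \<open>G\<close> preserves the Gaussian and the absolute
  determinant, so only \<open>norm t\<close> matters and \<open>t\<close> may be moved onto a
  coordinate axis.\<close>

lemma nn_integral_gauss_det:
  fixes t :: "real ^ 'n"
  shows "(\<integral>\<^sup>+G. ennreal (gauss_dens (G *v t)) * ennreal \<bar>det (G :: real ^ 'n ^ 'n)\<bar> \<partial>gauss)
    = det_moment TYPE('n) / ennreal (sqrt (1 + (norm t)\<^sup>2) ^ (CARD('n) + 1))"
proof -
  \<comment> \<open>The axis is arbitrary: the value found for it depends only on the length along
    it.\<close>
  define a :: 'n where "a = undefined"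
  have "norm (axis a (norm t) :: real ^ 'n) = norm t" by (simp add: norm_eq_sqrt_inner inner_axis_axis)
  then obtain f where f: "orthogonal_transformation f" "f t = axis a (norm t)"
    using orthogonal_transformation_exists[of t "axis a (norm t)"] by metis
  define Q where "Q = matrix f"
  have Q: "orthogonal_matrix Q" and Qt: "Q *v t = axis a (norm t)"
    using f by (auto simp: Q_def orthogonal_transformation_matrix)
  have QQ: "transpose Q ** Q = mat 1" using Q by (simp add: orthogonal_matrix)
  have Qv: "(G ** transpose Q) *v axis a (norm t) = G *v t" for G :: "real ^ 'n ^ 'n"
    by (simp add: Qt[symmetric] matrix_vector_mul_assoc matrix_mul_assoc[symmetric] QQ)
  have dQ: "\<bar>det (G ** transpose Q)\<bar> = \<bar>det G\<bar>" for G :: "real ^ 'n ^ 'n"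
    using det_orthogonal_matrix[OF Q] by (auto simp: det_mul)
  have "(\<integral>\<^sup>+G. ennreal (gauss_dens (G *v axis a (norm t))) * ennreal \<bar>det (G :: real ^ 'n ^ 'n)\<bar> \<partial>gauss)
     = (\<integral>\<^sup>+G. ennreal (gauss_dens (G *v axis a (norm t))) * ennreal \<bar>det (G :: real ^ 'n ^ 'n)\<bar> \<partial>distr gauss borel (\<lambda>G. G ** transpose Q))"
    by (simp add: gauss_distr_orthogonal[OF orthogonal_transformation_mult_matrix[OF Q]])
  also have "\<dots> = (\<integral>\<^sup>+G. ennreal (gauss_dens (G *v t)) * ennreal \<bar>det (G :: real ^ 'n ^ 'n)\<bar> \<partial>gauss)"
    by (subst nn_integral_distr) (auto simp: Qv dQ)
  finally show ?thesis by (simp add: nn_integral_gauss_det_axis)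
qed

lemma borel_measurable_fst_snd [measurable]:
  "(fst :: 'a::topological_space \<times> 'b::topological_space \<Rightarrow> 'a) \<in> borel_measurable borel"
  "(snd :: 'a::topological_space \<times> 'b::topological_space \<Rightarrow> 'b) \<in> borel_measurable borel"
  by (intro borel_measurable_continuous_onI continuous_on_fst continuous_on_snd continuous_on_id)+

text \<open>The hypotheses make \<open>v\<close> the adjoint of \<open>L\<close> and an isometric
  embedding, which is the situation of \<open>gauss_distr_coisometry\<close> in a form that mentions
  no basis.\<close>

lemma gauss_distr_adjoint:
  fixes L :: "'a::euclidean_space \<Rightarrow> 'b::euclidean_space"
  assumes adj: "\<And>a b. a \<bullet> v b = L a \<bullet> b" and id: "\<And>b. L (v b) = b"
  shows "distr gauss borel L = gauss"
proof -
  have "L = (\<lambda>a. \<Sum>b\<in>Basis. (a \<bullet> v b) *\<^sub>R b)"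
    by (simp add: fun_eq_iff adj euclidean_representation)
  moreover have "v b \<bullet> v c = (if b = c then 1 else 0)" if "b \<in> Basis" "c \<in> Basis" for b c
    using that by (simp add: adj id inner_Basis)
  ultimately show ?thesis using gauss_distr_coisometry[of v] by simp
qed

text \<open>On each line of matrices \<open>mat s + G\<close> the determinant is a nonzero
  polynomial in \<open>s\<close> and vanishes only finitely often. Averaging over translations with
  \<open>s\<close> in the unit interval leaves Lebesgue measure unchanged, and Fubini's theorem then
  shows the singular matrices to be a null set.\<close>

lemma AE_det_nonzero: "AE G in lborel. det (G :: real ^ 'n ^ 'n) \<noteq> 0"
proof -
  define Z where "Z = {G :: real ^ 'n ^ 'n. det G = 0}"
  have Z[measurable]: "Z \<in> sets borel" unfolding Z_def by measurable
  have fin: "finite {s. mat s + G \<in> Z}" for G :: "real ^ 'n ^ 'n"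
  proof -
    have entry: "real_polynomial_function (\<lambda>s. (mat s + G) $ i $ j)" for i j
    proof (cases "i = j")
      case True
      then show ?thesis
        by (auto simp: mat_def intro!: real_polynomial_function.intros(3)[OF real_polynomial_function.intros(1,2)] bounded_linear_ident)
    next
      case False
      then show ?thesis by (simp add: mat_def real_polynomial_function.intros(2))
    qed
    have "real_polynomial_function (\<lambda>s. det (mat s + G))"
      unfolding det_def
      by (intro real_polynomial_function_sum real_polynomial_function.intros(4) real_polynomial_function_prod
          real_polynomial_function.intros(2) entry) auto
    then obtain a n where a: "(\<lambda>s. det (mat s + G)) = (\<lambda>s. \<Sum>i\<le>n. a i * s ^ i)"
      using real_polynomial_function_imp_sum by blast
    \<comment> \<open>For \<open>s = K + 1\<close>, beyond the operator bound \<open>K\<close> of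
      \<open>G\<close>, the term \<open>mat s\<close> dominates and the matrix is invertible, so the
      polynomial is not identically zero.\<close>
    obtain K where K: "K > 0" "\<And>v. norm (G *v v) \<le> norm v * K"
      using bounded_linear.pos_bounded[OF matrix_vector_mul_bounded_linear[of G]] by blast
    have "det (mat (K + 1) + G) \<noteq> 0"
    proof -
      have "v = 0" if "(mat (K + 1) + G) *v v = 0" for v
      proof -
        have "mat (K + 1) *v v = (K + 1) *\<^sub>R v"
          by (simp add: vec_eq_iff matrix_vector_mult_def mat_def if_distrib if_distribR sum.delta cong: if_cong)
        with that have "(K + 1) *\<^sub>R v = - (G *v v)"
          by (simp add: matrix_vector_mult_add_rdistrib eq_neg_iff_add_eq_0)
        then have "norm ((K + 1) *\<^sub>R v) = norm (G *v v)" by simp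
        with K(2)[of v] K(1) have "norm v * (K + 1) \<le> norm v * K" by (simp add: mult.commute)
        then have "norm v \<le> 0" by (simp add: algebra_simps)
        then show ?thesis by simp
      qed
      then have "invertible (mat (K + 1) + G)"
        unfolding invertible_left_inverse matrix_left_invertible_ker by blast
      then show ?thesis by (simp add: invertible_det_nz)
    qed
    then have "(\<Sum>i\<le>n. a i * (K + 1) ^ i) \<noteq> 0" using fun_cong[OF a, of "K + 1"] by simp
    then obtain k where k: "k \<le> n" "a k \<noteq> 0"
      by (metis (no_types, lifting) atMost_iff mult_zero_left sum.neutral)
    have "{s. mat s + G \<in> Z} = {s. (\<Sum>i\<le>n. a i * s ^ i) = 0}"
      using a by (auto simp: Z_def fun_eq_iff)
    then show ?thesis using polyfun_rootbound_finite[of n a] k by auto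
  qed
  have mm: "(\<lambda>p :: real \<times> (real ^ 'n ^ 'n). mat (fst p) + snd p) \<in> borel_measurable borel"
    by (intro borel_measurable_continuous_onI continuous_on_add continuous_on_snd continuous_on_id)
       (simp add: mat_def continuous_on_vec_lambda, rule continuous_on_vec_lambda, rule continuous_on_vec_lambda,
        rename_tac i j, case_tac "i = j", auto intro!: continuous_intros)
  have "emeasure lborel Z = (\<integral>\<^sup>+s. emeasure lborel Z * indicator {0..1} (s::real) \<partial>lborel)"
    by (simp add: nn_integral_cmult)
  also have "\<dots> = (\<integral>\<^sup>+s. (\<integral>\<^sup>+G. indicator Z (mat s + G) * indicator {0..1} (s::real) \<partial>lborel) \<partial>lborel)"
  proof (rule nn_integral_cong)
    fix s :: real
    have "emeasure lborel Z = (\<integral>\<^sup>+G. indicator Z G \<partial>distr lborel borel ((+) (mat s)))"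
      by (simp add: lborel_distr_plus)
    also have "\<dots> = (\<integral>\<^sup>+G. indicator Z (mat s + G) \<partial>lborel)"
      by (subst nn_integral_distr) auto
    finally show "emeasure lborel Z * indicator {0..1} s = (\<integral>\<^sup>+G. indicator Z (mat s + G) * indicator {0..1} s \<partial>lborel)"
      by (simp add: indicator_def)
  qed
  also have "\<dots> = (\<integral>\<^sup>+G. (\<integral>\<^sup>+s. indicator Z (mat s + G) * indicator {0..1} (s::real) \<partial>lborel) \<partial>lborel)"
  proof (rule lborel_pair.Fubini'[symmetric])
    have "(\<lambda>p :: real \<times> (real ^ 'n ^ 'n). indicator Z (mat (fst p) + snd p) :: ennreal) \<in> borel_measurable borel"
      by (rule measurable_compose[OF mm]) simp
    moreover have "(\<lambda>p :: real \<times> (real ^ 'n ^ 'n). indicator {0..1} (fst p) :: ennreal) \<in> borel_measurable borel"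
      by (rule measurable_compose[OF borel_measurable_fst_snd(1)]) simp
    ultimately have "(\<lambda>p :: real \<times> (real ^ 'n ^ 'n). indicator Z (mat (fst p) + snd p) * indicator {0..1} (fst p) :: ennreal) \<in> borel_measurable borel"
      by (rule borel_measurable_times_ennreal)
    then show "(\<lambda>(s, G). indicator Z (mat s + G) * indicator {0..1} s :: ennreal) \<in> borel_measurable (lborel \<Otimes>\<^sub>M lborel)"
      by (simp add: lborel_prod split_beta)
  qed
  also have "\<dots> = (\<integral>\<^sup>+(G :: real ^ 'n ^ 'n). 0 \<partial>lborel)"
  proof (rule nn_integral_cong)
    fix G :: "real ^ 'n ^ 'n"
    have "AE s in lborel. s \<notin> {s. mat s + G \<in> Z}"
      using fin[of G] by (intro AE_not_in finite_imp_null_set_lborel)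
    then have "(\<integral>\<^sup>+s. indicator Z (mat s + G) * indicator {0..1} (s::real) \<partial>lborel) = (\<integral>\<^sup>+(s::real). 0 \<partial>lborel)"
      by (intro nn_integral_cong_AE) (auto elim!: eventually_mono simp: indicator_def)
    then show "(\<integral>\<^sup>+s. indicator Z (mat s + G) * indicator {0..1} (s::real) \<partial>lborel) = 0" by simp
  qed
  finally have "Z \<in> null_sets lborel" by (auto simp: null_sets_def)
  then have "AE G in lborel. G \<notin> Z" by (rule AE_not_in)
  then show ?thesis by (simp add: Z_def)
qed

section \<open>The normalizing constant of the Cauchy density\<close>

lemma nn_integral_lborel_scale:
  fixes f :: "'a::euclidean_space \<Rightarrow> ennreal"
  assumes [measurable]: "f \<in> borel_measurable borel" and c: "c \<noteq> 0"
  shows "(\<integral>\<^sup>+x. f x \<partial>lborel) = ennreal (\<bar>c\<bar> ^ DIM('a)) * (\<integral>\<^sup>+x. f (c *\<^sub>R x) \<partial>lborel)"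
  by (subst lborel_affine[OF c, of 0]) (simp add: nn_integral_density nn_integral_distr nn_integral_cmult)

lemma nn_integral_exp_norm:
  fixes u :: real
  assumes u: "u > 0"
  shows "(\<integral>\<^sup>+t. ennreal (exp (- u * (norm (t :: 'a::euclidean_space))\<^sup>2)) \<partial>lborel) = ennreal (sqrt (pi / u) ^ DIM('a))"
proof -
  have s: "sqrt (2 * u) > 0" "sqrt (2 * u) \<noteq> 0" using u by auto
  have "exp (- u * (norm t)\<^sup>2) = sqrt (2 * pi) ^ DIM('a) * gauss_dens (sqrt (2 * u) *\<^sub>R t)" for t :: 'a
    using u by (simp add: gauss_dens_def power_mult_distrib)
  then have "(\<integral>\<^sup>+t. ennreal (exp (- u * (norm (t :: 'a))\<^sup>2)) \<partial>lborel)
    = ennreal (sqrt (2 * pi) ^ DIM('a)) * (\<integral>\<^sup>+t. ennreal (gauss_dens (sqrt (2 * u) *\<^sub>R (t :: 'a))) \<partial>lborel)" (is "_ = _ * ?I")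
    by (subst nn_integral_cmult[symmetric]) (auto simp: ennreal_mult)
  moreover have "1 = ennreal (sqrt (2 * u) ^ DIM('a)) * ?I"
    using nn_integral_lborel_scale[of "\<lambda>t :: 'a. ennreal (gauss_dens t)" "sqrt (2 * u)"] s
    by (simp add: nn_integral_gauss_dens)
  then have "ennreal (1 / sqrt (2 * u) ^ DIM('a)) = ennreal (1 / sqrt (2 * u) ^ DIM('a)) * (ennreal (sqrt (2 * u) ^ DIM('a)) * ?I)"
    by simp
  then have "?I = ennreal (1 / sqrt (2 * u) ^ DIM('a))"
    using s by (simp add: mult.assoc[symmetric] ennreal_mult[symmetric])
  ultimately show ?thesis
    using u by (simp add: ennreal_mult[symmetric] power_divide[symmetric] real_sqrt_divide[symmetric])
qed

text \<open>The substitution \<open>t = a * u\<close> in Euler's integral. It represents a negative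
  power of \<open>a\<close> as a superposition of exponentials, through which the Cauchy kernel
  becomes a mixture of Gaussians.\<close>

lemma Gamma_scaled:
  fixes a s :: real
  assumes a: "a > 0" and s: "s > 0"
  shows "ennreal (Gamma s * a powr (- s)) = (\<integral>\<^sup>+u. ennreal (indicator {0..} u * u powr (s - 1) * exp (- (a * u))) \<partial>lborel)"
proof -
  have "ennreal (Gamma s) = (\<integral>\<^sup>+t. ennreal (indicator {0..} t * t powr (s - 1) / exp t) \<partial>lborel)"
    using s by (rule Gamma_conv_nn_integral_real)
  also have "\<dots> = ennreal a * (\<integral>\<^sup>+u. ennreal (indicator {0..} (a * u) * (a * u) powr (s - 1) / exp (a * u)) \<partial>lborel)"
    using nn_integral_real_affine[of "\<lambda>t. ennreal (indicator {0..} t * t powr (s - 1) / exp t)" a 0] a by simp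
  also have "\<dots> = ennreal a * (\<integral>\<^sup>+u. ennreal (a powr (s - 1)) * ennreal (indicator {0..} u * u powr (s - 1) * exp (- (a * u))) \<partial>lborel)"
    using a by (intro arg_cong2[where f="(*)"] nn_integral_cong refl)
      (auto simp: ennreal_mult[symmetric] indicator_def zero_le_mult_iff powr_mult exp_minus field_simps)
  also have "\<dots> = ennreal (a powr s) * (\<integral>\<^sup>+u. ennreal (indicator {0..} u * u powr (s - 1) * exp (- (a * u))) \<partial>lborel)"
    using a by (subst nn_integral_cmult) (auto simp: mult.assoc[symmetric] ennreal_mult[symmetric] powr_diff)
  finally have eq: "ennreal (Gamma s) = ennreal (a powr s) * (\<integral>\<^sup>+u. ennreal (indicator {0..} u * u powr (s - 1) * exp (- (a * u))) \<partial>lborel)" (is "_ = _ * ?I") .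
  have "ennreal (Gamma s * a powr (- s)) = ennreal (a powr (- s)) * ennreal (Gamma s)"
    using s by (simp add: ennreal_mult[symmetric] Gamma_real_pos less_imp_le mult.commute)
  also have "\<dots> = ennreal (a powr (- s) * a powr s) * ?I"
    unfolding eq by (simp add: mult.assoc ennreal_mult)
  also have "a powr (- s) * a powr s = 1" using a by (simp add: powr_minus)
  finally show ?thesis by simp
qed

text \<open>The kernel is represented by \<open>Gamma_scaled\<close> and integrated over
  \<open>t\<close> before \<open>u\<close>. The Gaussian integral contributes \<open>u\<close> to
  the power of minus half the dimension, which reduces the exponent of \<open>u\<close> to -1/2 and
  leaves Gamma(1/2), the square root of \<pi>.\<close>

lemma nn_integral_cauchy_kernel:
  "ennreal (Gamma ((real DIM('a) + 1) / 2)) *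
     (\<integral>\<^sup>+t. inverse (ennreal (sqrt (1 + (norm (t :: 'a::euclidean_space))\<^sup>2) ^ (DIM('a) + 1))) \<partial>lborel)
   = ennreal (sqrt pi ^ (DIM('a) + 1))"
proof -
  define s where "s = (real DIM('a) + 1) / 2"
  have s: "s > 0" "s > 1 / 2" by (auto simp: s_def)
  have pos: "1 + (norm t)\<^sup>2 > 0" for t :: 'a by (simp add: add_pos_nonneg)
  have "ennreal (Gamma s) * (\<integral>\<^sup>+t. inverse (ennreal (sqrt (1 + (norm (t :: 'a))\<^sup>2) ^ (DIM('a) + 1))) \<partial>lborel)
     = (\<integral>\<^sup>+t. ennreal (Gamma s * (1 + (norm (t :: 'a))\<^sup>2) powr (- s)) \<partial>lborel)"
  proof (subst nn_integral_cmult[symmetric], measurable, rule nn_integral_cong)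
    fix t :: 'a
    have "sqrt (1 + (norm t)\<^sup>2) ^ (DIM('a) + 1) = (1 + (norm t)\<^sup>2) powr s"
      using pos[of t] by (simp add: powr_half_sqrt[symmetric] powr_realpow[symmetric] powr_powr s_def add.commute del: power_Suc)
    then show "ennreal (Gamma s) * inverse (ennreal (sqrt (1 + (norm t)\<^sup>2) ^ (DIM('a) + 1)))
        = ennreal (Gamma s * (1 + (norm t)\<^sup>2) powr (- s))"
      using pos[of t] s by (simp add: inverse_ennreal ennreal_mult[symmetric] Gamma_real_pos less_imp_le powr_minus)
  qed
  also have "\<dots> = (\<integral>\<^sup>+t. \<integral>\<^sup>+u. ennreal (indicator {0..} u * u powr (s - 1) * exp (- ((1 + (norm (t :: 'a))\<^sup>2) * u))) \<partial>lborel \<partial>lborel)"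
    by (intro nn_integral_cong Gamma_scaled pos s)
  also have "\<dots> = (\<integral>\<^sup>+u. \<integral>\<^sup>+t. ennreal (indicator {0..} u * u powr (s - 1) * exp (- ((1 + (norm (t :: 'a))\<^sup>2) * u))) \<partial>lborel \<partial>lborel)"
    by (rule lborel_pair.Fubini'[symmetric]) measurable
  also have "\<dots> = (\<integral>\<^sup>+u. ennreal (sqrt pi ^ DIM('a)) * ennreal (indicator {0..} u * u powr (1/2 - 1) * exp (- (1 * u))) \<partial>lborel)"
  proof (rule nn_integral_cong)
    fix u :: real
    consider "u < 0" | "u = 0" | "u > 0" by linarith
    then show "(\<integral>\<^sup>+t. ennreal (indicator {0..} u * u powr (s - 1) * exp (- ((1 + (norm (t :: 'a))\<^sup>2) * u))) \<partial>lborel)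
       = ennreal (sqrt pi ^ DIM('a)) * ennreal (indicator {0..} u * u powr (1/2 - 1) * exp (- (1 * u)))"
    proof cases
      case 3
      have "ennreal (indicator {0..} u * u powr (s - 1) * exp (- ((1 + (norm t)\<^sup>2) * u)))
         = ennreal (u powr (s - 1) * exp (- u)) * ennreal (exp (- u * (norm t)\<^sup>2))" for t :: 'a
        using 3 by (simp add: ennreal_mult[symmetric] exp_add[symmetric] algebra_simps)
      then have "(\<integral>\<^sup>+t. ennreal (indicator {0..} u * u powr (s - 1) * exp (- ((1 + (norm (t :: 'a))\<^sup>2) * u))) \<partial>lborel)
         = ennreal (u powr (s - 1) * exp (- u)) * ennreal (sqrt (pi / u) ^ DIM('a))"
        using nn_integral_exp_norm[OF 3, where ?'a='a] by (simp add: nn_integral_cmult)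
      also have "\<dots> = ennreal (sqrt pi ^ DIM('a) * (u powr (s - 1) / sqrt u ^ DIM('a)) * exp (- u))"
        using 3 by (simp add: ennreal_mult[symmetric] real_sqrt_divide power_divide mult_ac)
      also have "u powr (s - 1) / sqrt u ^ DIM('a) = u powr (1/2 - 1)"
        using 3 by (simp add: powr_half_sqrt[symmetric] powr_realpow[symmetric] powr_powr powr_diff[symmetric] s_def field_simps)
      finally show ?thesis using 3 by (simp add: ennreal_mult[symmetric] mult.assoc)
    qed (auto simp: indicator_def)
  qed
  also have "\<dots> = ennreal (sqrt pi ^ DIM('a)) * ennreal (Gamma (1/2) * 1 powr (- (1/2)))"
    by (subst Gamma_scaled) (auto simp: nn_integral_cmult)
  also have "\<dots> = ennreal (sqrt pi ^ (DIM('a) + 1))"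
    by (simp add: Gamma_one_half_real ennreal_mult[symmetric] mult.commute)
  finally show ?thesis by (simp add: s_def)
qed


lemma has_derivative_matrix_vector_mult:
  "((*v) (A :: real ^ 'n ^ 'm) has_derivative (*v) A) (at x within S)"
  by (intro bounded_linear_imp_has_derivative matrix_vector_mul_bounded_linear)

text \<open>
  Instead of computing the moment, integrate \<open>nn_integral_gauss_det\<close> over \<open>t\<close>: for invertible \<open>G\<close> the
  substitution \<open>y = G t\<close> turns its left-hand side into the total mass of a Gaussian.
\<close>

lemma det_moment_eq:
  "det_moment TYPE('n::finite) = ennreal (Gamma ((real CARD('n) + 1) / 2) / sqrt pi ^ (CARD('n) + 1))"
proof -
  let ?I = "\<integral>\<^sup>+t. inverse (ennreal (sqrt (1 + (norm (t :: real ^ 'n))\<^sup>2) ^ (CARD('n) + 1))) \<partial>lborel"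
  let ?\<Gamma> = "Gamma ((real CARD('n) + 1) / 2)"
  have G: "?\<Gamma> > 0" by (simp add: Gamma_real_pos)
  have [measurable]: "(\<lambda>p :: (real ^ 'n) \<times> (real ^ 'n ^ 'n). snd p *v fst p) \<in> borel_measurable borel"
    by (intro borel_measurable_continuous_onI)
       (auto simp: matrix_vector_mult_def continuous_on_vec_lambda intro!: continuous_intros)
  have [measurable]: "(\<lambda>p :: (real ^ 'n) \<times> (real ^ 'n ^ 'n). det (snd p)) \<in> borel_measurable borel"
    using measurable_compose[OF borel_measurable_continuous_onI[OF continuous_on_snd[OF continuous_on_id]] borel_measurable_det]
    by simp
  have "det_moment TYPE('n) * ?I =
    (\<integral>\<^sup>+t. det_moment TYPE('n) / ennreal (sqrt (1 + (norm (t :: real ^ 'n))\<^sup>2) ^ (CARD('n) + 1)) \<partial>lborel)"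
    by (simp add: nn_integral_cmult divide_ennreal_def)
  also have "\<dots> = (\<integral>\<^sup>+t. (\<integral>\<^sup>+G. ennreal (gauss_dens (G *v t)) * ennreal \<bar>det (G :: real ^ 'n ^ 'n)\<bar> \<partial>gauss) \<partial>lborel)"
    by (simp add: nn_integral_gauss_det)
  also have "\<dots> = (\<integral>\<^sup>+G. (\<integral>\<^sup>+t. ennreal (gauss_dens (G *v t)) * ennreal \<bar>det (G :: real ^ 'n ^ 'n)\<bar> \<partial>lborel) \<partial>gauss)"
  proof (rule pair_sigma_finite.Fubini'[symmetric])
    show "pair_sigma_finite (lborel :: (real ^ 'n) measure) (gauss :: (real ^ 'n ^ 'n) measure)"
      by (simp add: pair_sigma_finite_def sigma_finite_lborel prob_space_imp_sigma_finite prob_space_gauss)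
    have "(\<lambda>p :: (real ^ 'n) \<times> (real ^ 'n ^ 'n). ennreal (gauss_dens (snd p *v fst p)) * ennreal \<bar>det (snd p)\<bar>) \<in> borel_measurable borel"
      by measurable
    moreover have "sets ((lborel :: (real ^ 'n) measure) \<Otimes>\<^sub>M (gauss :: (real ^ 'n ^ 'n) measure)) = sets borel"
      by (simp add: borel_prod[symmetric] cong: sets_pair_measure_cong)
    ultimately show "(\<lambda>(t, G). ennreal (gauss_dens (G *v t)) * ennreal \<bar>det G\<bar>) \<in> borel_measurable ((lborel :: (real ^ 'n) measure) \<Otimes>\<^sub>M (gauss :: (real ^ 'n ^ 'n) measure))"
      by (simp add: split_beta cong: measurable_cong_sets)
  qed
  also have "\<dots> = (\<integral>\<^sup>+(G :: real ^ 'n ^ 'n). 1 \<partial>gauss)"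
  proof (rule nn_integral_cong_AE)
    have "AE G in gauss. det (G :: real ^ 'n ^ 'n) \<noteq> 0"
      unfolding gauss_def using AE_det_nonzero[where 'n='n] by (subst AE_density) auto
    then show "AE G in gauss. (\<integral>\<^sup>+t. ennreal (gauss_dens (G *v t)) * ennreal \<bar>det (G :: real ^ 'n ^ 'n)\<bar> \<partial>lborel) = 1"
    proof eventually_elim
      case (elim G)
      have inv: "invertible G" using elim by (simp add: invertible_det_nz)
      then have inj: "inj ((*v) G)" by (simp add: inj_matrix_vector_mult)
      have surj: "range ((*v) G) = UNIV"
        using inv unfolding invertible_right_inverse matrix_right_invertible_surjective by simp
      have "(\<integral>\<^sup>+y. ennreal (gauss_dens y) * indicator ((*v) G ` UNIV) y \<partial>lborel)
         = (\<integral>\<^sup>+x. ennreal (gauss_dens (G *v x)) * ennreal \<bar>det (matrix ((*v) G))\<bar> * indicator UNIV x \<partial>lborel)"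
        by (rule nn_integral_differentiable_image)
           (use inj surj in \<open>auto intro: has_derivative_matrix_vector_mult\<close>)
      then show ?case by (simp add: surj nn_integral_gauss_dens)
    qed
  qed
  also have "\<dots> = 1"
    using prob_space.emeasure_space_1[OF prob_space_gauss[where ?'a="real ^ 'n ^ 'n"]] by simp
  finally have 1: "det_moment TYPE('n) * ?I = 1" .
  have 2: "ennreal ?\<Gamma> * ?I = ennreal (sqrt pi ^ (CARD('n) + 1))"
    using nn_integral_cauchy_kernel[where ?'a="real ^ 'n"] by simp
  have "det_moment TYPE('n) * ennreal (sqrt pi ^ (CARD('n) + 1)) = ennreal ?\<Gamma>"
  proof -
    have "det_moment TYPE('n) * (ennreal ?\<Gamma> * ?I) = ennreal ?\<Gamma> * (det_moment TYPE('n) * ?I)"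
      by (rule mult.left_commute)
    then show ?thesis unfolding 2[symmetric] 1 by simp
  qed
  then have "det_moment TYPE('n) * ennreal (sqrt pi ^ (CARD('n) + 1)) * ennreal (1 / sqrt pi ^ (CARD('n) + 1))
     = ennreal ?\<Gamma> * ennreal (1 / sqrt pi ^ (CARD('n) + 1))" by simp
  then show ?thesis
    using G by (simp add: mult.assoc ennreal_mult[symmetric] less_imp_le)
qed

section \<open>The Gaussian integral over all \<open>A\<close> at a fixed point\<close>

lemma inner_matrix_mult_transpose:
  fixes A :: "real ^ 'N ^ 'n" and E :: "real ^ 'm ^ 'N" and G :: "real ^ 'm ^ 'n"
  shows "A \<bullet> (G ** transpose E) = (A ** E) \<bullet> G"
proof -
  have "A \<bullet> (G ** transpose E) = (\<Sum>i\<in>UNIV. \<Sum>k\<in>UNIV. \<Sum>j\<in>UNIV. A $ i $ k * (G $ i $ j * E $ k $ j))"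
    by (simp add: inner_vec_def matrix_matrix_mult_def transpose_def sum_distrib_left)
  also have "\<dots> = (\<Sum>i\<in>UNIV. \<Sum>j\<in>UNIV. \<Sum>k\<in>UNIV. A $ i $ k * (G $ i $ j * E $ k $ j))"
    by (intro sum.cong refl sum.swap)
  also have "\<dots> = (A ** E) \<bullet> G"
    by (simp add: inner_vec_def matrix_matrix_mult_def sum_distrib_right sum_distrib_left mult_ac)
  finally show ?thesis .
qed

text \<open>A QR factorization up to the choice of basis: the columns of \<open>E\<close> are an
  orthonormal basis of the range of \<open>J\<close>, and \<open>R = transpose E ** J\<close>
  records the columns of \<open>J\<close> in that basis.\<close>

lemma ex_orthonormal_factor:
  fixes J :: "real ^ 'n ^ 'N"
  assumes inj: "inj ((*v) J)"
  obtains E :: "real ^ 'n ^ 'N" and R :: "real ^ 'n ^ 'n"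
  where "J = E ** R" "transpose E ** E = mat 1" "\<And>w. (\<And>h. w \<bullet> (J *v h) = 0) \<Longrightarrow> transpose E *v w = 0"
proof -
  let ?V = "range ((*v) J)"
  have V: "subspace ?V" by (intro linear_subspace_image) auto
  have "dim ?V = CARD('n)"
    using dim_image_eq[of "(*v) J" UNIV] inj by (simp add: inj_on_subset[OF inj])
  then obtain B where B: "B \<subseteq> ?V" "pairwise orthogonal B" "\<And>x. x \<in> B \<Longrightarrow> norm x = 1"
    "independent B" "card B = CARD('n)" "span B = ?V"
    using orthonormal_basis_subspace[OF V] by metis
  have finB: "finite B" using B(4) by (rule independent_imp_finite)
  then obtain e where e: "bij_betw e (UNIV :: 'n set) B"
    using finite_same_card_bij[of "UNIV :: 'n set" B] B(5) by auto
  have eB: "e j \<in> B" and einj: "e i = e j \<longleftrightarrow> i = j" for i j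
    using e by (auto simp: bij_betw_def inj_eq)
  have ee: "e i \<bullet> e j = (if i = j then 1 else 0)" for i j
    using B(2,3) eB[of i] eB[of j] einj by (auto simp: pairwise_def orthogonal_def norm_eq_1)
  define E :: "real ^ 'n ^ 'N" where "E = (\<chi> i j. e j $ i)"
  have Eh: "E *v h = (\<Sum>j\<in>UNIV. h $ j *\<^sub>R e j)" for h
    by (simp add: E_def vec_eq_iff matrix_vector_mult_def mult.commute)
  have Et: "transpose E *v v = (\<chi> j. v \<bullet> e j)" for v
    by (simp add: E_def vec_eq_iff matrix_vector_mult_def transpose_def inner_vec_def mult.commute)
  have EEt: "E *v (transpose E *v v) = v" if "v \<in> ?V" for v
  proof -
    have "E *v (transpose E *v v) = (\<Sum>b\<in>B. (v \<bullet> b) *\<^sub>R b)"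
      unfolding Eh Et using sum.reindex_bij_betw[OF e, of "\<lambda>b. (v \<bullet> b) *\<^sub>R b"] by simp
    also have "\<dots> = v" by (rule orthonormal_representation) (use B finB that in auto)
    finally show ?thesis .
  qed
  show ?thesis
  proof (rule that[of E "transpose E ** J"])
    show "J = E ** (transpose E ** J)"
    proof (rule matrix_eq[THEN iffD2], rule allI)
      fix h
      show "J *v h = E ** (transpose E ** J) *v h"
        using EEt[of "J *v h"] by (simp add: matrix_vector_mul_assoc[symmetric])
    qed
    show "transpose E ** E = mat 1"
      by (simp add: E_def vec_eq_iff matrix_matrix_mult_def transpose_def mat_def ee[unfolded inner_vec_def, simplified])
    show "transpose E *v w = 0" if "\<And>h. w \<bullet> (J *v h) = 0" for w
    proof -
      have "w \<bullet> e j = 0" for j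
        using eB[of j] B(1) that by auto
      then show ?thesis unfolding Et by (simp add: vec_eq_iff)
    qed
  qed
qed

text \<open>Since \<open>w\<close> is orthogonal to the columns of \<open>E\<close>, the matrix
  \<open>A ** E\<close> and the vector \<open>A *v w\<close> are independent. The vector is
  \<open>norm w\<close> times a standard Gaussian one, so integrating it out is the convolution of
  \<open>nn_integral_gauss_dens_affine\<close>.\<close>

lemma nn_integral_gauss_slice_normalized:
  fixes E :: "real ^ 'n ^ 'N"
  assumes EE: "transpose E ** E = mat 1" and Ew: "transpose E *v w = 0"
  shows "(\<integral>\<^sup>+A. ennreal (gauss_dens ((A ** E) *v t + A *v w)) * ennreal \<bar>det (A ** E)\<bar> \<partial>gauss)
    = (\<integral>\<^sup>+G. ennreal (gauss_dens (G *v (t /\<^sub>R sqrt (1 + (norm w)\<^sup>2)))) * ennreal \<bar>det (G :: real ^ 'n ^ 'n)\<bar> \<partial>gauss)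
        / ennreal (sqrt (1 + (norm w)\<^sup>2) ^ CARD('n))"
proof (cases "w = 0")
  case True
  have "distr gauss borel (\<lambda>A :: real ^ 'N ^ 'n. A ** E) = gauss"
    by (rule gauss_distr_adjoint[where v = "\<lambda>G. G ** transpose E"])
       (simp_all add: inner_matrix_mult_transpose matrix_mul_assoc[symmetric] EE)
  then have "(\<integral>\<^sup>+G. ennreal (gauss_dens (G *v t)) * ennreal \<bar>det (G :: real ^ 'n ^ 'n)\<bar> \<partial>gauss)
    = (\<integral>\<^sup>+G. ennreal (gauss_dens (G *v t)) * ennreal \<bar>det (G :: real ^ 'n ^ 'n)\<bar> \<partial>distr gauss borel (\<lambda>A :: real ^ 'N ^ 'n. A ** E))"
    by simp
  also have "\<dots> = (\<integral>\<^sup>+A. ennreal (gauss_dens ((A ** E) *v t)) * ennreal \<bar>det (A ** E)\<bar> \<partial>gauss)"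
    by (subst nn_integral_distr) auto
  finally show ?thesis using True by (simp add: divide_ennreal_def)
next
  case False
  define q where "q = norm w"
  have q: "q > 0" using False by (simp add: q_def)
  define u where "u = w /\<^sub>R q"
  have wu: "w = q *\<^sub>R u" using q by (simp add: u_def)
  have uu: "u \<bullet> u = 1" using q by (simp add: u_def q_def power2_norm_eq_inner[symmetric] power2_eq_square)
  have Eu: "transpose E *v u = 0" using Ew by (simp add: u_def matrix_vector_mult_scaleR)
  have uE: "(\<Sum>k\<in>UNIV. u $ k * E $ k $ j) = 0" for j
    using Eu by (auto simp: vec_eq_iff matrix_vector_mult_def transpose_def mult.commute)
  \<comment> \<open>The rank one matrix \<open>y\<close> times the transpose of \<open>u\<close>; as
    a function of \<open>y\<close> it is adjoint to \<open>A *v u\<close> as a function of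
    \<open>A\<close>.\<close>
  define out where "out y = (\<chi> i k. y $ i * u $ k)" for y :: "real ^ 'n"
  have out_E: "out y ** E = 0" for y
    by (simp add: out_def vec_eq_iff matrix_matrix_mult_def mult.assoc sum_distrib_left[symmetric] uE)
  have out_u: "out y *v u = y" for y
    using uu by (simp add: out_def vec_eq_iff matrix_vector_mult_def inner_vec_def mult.assoc sum_distrib_left[symmetric])
  have inner_out: "A \<bullet> out y = (A *v u) \<bullet> y" for A y
    by (simp add: out_def inner_vec_def matrix_vector_mult_def sum_distrib_right sum_distrib_left mult_ac)
  let ?L = "\<lambda>A :: real ^ 'N ^ 'n. (A ** E, A *v u)"
  have dL: "distr gauss borel ?L = gauss"
  proof (rule gauss_distr_adjoint[where v = "\<lambda>(G, y). G ** transpose E + out y"])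
    show "A \<bullet> (case b of (G, y) \<Rightarrow> G ** transpose E + out y) = (A ** E, A *v u) \<bullet> b" for A b
      by (cases b) (simp add: inner_add_right inner_matrix_mult_transpose inner_out)
    show "((case b of (G, y) \<Rightarrow> G ** transpose E + out y) ** E, (case b of (G, y) \<Rightarrow> G ** transpose E + out y) *v u) = b" for b
    proof (cases b)
      case (Pair G y)
      have "(G ** transpose E + out y) ** E = (G ** transpose E) ** E + out y ** E"
        by (simp add: vec_eq_iff matrix_matrix_mult_def distrib_right sum.distrib)
      also have "\<dots> = G" by (simp add: out_E matrix_mul_assoc[symmetric] EE)
      finally have 1: "(G ** transpose E + out y) ** E = G" .
      have 2: "(G ** transpose E + out y) *v u = y"
        by (simp add: matrix_vector_mult_add_rdistrib out_u matrix_vector_mul_assoc[symmetric] Eu[simplified])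
      show ?thesis using 1 2 by (simp add: Pair)
    qed
  qed
  have [measurable]: "?L \<in> borel_measurable borel"
    by (subst borel_prod[symmetric]) measurable
  let ?F = "\<lambda>p :: (real ^ 'n ^ 'n) \<times> (real ^ 'n). ennreal (gauss_dens (fst p *v t + q *\<^sub>R snd p)) * ennreal \<bar>det (fst p)\<bar>"
  have mv: "(\<lambda>p :: (real ^ 'n ^ 'n) \<times> (real ^ 'n). fst p *v t) \<in> borel_measurable borel"
    using measurable_compose[OF borel_measurable_continuous_onI[OF continuous_on_fst[OF continuous_on_id]] borel_measurable_matrix_vector_mult[of t]]
    by simp
  have md: "(\<lambda>p :: (real ^ 'n ^ 'n) \<times> (real ^ 'n). det (fst p)) \<in> borel_measurable borel"
    by (rule measurable_compose[OF borel_measurable_fst_snd(1) borel_measurable_det])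
  have [measurable]: "?F \<in> borel_measurable borel"
    using mv md by measurable
  have mF: "?F \<in> borel_measurable (gauss \<Otimes>\<^sub>M gauss)"
    unfolding gauss_distr_Pair by measurable
  interpret g: sigma_finite_measure "gauss :: (real ^ 'n) measure"
    by (rule prob_space_imp_sigma_finite[OF prob_space_gauss])
  have "(\<integral>\<^sup>+A. ennreal (gauss_dens ((A ** E) *v t + A *v w)) * ennreal \<bar>det (A ** E)\<bar> \<partial>gauss)
     = (\<integral>\<^sup>+A. ?F (?L A) \<partial>gauss)"
    by (simp add: wu matrix_vector_mult_scaleR)
  also have "\<dots> = (\<integral>\<^sup>+p. ?F p \<partial>gauss)"
    by (subst dL[symmetric], subst nn_integral_distr) auto
  also have "\<dots> = (\<integral>\<^sup>+G. \<integral>\<^sup>+y. ?F (G, y) \<partial>gauss \<partial>gauss)"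
    unfolding gauss_distr_Pair[symmetric] using mF by (rule g.nn_integral_fst[symmetric])
  also have "\<dots> = (\<integral>\<^sup>+G. (ennreal (gauss_dens (G *v (t /\<^sub>R sqrt (1 + q\<^sup>2)))) * ennreal \<bar>det (G :: real ^ 'n ^ 'n)\<bar>)
        * inverse (ennreal (sqrt (1 + q\<^sup>2) ^ CARD('n))) \<partial>gauss)"
  proof (rule nn_integral_cong)
    fix G :: "real ^ 'n ^ 'n"
    have pos: "sqrt (1 + q\<^sup>2) > 0" by (simp add: add_pos_nonneg)
    have "(\<integral>\<^sup>+y. ?F (G, y) \<partial>gauss) = (\<integral>\<^sup>+y. ennreal (gauss_dens (G *v t + q *\<^sub>R y)) \<partial>gauss) * ennreal \<bar>det G\<bar>"
      by (subst nn_integral_multc[symmetric]) auto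
    also have "\<dots> = ennreal (gauss_dens (G *v t /\<^sub>R sqrt (1 + q\<^sup>2)) / sqrt (1 + q\<^sup>2) ^ CARD('n)) * ennreal \<bar>det G\<bar>"
      by (simp add: nn_integral_gauss_dens_affine)
    also have "ennreal (gauss_dens (G *v t /\<^sub>R sqrt (1 + q\<^sup>2)) / sqrt (1 + q\<^sup>2) ^ CARD('n))
        = ennreal (gauss_dens (G *v t /\<^sub>R sqrt (1 + q\<^sup>2))) * inverse (ennreal (sqrt (1 + q\<^sup>2) ^ CARD('n)))"
      using pos by (subst inverse_ennreal) (auto simp: ennreal_mult[symmetric] divide_inverse)
    finally show "(\<integral>\<^sup>+y. ?F (G, y) \<partial>gauss) = (ennreal (gauss_dens (G *v (t /\<^sub>R sqrt (1 + q\<^sup>2)))) * ennreal \<bar>det G\<bar>)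
        * inverse (ennreal (sqrt (1 + q\<^sup>2) ^ CARD('n)))"
      by (simp add: matrix_vector_mult_scaleR mult_ac)
  qed
  also have "\<dots> = (\<integral>\<^sup>+G. ennreal (gauss_dens (G *v (t /\<^sub>R sqrt (1 + q\<^sup>2)))) * ennreal \<bar>det (G :: real ^ 'n ^ 'n)\<bar> \<partial>gauss)
        / ennreal (sqrt (1 + q\<^sup>2) ^ CARD('n))"
    by (subst nn_integral_multc) (auto simp: divide_ennreal_def)
  finally show ?thesis by (simp add: q_def)
qed

text \<open>Here the formula for \<open>alpha\<close> arises. Integrating out the normal part
  \<open>w\<close> costs the factor \<sigma> to the power -n, while the determinant integral at the
  rescaled point contributes the quotient of \<sigma> by \<open>sqrt (1 + (norm x)\<^sup>2)\<close>
  to the power n + 1. One factor \<sigma> survives as the numerator of \<open>alpha\<close>; the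
  Gram root is the absolute determinant of \<open>R\<close>.\<close>

lemma nn_integral_gauss_slice:
  fixes J :: "real ^ 'n ^ 'N" and x w :: "real ^ 'N"
  assumes inj: "inj ((*v) J)" and x: "x = J *v p + w" and w: "\<And>h. w \<bullet> (J *v h) = 0"
  shows "(\<integral>\<^sup>+A. ennreal (gauss_dens (A *v x)) * ennreal \<bar>det (A ** J)\<bar> \<partial>gauss)
    = ennreal (sqrt (1 + (norm w)\<^sup>2) / (1 + (norm x)\<^sup>2) powr ((real CARD('n) + 1) / 2) *
        (Gamma ((real CARD('n) + 1) / 2) / sqrt pi ^ (CARD('n) + 1)) * sqrt (det (transpose J ** J)))"
proof -
  obtain E :: "real ^ 'n ^ 'N" and R :: "real ^ 'n ^ 'n"
    where JE: "J = E ** R" and EE: "transpose E ** E = mat 1" and Ew: "transpose E *v w = 0"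
    using ex_orthonormal_factor[OF inj] w by metis
  \<comment> \<open>Coordinates of the tangential part of \<open>x\<close> in the orthonormal basis
    given by \<open>E\<close>.\<close>
  define t where "t = R *v p"
  define \<sigma> where "\<sigma> = sqrt (1 + (norm w)\<^sup>2)"
  have \<sigma>: "\<sigma> > 0" "\<sigma>\<^sup>2 = 1 + (norm w)\<^sup>2" by (auto simp: \<sigma>_def add_pos_nonneg)
  have xE: "x = E *v t + w" by (simp add: x t_def JE matrix_vector_mul_assoc)
  have "(norm (E *v t))\<^sup>2 = (norm t)\<^sup>2"
    unfolding power2_norm_eq_inner
    by (metis EE dot_lmul_matrix inner_commute matrix_vector_mul_assoc matrix_vector_mul_lid transpose_matrix_vector)
  moreover have "(E *v t) \<bullet> w = 0"
    by (metis Ew dot_lmul_matrix inner_commute inner_zero_right transpose_matrix_vector)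
  ultimately have nx: "(norm x)\<^sup>2 = (norm t)\<^sup>2 + (norm w)\<^sup>2"
    unfolding xE by (simp add: power2_norm_eq_inner inner_add_left inner_add_right inner_commute)
  have "transpose J ** J = transpose R ** (transpose E ** E) ** R"
    by (simp add: JE matrix_transpose_mul matrix_mul_assoc)
  then have detJ: "sqrt (det (transpose J ** J)) = \<bar>det R\<bar>"
    by (simp add: EE det_mul)
  have "(\<integral>\<^sup>+A. ennreal (gauss_dens (A *v x)) * ennreal \<bar>det (A ** J)\<bar> \<partial>gauss)
     = (\<integral>\<^sup>+A. (ennreal (gauss_dens ((A ** E) *v t + A *v w)) * ennreal \<bar>det (A ** E)\<bar>) * ennreal \<bar>det R\<bar> \<partial>gauss)"
    by (intro nn_integral_cong)
       (simp add: xE JE matrix_vector_right_distrib matrix_vector_mul_assoc matrix_mul_assoc det_mul abs_mult ennreal_mult mult.assoc)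
  also have "\<dots> = (\<integral>\<^sup>+A. (ennreal (gauss_dens ((A ** E) *v t + A *v w)) * ennreal \<bar>det (A ** E)\<bar>) \<partial>gauss) * ennreal \<bar>det R\<bar>"
  proof (rule nn_integral_multc)
    have "(\<lambda>A :: real ^ 'N ^ 'n. (A ** E) *v t) \<in> borel_measurable borel"
      by (intro measurable_compose[OF borel_measurable_matrix_matrix_mult] borel_measurable_matrix_vector_mult)
    then show "(\<lambda>A :: real ^ 'N ^ 'n. ennreal (gauss_dens ((A ** E) *v t + A *v w)) * ennreal \<bar>det (A ** E)\<bar>) \<in> borel_measurable gauss"
      by measurable
  qed
  also have "\<dots> = det_moment TYPE('n) / ennreal (sqrt (1 + (norm (t /\<^sub>R \<sigma>))\<^sup>2) ^ (CARD('n) + 1)) / ennreal (\<sigma> ^ CARD('n)) * ennreal \<bar>det R\<bar>"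
    by (simp add: nn_integral_gauss_slice_normalized[OF EE Ew] nn_integral_gauss_det \<sigma>_def)
  also have "sqrt (1 + (norm (t /\<^sub>R \<sigma>))\<^sup>2) = sqrt (1 + (norm x)\<^sup>2) / \<sigma>"
  proof -
    have "1 + (norm (t /\<^sub>R \<sigma>))\<^sup>2 = (1 + (norm x)\<^sup>2) / \<sigma>\<^sup>2"
    proof -
      have "1 + (norm w)\<^sup>2 \<noteq> 0" using \<sigma> by (metis zero_less_power less_irrefl)
      then show ?thesis using \<sigma> by (simp add: nx power_mult_distrib power_inverse field_simps)
    qed
    then show ?thesis using \<sigma>(1) by (simp add: real_sqrt_divide)
  qed
  also have "det_moment TYPE('n) / ennreal ((sqrt (1 + (norm x)\<^sup>2) / \<sigma>) ^ (CARD('n) + 1)) / ennreal (\<sigma> ^ CARD('n)) * ennreal \<bar>det R\<bar>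
     = ennreal (\<sigma> / sqrt (1 + (norm x)\<^sup>2) ^ (CARD('n) + 1) *
        (Gamma ((real CARD('n) + 1) / 2) / sqrt pi ^ (CARD('n) + 1)) * \<bar>det R\<bar>)"
  proof -
    have p: "sqrt (1 + (norm x)\<^sup>2) > 0" by (simp add: add_pos_nonneg)
    have G: "Gamma ((real CARD('n) + 1) / 2) > 0" by (simp add: Gamma_real_pos)
    show ?thesis
      unfolding det_moment_eq using p \<sigma>(1) G
      by (simp add: divide_ennreal ennreal_mult[symmetric] power_divide less_imp_le field_simps)
  qed
  also have "sqrt (1 + (norm x)\<^sup>2) ^ (CARD('n) + 1) = (1 + (norm x)\<^sup>2) powr ((real CARD('n) + 1) / 2)"
  proof -
    have p: "1 + (norm x)\<^sup>2 > 0" by (simp add: add_pos_nonneg)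
    then show ?thesis
      by (simp add: powr_half_sqrt[symmetric] powr_realpow[symmetric] powr_powr add.commute del: power_Suc)
  qed
  finally show ?thesis by (simp add: detJ \<sigma>_def)
qed

section \<open>Polynomial functions\<close>

definition subring_on :: "'a::comm_ring_1 set \<Rightarrow> bool" where
  "subring_on R \<longleftrightarrow> 0 \<in> R \<and> 1 \<in> R \<and> (\<forall>a\<in>R. \<forall>b\<in>R. a + b \<in> R \<and> a * b \<in> R) \<and> (\<forall>a\<in>R. - a \<in> R)"

text \<open>Like the rings, ideals are carrier sets inside one ring of functions with pointwise
  operations, so that coordinates can be adjoined one after another within a single type.\<close>

definition ideal_on :: "'a::comm_ring_1 set \<Rightarrow> 'a set \<Rightarrow> bool" where
  "ideal_on R I \<longleftrightarrow> 0 \<in> I \<and> (\<forall>a\<in>I. \<forall>b\<in>I. a + b \<in> I) \<and> (\<forall>r\<in>R. \<forall>a\<in>I. r * a \<in> I)"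

inductive_set ideal_gen :: "'a::comm_ring_1 set \<Rightarrow> 'a set \<Rightarrow> 'a set" for R G where
  zero: "0 \<in> ideal_gen R G"
| step: "r \<in> R \<Longrightarrow> g \<in> G \<Longrightarrow> u \<in> ideal_gen R G \<Longrightarrow> r * g + u \<in> ideal_gen R G"

definition noetherian_on :: "'a::comm_ring_1 set \<Rightarrow> bool" where
  "noetherian_on R \<longleftrightarrow> (\<forall>I. I \<subseteq> R \<longrightarrow> ideal_on R I \<longrightarrow> (\<exists>G. finite G \<and> G \<subseteq> I \<and> I \<subseteq> ideal_gen R G))"

lemma ideal_gen_add: "u \<in> ideal_gen R G \<Longrightarrow> v \<in> ideal_gen R G \<Longrightarrow> u + v \<in> ideal_gen R G"
  by (induction rule: ideal_gen.induct) (auto simp: add.assoc intro: ideal_gen.step)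

lemma ideal_gen_mult:
  assumes "subring_on R" "r \<in> R"
  shows "u \<in> ideal_gen R G \<Longrightarrow> r * u \<in> ideal_gen R G"
proof (induction rule: ideal_gen.induct)
  case (step s g u)
  have "(r * s) * g + r * u \<in> ideal_gen R G"
    using step assms by (intro ideal_gen.step) (auto simp: subring_on_def)
  then show ?case by (simp add: algebra_simps)
qed (simp add: ideal_gen.zero)

lemma ideal_gen_base: "subring_on R \<Longrightarrow> g \<in> G \<Longrightarrow> g \<in> ideal_gen R G"
  using ideal_gen.step[of 1 R g G 0] by (auto simp: subring_on_def ideal_gen.zero)

lemma ideal_gen_ideal: "subring_on R \<Longrightarrow> ideal_on R (ideal_gen R G)"
  unfolding ideal_on_def by (auto intro: ideal_gen_add ideal_gen_mult ideal_gen.zero)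

lemma ideal_gen_mono: "G \<subseteq> H \<Longrightarrow> ideal_gen R G \<subseteq> ideal_gen R H"
proof
  fix u assume "G \<subseteq> H" "u \<in> ideal_gen R G"
  from this(2,1) show "u \<in> ideal_gen R H"
    by (induction rule: ideal_gen.induct) (auto intro: ideal_gen.intros)
qed

lemma ideal_gen_least: "G \<subseteq> I \<Longrightarrow> ideal_on R I \<Longrightarrow> ideal_gen R G \<subseteq> I"
proof
  fix u assume "G \<subseteq> I" "ideal_on R I" "u \<in> ideal_gen R G"
  from this(3,1,2) show "u \<in> I"
    by (induction rule: ideal_gen.induct) (auto simp: ideal_on_def)
qed

text \<open>The ideal generated by the whole sequence is generated by finitely many elements, and
  these involve only finitely many of the \<open>a i\<close>.\<close>

lemma noetherian_on_sequence:
  assumes R: "subring_on R" "noetherian_on R" and a: "\<And>i :: nat. a i \<in> R"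
  obtains m where "a m \<in> ideal_gen R (a ` {..<m})"
proof -
  let ?I = "ideal_gen R (range a)"
  have "ideal_on R R" using R(1) by (auto simp: ideal_on_def subring_on_def)
  then have "?I \<subseteq> R" using a by (intro ideal_gen_least) auto
  then obtain G where G: "finite G" "G \<subseteq> ?I" "?I \<subseteq> ideal_gen R G"
    using R(2) ideal_gen_ideal[OF R(1), of "range a"] unfolding noetherian_on_def by metis
  have mono: "ideal_gen R (a ` {..<m}) \<subseteq> ideal_gen R (a ` {..<m'})" if "m \<le> m'" for m m'
    using that by (intro ideal_gen_mono image_mono) auto
  have ex: "\<exists>m. u \<in> ideal_gen R (a ` {..<m})" if "u \<in> ?I" for u
    using that
  proof (induction rule: ideal_gen.induct)
    case (step r g u)
    then obtain m i where m: "u \<in> ideal_gen R (a ` {..<m})" and "g = a i" by auto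
    then have "r * g + u \<in> ideal_gen R (a ` {..<max m (Suc i)})"
      using step mono[of m "max m (Suc i)"] by (intro ideal_gen.step) auto
    then show ?case by blast
  qed (auto intro: ideal_gen.zero)
  have "\<exists>m. G' \<subseteq> ideal_gen R (a ` {..<m})" if "finite G'" "G' \<subseteq> ?I" for G'
    using that
  proof (induction rule: finite_induct)
    case (insert g G')
    then obtain m1 m2 where "G' \<subseteq> ideal_gen R (a ` {..<m1})" "g \<in> ideal_gen R (a ` {..<m2})"
      using ex[of g] by auto
    then have "insert g G' \<subseteq> ideal_gen R (a ` {..<max m1 m2})"
      using mono[of m1 "max m1 m2"] mono[of m2 "max m1 m2"] by auto
    then show ?case by blast
  qed auto
  then obtain m where m: "G \<subseteq> ideal_gen R (a ` {..<m})" using G by blast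
  have "ideal_gen R G \<subseteq> ideal_gen R (a ` {..<m})"
    using m ideal_gen_ideal[OF R(1)] by (intro ideal_gen_least) auto
  then have "a m \<in> ideal_gen R (a ` {..<m})"
    using G(3) ideal_gen_base[OF R(1), of "a m" "range a"] by auto
  then show ?thesis by (rule that)
qed

text \<open>The bound \<open>k\<close> limits the length of an expression, which is one more than
  its degree. Expressions need not be unique, since \<open>t\<close> may be algebraic over
  \<open>R\<close>.\<close>

definition adjoin :: "'a::comm_ring_1 set \<Rightarrow> 'a \<Rightarrow> nat \<Rightarrow> 'a set" where
  "adjoin R t k = {u. \<exists>a. (\<forall>j. a j \<in> R) \<and> u = (\<Sum>j<k. a j * t ^ j)}"

lemma adjoin_mono:
  assumes "subring_on R" "k \<le> l" shows "adjoin R t k \<subseteq> adjoin R t l"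
proof
  fix u assume "u \<in> adjoin R t k"
  then obtain a where a: "\<And>j. a j \<in> R" "u = (\<Sum>j<k. a j * t ^ j)" by (auto simp: adjoin_def)
  have "(\<Sum>j<l. (if j < k then a j else 0) * t ^ j) = u"
    unfolding a(2) using assms(2) by (intro sum.mono_neutral_cong_right) auto
  moreover have "\<forall>j. (if j < k then a j else 0) \<in> R" using a assms by (auto simp: subring_on_def)
  ultimately show "u \<in> adjoin R t l"
    unfolding adjoin_def by (auto intro!: exI[of _ "\<lambda>j. if j < k then a j else 0"])
qed

lemma adjoin_add:
  assumes "subring_on R" "u \<in> adjoin R t k" "v \<in> adjoin R t k" shows "u + v \<in> adjoin R t k"
proof -
  obtain a b where "\<And>j. a j \<in> R" "u = (\<Sum>j<k. a j * t ^ j)" "\<And>j. b j \<in> R" "v = (\<Sum>j<k. b j * t ^ j)"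
    using assms by (auto simp: adjoin_def)
  then show ?thesis
    using assms(1) unfolding adjoin_def
    by (auto intro!: exI[of _ "\<lambda>j. a j + b j"] simp: sum.distrib algebra_simps subring_on_def)
qed

lemma adjoin_monomial_mult:
  assumes R: "subring_on R" and r: "r \<in> R" and u: "u \<in> adjoin R t k"
  shows "r * t ^ i * u \<in> adjoin R t (k + i)"
proof -
  obtain a where a: "\<And>j. a j \<in> R" "u = (\<Sum>j<k. a j * t ^ j)" using u by (auto simp: adjoin_def)
  let ?b = "\<lambda>j. if i \<le> j then r * a (j - i) else 0"
  have "(\<Sum>j<k + i. ?b j * t ^ j) = (\<Sum>j\<in>{i..<k + i}. r * a (j - i) * t ^ j)"
    by (rule sum.mono_neutral_cong_right) auto
  also have "\<dots> = (\<Sum>j<k. r * a j * t ^ (j + i))"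
    using sum.shift_bounds_nat_ivl[of "\<lambda>j. r * a (j - i) * t ^ j" 0 i k] by (simp add: atLeast0LessThan)
  also have "\<dots> = r * t ^ i * u"
    unfolding a(2) by (simp add: sum_distrib_left power_add algebra_simps)
  finally have "r * t ^ i * u = (\<Sum>j<k + i. ?b j * t ^ j)" ..
  moreover have "\<forall>j. ?b j \<in> R" using a r R by (auto simp: subring_on_def)
  ultimately show ?thesis unfolding adjoin_def by (intro CollectI exI[of _ ?b] conjI)
qed

lemma adjoin_mult:
  assumes R: "subring_on R" and u: "u \<in> adjoin R t k" and v: "v \<in> adjoin R t l"
  shows "u * v \<in> adjoin R t (l + k)"
proof -
  obtain a where a: "\<And>j. a j \<in> R" "u = (\<Sum>j<k. a j * t ^ j)" using u by (auto simp: adjoin_def)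
  have 0: "0 \<in> adjoin R t (l + k)"
    using R unfolding adjoin_def by (auto simp: subring_on_def intro!: exI[of _ "\<lambda>_. 0"])
  have "(\<Sum>j\<in>S. a j * t ^ j * v) \<in> adjoin R t (l + k)" if "finite S" "S \<subseteq> {..<k}" for S
    using that
  proof (induction rule: finite_induct)
    case (insert i S)
    have "a i * t ^ i * v \<in> adjoin R t (l + k)"
      using adjoin_monomial_mult[OF R a(1) v, of i i] adjoin_mono[OF R, of "l + i" "l + k" t] insert by auto
    then show ?case using insert by (auto intro: adjoin_add[OF R])
  qed (use 0 in simp)
  from this[of "{..<k}"] show ?thesis by (simp add: a(2) sum_distrib_right)
qed

lemma subring_on_adjoin:
  assumes R: "subring_on R" shows "subring_on (\<Union>k. adjoin R t k)"
  unfolding subring_on_def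
proof (intro conjI ballI)
  have in0: "R \<subseteq> adjoin R t 1"
  proof
    fix r assume "r \<in> R"
    then show "r \<in> adjoin R t 1" unfolding adjoin_def by (auto intro!: exI[of _ "\<lambda>_. r"])
  qed
  show "0 \<in> (\<Union>k. adjoin R t k)" "1 \<in> (\<Union>k. adjoin R t k)"
    using in0 R by (auto simp: subring_on_def)
  fix u assume "u \<in> (\<Union>k. adjoin R t k)"
  then obtain k where k: "u \<in> adjoin R t k" by auto
  have "- 1 \<in> adjoin R t 1" using in0 R by (auto simp: subring_on_def)
  from adjoin_mult[OF R this k] show "- u \<in> (\<Union>k. adjoin R t k)" by auto
  fix v assume "v \<in> (\<Union>k. adjoin R t k)"
  then obtain l where l: "v \<in> adjoin R t l" by auto
  show "u + v \<in> (\<Union>k. adjoin R t k)"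
    using adjoin_add[OF R, of u t "max k l" v] k l adjoin_mono[OF R, of k "max k l" t] adjoin_mono[OF R, of l "max k l" t]
    by auto
  show "u * v \<in> (\<Union>k. adjoin R t k)" using adjoin_mult[OF R k l] by auto
qed

text \<open>
  Hilbert's argument.  It needs no freeness: the degree of an element is the least length of a
  polynomial expression for it, and the leading coefficients are taken from such expressions.
\<close>

lemma noetherian_on_adjoin:
  assumes R: "subring_on R" "noetherian_on R"
  shows "noetherian_on (\<Union>k. adjoin R t k)" (is "noetherian_on ?T")
  unfolding noetherian_on_def
proof (intro allI impI)
  fix I assume I: "I \<subseteq> ?T" "ideal_on ?T I"
  have T: "subring_on ?T" by (rule subring_on_adjoin[OF R(1)])
  \<comment> \<open>The least length of an expression, hence one more than the degree for nonzero
    elements, and 0 for the zero element.\<close>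
  define D where "D u = (LEAST k. u \<in> adjoin R t k)" for u
  have D: "u \<in> adjoin R t (D u)" if "u \<in> I" for u
    unfolding D_def using that I(1) by (auto intro: LeastI)
  have D_le: "D u \<le> k" if "u \<in> adjoin R t k" for u k
    unfolding D_def using that by (rule Least_le)
  show "\<exists>G. finite G \<and> G \<subseteq> I \<and> I \<subseteq> ideal_gen ?T G"
  proof (rule ccontr)
    assume no: "\<nexists>G. finite G \<and> G \<subseteq> I \<and> I \<subseteq> ideal_gen ?T G"
    \<comment> \<open>The sequence \<open>g\<close> will be chosen greedily: each member has least
      length among the elements of \<open>I\<close> outside the ideal generated by its
      predecessors.\<close>
    define P where "P G u \<longleftrightarrow> u \<in> I - ideal_gen ?T G \<and> (\<forall>v\<in>I - ideal_gen ?T G. D u \<le> D v)" for G u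
    have ex: "\<exists>u. P G u" if "finite G" "G \<subseteq> I" for G
    proof -
      have "\<exists>u. u \<in> I - ideal_gen ?T G" using no that by blast
      then show ?thesis unfolding P_def using ex_has_least_nat[of "\<lambda>u. u \<in> I - ideal_gen ?T G" _ D] by blast
    qed
    obtain g where g: "\<And>n :: nat. P (g ` {..<n}) (g n)"
    proof -
      have "\<exists>f. \<forall>n :: nat. P (f ` {..<n}) (f n)"
      proof -
        \<comment> \<open>The list of earlier choices is carried along, because each choice depends
          on all of its predecessors.\<close>
        define F where "F = rec_nat [] (\<lambda>_ L. L @ [SOME u. P (set L) u])"
        define f where "f n = (SOME u. P (set (F n)) u)" for n
        have F: "F n = map f [0..<n]" for n
          by (induction n) (auto simp: F_def f_def)
        have "P (f ` {..<n}) (f n) \<and> f n \<in> I" for n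
        proof (induction n rule: less_induct)
          case (less n)
          have "set (F n) = f ` {..<n}" by (simp add: F atLeast0LessThan)
          moreover have "\<exists>u. P (f ` {..<n}) u" using less by (intro ex) auto
          ultimately have "P (f ` {..<n}) (f n)" unfolding f_def[of n] by (metis someI_ex)
          then show ?case by (simp add: P_def)
        qed
        then show ?thesis by (intro exI[of _ f]) auto
      qed
      then show ?thesis using that by auto
    qed
    have gI: "g n \<in> I" and gnot: "g n \<notin> ideal_gen ?T (g ` {..<n})" for n
      using g[of n] by (auto simp: P_def)
    have gmin: "D (g n) \<le> D v" if "v \<in> I" "v \<notin> ideal_gen ?T (g ` {..<n})" for n v
      using g[of n] that by (auto simp: P_def)
    have Dmono: "D (g i) \<le> D (g n)" if "i \<le> n" for i n
    proof (rule gmin[OF gI])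
      show "g n \<notin> ideal_gen ?T (g ` {..<i})"
        using gnot[of n] ideal_gen_mono[of "g ` {..<i}" "g ` {..<n}"] that by force
    qed
    have "\<exists>b. (\<forall>j. b j \<in> R) \<and> g n = (\<Sum>j<D (g n). b j * t ^ j)" for n
      using D[OF gI[of n]] by (simp add: adjoin_def)
    then obtain b where b: "\<And>n j. b n j \<in> R" "\<And>n. g n = (\<Sum>j<D (g n). b n j * t ^ j)" by metis
    have Dpos: "D (g n) > 0" for n
    proof (rule ccontr)
      assume "\<not> D (g n) > 0"
      then have "g n = 0" using b(2)[of n] by simp
      then show False using gnot[of n] by (simp add: ideal_gen.zero)
    qed
    define a where "a n = b n (D (g n) - 1)" for n
    define d where "d n = D (g n) - 1" for n
    have lead: "\<exists>w\<in>adjoin R t (d n). g n = a n * t ^ d n + w" for n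
    proof -
      have "g n = (\<Sum>j<Suc (d n). b n j * t ^ j)" using b(2)[of n] Dpos[of n] by (simp add: d_def)
      then have "g n = a n * t ^ d n + (\<Sum>j<d n. b n j * t ^ j)" by (simp add: a_def d_def add.commute)
      then show ?thesis using b(1)[of n] unfolding adjoin_def by blast
    qed
    obtain m where m: "a m \<in> ideal_gen R (a ` {..<m})"
      using noetherian_on_sequence[OF R, of a] b(1) by (auto simp: a_def)
    \<comment> \<open>A relation among leading coefficients is lifted to the \<open>g i\<close>.
      Multiplying \<open>g i\<close> by \<open>t ^ (d m - d i)\<close>, possible because lengths do
      not decrease along the sequence, aligns the leading terms; what remains has length at most
      \<open>d m\<close>.\<close>
    have "\<exists>w\<in>ideal_gen ?T (g ` {..<m}). w - u * t ^ d m \<in> adjoin R t (d m)" if "u \<in> ideal_gen R (a ` {..<m})" for u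
      using that
    proof (induction rule: ideal_gen.induct)
      case zero
      have "0 \<in> adjoin R t (d m)"
        using R(1) unfolding adjoin_def by (auto simp: subring_on_def intro!: exI[of _ "\<lambda>_. 0"])
      then show ?case by (intro bexI[of _ 0]) (auto intro: ideal_gen.zero)
    next
      case (step r h u)
      then obtain i w where i: "i < m" "h = a i" and w: "w \<in> ideal_gen ?T (g ` {..<m})" "w - u * t ^ d m \<in> adjoin R t (d m)"
        by auto
      have di: "d i \<le> d m" using Dmono[of i m] i by (simp add: d_def)
      obtain w' where w': "w' \<in> adjoin R t (d i)" "g i = a i * t ^ d i + w'" using lead by blast
      let ?w = "(r * t ^ (d m - d i)) * g i + w"
      have "r * t ^ (d m - d i) \<in> ?T"
      proof -
        have "1 \<in> adjoin R t 1" using R(1) unfolding adjoin_def by (auto simp: subring_on_def intro!: exI[of _ "\<lambda>_. 1"])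
        from adjoin_monomial_mult[OF R(1) step(1) this, of "d m - d i"] show ?thesis by auto
      qed
      then have "?w \<in> ideal_gen ?T (g ` {..<m})" using i w by (intro ideal_gen.step) auto
      moreover have "?w - (r * h + u) * t ^ d m = r * t ^ (d m - d i) * w' + (w - u * t ^ d m)"
      proof -
        have "t ^ (d m - d i) * t ^ d i = t ^ d m" using di by (simp add: power_add[symmetric])
        then have "r * t ^ (d m - d i) * (a i * t ^ d i) = r * a i * t ^ d m"
          by (metis (no_types, lifting) mult.assoc mult.left_commute)
        then show ?thesis by (simp add: w'(2) i algebra_simps)
      qed
      moreover have "r * t ^ (d m - d i) * w' \<in> adjoin R t (d m)"
        using adjoin_monomial_mult[OF R(1) step(1) w'(1), of "d m - d i"] di by simp
      ultimately show ?case using w(2) adjoin_add[OF R(1)] by (metis (no_types, lifting))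
    qed
    then obtain w where w: "w \<in> ideal_gen ?T (g ` {..<m})" "w - a m * t ^ d m \<in> adjoin R t (d m)"
      using m by blast
    obtain w' where w': "w' \<in> adjoin R t (d m)" "g m = a m * t ^ d m + w'" using lead by blast
    have neg: "- x \<in> adjoin R t (d m)" if x: "x \<in> adjoin R t (d m)" for x
      using adjoin_monomial_mult[OF R(1) _ x, of "- 1" 0] R(1) by (auto simp: subring_on_def)
    \<comment> \<open>Subtracting the lifted relation cancels the leading term of
      \<open>g m\<close>. The result is still outside the ideal but has smaller length, against the
      minimal choice of \<open>g m\<close>.\<close>
    let ?h = "g m + (- 1) * w"
    have "- (1::'a) \<in> ?T" using T by (auto simp: subring_on_def)
    then have mw: "(- 1) * w \<in> ideal_gen ?T (g ` {..<m})" "(1::'a) \<in> ?T" "w \<in> ideal_gen ?T (g ` {..<m})"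
      using ideal_gen_mult[OF T, of "-1" w] w T by (auto simp: subring_on_def)
    have "ideal_gen ?T (g ` {..<m}) \<subseteq> I" using gI I(2) by (intro ideal_gen_least) auto
    then have hI: "?h \<in> I" using mw(1) gI[of m] I(2) unfolding ideal_on_def by blast
    have "?h \<notin> ideal_gen ?T (g ` {..<m})"
    proof
      assume "?h \<in> ideal_gen ?T (g ` {..<m})"
      from ideal_gen_add[OF this mw(3)] show False using gnot[of m] by simp
    qed
    then have "D (g m) \<le> D ?h" using hI by (intro gmin)
    moreover have "?h = w' + - (w - a m * t ^ d m)" using w'(2) by (simp add: algebra_simps)
    then have "?h \<in> adjoin R t (d m)" using w' w(2) neg adjoin_add[OF R(1)] by metis
    then have "D ?h \<le> d m" by (rule D_le)
    ultimately show False using Dpos[of m] by (simp add: d_def)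
  qed
qed

text \<open>The constants form a field, in which a nonzero ideal is generated by any of its nonzero
  members. This starts the induction over the coordinates.\<close>

lemma noetherian_on_constants:
  "subring_on (range (\<lambda>c :: real. (\<lambda>x :: 'x. c)))" (is "subring_on ?R")
  "noetherian_on (range (\<lambda>c :: real. (\<lambda>x :: 'x. c)))"
proof -
  show R: "subring_on ?R"
    by (auto simp: subring_on_def image_iff fun_eq_iff)
  show "noetherian_on ?R"
    unfolding noetherian_on_def
  proof (intro allI impI)
    fix I :: "('x \<Rightarrow> real) set" assume I: "I \<subseteq> ?R" "ideal_on ?R I"
    show "\<exists>G. finite G \<and> G \<subseteq> I \<and> I \<subseteq> ideal_gen ?R G"
    proof (cases "I \<subseteq> {0}")
      case True
      then show ?thesis by (intro exI[of _ "{}"]) (auto intro: ideal_gen.zero)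
    next
      case False
      then obtain c where c: "(\<lambda>x. c) \<in> I" "(\<lambda>x :: 'x. c) \<noteq> 0" using I(1) by auto
      then have c0: "c \<noteq> 0" by (auto simp: fun_eq_iff)
      have "I \<subseteq> ideal_gen ?R {\<lambda>x. c}"
      proof
        fix u assume "u \<in> I"
        then obtain k where k: "u = (\<lambda>x. k)" using I(1) by auto
        have "(\<lambda>x. k / c) * (\<lambda>x. c) + 0 \<in> ideal_gen ?R {\<lambda>x. c}"
          by (intro ideal_gen.intros) auto
        moreover have "(\<lambda>x. k / c) * (\<lambda>x. c) + 0 = u" using c0 by (auto simp: k fun_eq_iff)
        ultimately show "u \<in> ideal_gen ?R {\<lambda>x. c}" by simp
      qed
      then show ?thesis using c(1) by (intro exI[of _ "{\<lambda>x. c}"]) auto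
    qed
  qed
qed

lemma sum_fun_apply: "(\<Sum>i\<in>S. f i) x = (\<Sum>i\<in>S. f i x)"
  by (induction S rule: infinite_finite_induct) auto

lemma power_fun_apply: "(f ^ n) x = (f x :: 'b::comm_semiring_1) ^ n"
  by (induction n) auto

text \<open>Coordinates are adjoined to the constants one at a time. The invariant
  \<open>R \<subseteq> ?P\<close> keeps the ring inside the polynomials, and once all coordinates
  are present the ring contains every polynomial.\<close>

lemma noetherian_polynomials:
  "noetherian_on {p :: real ^ 'N \<Rightarrow> real. real_polynomial_function p}" (is "noetherian_on ?P")
proof -
  have "\<exists>R :: (real ^ 'N \<Rightarrow> real) set. subring_on R \<and> noetherian_on R \<and> (\<forall>c. (\<lambda>x. c) \<in> R) \<and>
      (\<forall>i\<in>S. (\<lambda>x. x $ i) \<in> R) \<and> R \<subseteq> ?P" if "finite S" for S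
    using that
  proof (induction rule: finite_induct)
    case empty
    show ?case
      by (intro exI[of _ "range (\<lambda>c x. c)"]) (auto intro: noetherian_on_constants real_polynomial_function.intros)
  next
    case (insert i S)
    then obtain R :: "(real ^ 'N \<Rightarrow> real) set" where R: "subring_on R" "noetherian_on R"
      "\<And>c. (\<lambda>x. c) \<in> R" "\<And>j. j \<in> S \<Longrightarrow> (\<lambda>x. x $ j) \<in> R" "R \<subseteq> ?P" by blast
    define t :: "real ^ 'N \<Rightarrow> real" where "t = (\<lambda>x. x $ i)"
    let ?T = "\<Union>k. adjoin R t k"
    have RT: "R \<subseteq> ?T"
    proof
      fix r assume "r \<in> R"
      then have "r \<in> adjoin R t 1" unfolding adjoin_def by (auto intro!: exI[of _ "\<lambda>_. r"])
      then show "r \<in> ?T" by blast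
    qed
    have "1 \<in> R" "0 \<in> R" using R(1) by (auto simp: subring_on_def)
    then have "t \<in> adjoin R t 2"
      unfolding adjoin_def by (auto intro!: exI[of _ "\<lambda>j. if j = 1 then 1 else 0"] simp: numeral_2_eq_2)
    then have tT: "t \<in> ?T" by blast
    have "u \<in> ?P" if uT: "u \<in> ?T" for u
    proof -
      obtain k a where a: "\<And>j. a j \<in> R" "u = (\<Sum>j<k. a j * t ^ j)" using uT by (auto simp: adjoin_def)
      have u: "u = (\<lambda>x. \<Sum>j<k. a j x * (x $ i) ^ j)"
        by (auto simp: a(2) fun_eq_iff sum_fun_apply power_fun_apply t_def)
      have "real_polynomial_function (a j)" for j using a(1)[of j] R(5) by auto
      moreover have "real_polynomial_function (\<lambda>x :: real ^ 'N. x $ i)"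
        by (intro real_polynomial_function.intros(1) bounded_linear_vec_nth)
      ultimately have "real_polynomial_function u"
        unfolding u by (intro real_polynomial_function_sum real_polynomial_function.intros(4) real_polynomial_function_power) auto
      then show ?thesis by simp
    qed
    then have "?T \<subseteq> ?P" by blast
    moreover have "\<forall>j\<in>insert i S. (\<lambda>x. x $ j) \<in> ?T"
      using tT R(4) RT by (auto simp: t_def)
    moreover have "\<forall>c. (\<lambda>x. c) \<in> ?T" using R(3) RT by blast
    ultimately show ?case
      using subring_on_adjoin[OF R(1), of t] noetherian_on_adjoin[OF R(1,2), of t] by blast
  qed
  from this[of UNIV] obtain R :: "(real ^ 'N \<Rightarrow> real) set" where R: "subring_on R" "noetherian_on R"
      "\<And>c. (\<lambda>x. c) \<in> R" "\<And>j. (\<lambda>x. x $ j) \<in> R" "R \<subseteq> ?P" by auto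
  have cl: "f + g \<in> R" "f * g \<in> R" if "f \<in> R" "g \<in> R" for f g
    using R(1) that by (auto simp: subring_on_def)
  have "p \<in> R" if "real_polynomial_function p" for p
    using that
  proof (induction rule: real_polynomial_function.induct)
    case (linear f)
    have "f = (\<Sum>i\<in>UNIV. (\<lambda>x. f (axis i 1)) * (\<lambda>x. x $ i))"
    proof
      fix x :: "real ^ 'N"
      have "f x = f (\<Sum>i\<in>UNIV. x $ i *\<^sub>R axis i 1)" using basis_expansion[of x] by (simp add: scalar_mult_eq_scaleR)
      also have "\<dots> = (\<Sum>i\<in>UNIV. x $ i * f (axis i 1))"
        using linear bounded_linear.linear[OF linear] by (simp add: linear_sum linear_scale)
      finally show "f x = (\<Sum>i\<in>UNIV. (\<lambda>x. f (axis i 1)) * (\<lambda>x. x $ i)) x"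
        by (simp add: sum_fun_apply mult.commute)
    qed
    moreover have "(\<Sum>i\<in>S. (\<lambda>x. f (axis i 1)) * (\<lambda>x. x $ i)) \<in> R" if "finite S" for S :: "'N set"
      using that
    proof (induction rule: finite_induct)
      case empty
      show ?case using R(3)[of 0] by (simp add: zero_fun_def)
    next
      case (insert i S)
      show ?case
        unfolding sum.insert[OF insert.hyps] by (intro cl R insert.IH)
    qed
    ultimately show ?case by (metis finite_class.finite_UNIV)
  next
    case (const c)
    show ?case by (rule R(3))
  next
    case (add f g)
    then show ?case using cl(1)[of f g] by (simp add: plus_fun_def)
  next
    case (mult f g)
    then show ?case using cl(2)[of f g] by (simp add: times_fun_def)
  qed
  then have "R = ?P" using R(5) by blast
  then show ?thesis using R(2) by simp
qed

section \<open>Gradients and the vanishing ideal\<close>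

definition grad :: "('a::real_inner \<Rightarrow> real) \<Rightarrow> 'a \<Rightarrow> 'a" where
  "grad p x = (SOME g. GDERIV p x :> g)"

lemma GDERIV_unique: "GDERIV p x :> g \<Longrightarrow> GDERIV p x :> h \<Longrightarrow> g = h"
  unfolding gderiv_def by (metis has_derivative_unique inner_commute vector_eq_rdot)

lemma grad_eqI: "GDERIV p x :> g \<Longrightarrow> grad p x = g"
  unfolding grad_def using GDERIV_unique by (metis someI_ex)

lemma polynomial_grad:
  fixes p :: "'a::euclidean_space \<Rightarrow> real"
  assumes "real_polynomial_function p"
  shows "GDERIV p x :> grad p x" "continuous_on S (grad p)"
proof -
  have "\<exists>g. (\<forall>x. GDERIV p x :> g x) \<and> continuous_on UNIV g"
    using assms
  proof (induction rule: real_polynomial_function.induct)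
    case (linear f)
    have "f h = h \<bullet> (\<Sum>b\<in>Basis. f b *\<^sub>R b)" for h
      using linear bounded_linear.linear[OF linear]
      by (subst euclidean_representation[of h, symmetric])
         (simp add: linear_sum linear_scale inner_sum_right inner_commute mult.commute del: euclidean_representation)
    then have "GDERIV f x :> (\<Sum>b\<in>Basis. f b *\<^sub>R b)" for x
      unfolding gderiv_def using bounded_linear_imp_has_derivative[OF linear]
      by (metis (no_types, lifting) has_derivative_transform UNIV_I ext)
    then show ?case by (intro exI[of _ "\<lambda>_. \<Sum>b\<in>Basis. f b *\<^sub>R b"]) auto
  next
    case (const c)
    show ?case by (intro exI[of _ "\<lambda>_. 0"]) (auto simp: gderiv_def)
  next
    case (add f g)
    then obtain f' g' where "\<forall>x. GDERIV f x :> f' x" "continuous_on UNIV f'"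
      "\<forall>x. GDERIV g x :> g' x" "continuous_on UNIV g'" by blast
    then show ?case
      by (intro exI[of _ "\<lambda>x. f' x + g' x"]) (auto simp: gderiv_def inner_add_right intro!: derivative_intros continuous_intros)
  next
    case (mult f g)
    then obtain f' g' where fg: "\<And>x. GDERIV f x :> f' x" "continuous_on UNIV f'"
      "\<And>x. GDERIV g x :> g' x" "continuous_on UNIV g'" by blast
    have c: "continuous_on UNIV f" "continuous_on UNIV g"
      using fg(1,3) unfolding gderiv_def
      by (auto simp: continuous_on_eq_continuous_at intro: has_derivative_continuous)
    have "GDERIV (\<lambda>x. f x * g x) x :> (f x *\<^sub>R g' x + g x *\<^sub>R f' x)" for x
      using GDERIV_mult[OF fg(1)[of x] fg(3)[of x]] by (simp add: add.commute)
    then show ?case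
      using fg c by (intro exI[of _ "\<lambda>x. f x *\<^sub>R g' x + g x *\<^sub>R f' x"]) (auto intro!: continuous_intros)
  qed
  then obtain g where g: "\<And>x. GDERIV p x :> g x" "continuous_on UNIV g" by blast
  have "grad p = g" using g(1) by (intro ext grad_eqI)
  then show "GDERIV p x :> grad p x" "continuous_on S (grad p)"
    using g by (auto intro: continuous_on_subset)
qed

lemma polynomial_has_derivative:
  fixes p :: "'a::euclidean_space \<Rightarrow> real"
  assumes "real_polynomial_function p"
  shows "(p has_derivative (\<lambda>h. grad p x \<bullet> h)) (at x)"
  using polynomial_grad(1)[OF assms, of x] by (simp add: gderiv_def inner_commute)

text \<open>Adapts \<open>inverse_function_theorem\<close> to derivatives given as plain functions:
  in finite dimensions continuity in each direction is continuity in operator norm, and an injective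
  derivative has a linear left inverse.\<close>

lemma inverse_function_euclidean:
  fixes f :: "'a::euclidean_space \<Rightarrow> 'a" and f' :: "'a \<Rightarrow> 'a \<Rightarrow> 'a"
  assumes U: "open U" "x0 \<in> U"
    and der: "\<And>x. x \<in> U \<Longrightarrow> (f has_derivative f' x) (at x)"
    and cont: "\<And>h. continuous_on U (\<lambda>x. f' x h)"
    and inj: "inj (f' x0)"
  obtains U' V g where "open U'" "U' \<subseteq> U" "x0 \<in> U'" "open V" "f x0 \<in> V" "homeomorphism U' V f g"
    "\<And>y. y \<in> V \<Longrightarrow> (g has_derivative inv (f' (g y))) (at y)"
    "\<And>y. y \<in> V \<Longrightarrow> bij (f' (g y))"
proof -
  have bl: "bounded_linear (f' x)" if "x \<in> U" for x
    using der[OF that] by (rule has_derivative_bounded_linear)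
  define F where "F x = Blinfun (f' x)" for x
  have F: "blinfun_apply (F x) = f' x" if "x \<in> U" for x
    using bl[OF that] by (simp add: F_def bounded_linear_Blinfun_apply)
  have lin: "linear (f' x0)" using bl[OF U(2)] by (rule bounded_linear.linear)
  obtain g0 where g0: "linear g0" "g0 \<circ> f' x0 = id"
    using linear_injective_left_inverse[OF lin inj] by blast
  have bg0: "bounded_linear g0" using g0(1) by (simp add: linear_conv_bounded_linear)
  have inv: "Blinfun g0 o\<^sub>L F x0 = id_blinfun"
    by (rule blinfun_eqI) (use g0 F[OF U(2)] bg0 in \<open>simp add: bounded_linear_Blinfun_apply fun_eq_iff\<close>)
  have contF: "continuous_on U F"
  proof (rule continuous_on_blinfun_componentwise)
    fix i :: 'a
    show "continuous_on U (\<lambda>x. F x i)"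
      using cont[of i] by (rule continuous_on_eq) (simp add: F)
  qed
  have derF: "(f has_derivative blinfun_apply (F x)) (at x)" if "x \<in> U" for x
    using der[OF that] by (simp add: F that)
  from inverse_function_theorem[OF U(1) derF contF U(2) inv]
  obtain U' V g g' where *: "open U'" "U' \<subseteq> U" "x0 \<in> U'" "open V" "f x0 \<in> V" "homeomorphism U' V f g"
    "\<And>y. y \<in> V \<Longrightarrow> (g has_derivative (g' y)) (at y)"
    "\<And>y. y \<in> V \<Longrightarrow> g' y = inv (blinfun_apply (F (g y)))"
    "\<And>y. y \<in> V \<Longrightarrow> bij (blinfun_apply (F (g y)))" by metis
  have gU: "g y \<in> U" if "y \<in> V" for y
    using *(2,6) that by (auto simp: homeomorphism_def)
  show ?thesis
  proof (rule that[OF *(1-6)])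
    show "(g has_derivative inv (f' (g y))) (at y)" if "y \<in> V" for y
      using *(7,8)[OF that] F[OF gU[OF that]] by simp
    show "bij (f' (g y))" if "y \<in> V" for y
      using *(9)[OF that] F[OF gU[OF that]] by simp
  qed
qed

text \<open>By the product rule the gradient of \<open>r * g\<close> is \<open>r\<close> times the
  gradient of \<open>g\<close> plus \<open>g\<close> times that of \<open>r\<close>, and the second
  term vanishes at a zero of \<open>g\<close>.\<close>

lemma ideal_gen_grad:
  fixes p :: "real ^ 'N \<Rightarrow> real"
  assumes p: "p \<in> ideal_gen {p. real_polynomial_function p} G"
    and G: "\<And>g. g \<in> G \<Longrightarrow> real_polynomial_function g" "\<And>g. g \<in> G \<Longrightarrow> g x = 0" "\<And>g. g \<in> G \<Longrightarrow> grad g x \<bullet> v = 0"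
  shows "real_polynomial_function p \<and> p x = 0 \<and> grad p x \<bullet> v = 0"
  using p
proof (induction rule: ideal_gen.induct)
  case zero
  have "grad 0 x = 0" by (rule grad_eqI) (simp add: gderiv_def zero_fun_def)
  then show ?case by (simp add: zero_fun_def real_polynomial_function.intros)
next
  case (step r g u)
  have r: "real_polynomial_function r" and g: "real_polynomial_function g" and u: "real_polynomial_function u"
    using step G by auto
  have eq: "r * g + u = (\<lambda>y. r y * g y + u y)" by (simp add: fun_eq_iff)
  have "GDERIV (\<lambda>y. r y * g y + u y) x :> (r x *\<^sub>R grad g x + g x *\<^sub>R grad r x + grad u x)"
    using GDERIV_add[OF GDERIV_mult[OF polynomial_grad(1)[OF r] polynomial_grad(1)[OF g]] polynomial_grad(1)[OF u]]
    by (simp add: add.commute)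
  then have "grad (\<lambda>y. r y * g y + u y) x = r x *\<^sub>R grad g x + g x *\<^sub>R grad r x + grad u x"
    by (rule grad_eqI)
  moreover have "real_polynomial_function (\<lambda>y. r y * g y + u y)"
    using r g u by (intro real_polynomial_function.intros(3,4))
  ultimately show ?case
    unfolding eq using step G by (simp add: inner_add_left)
qed

text \<open>The equations supplied by nonsingularity vary with the point; finite generators of the
  vanishing ideal do not, and by \<open>ideal_gen_grad\<close> their gradients control those of all
  polynomials in the ideal.\<close>

lemma finite_gradient_generators:
  fixes V :: "(real ^ 'N) set"
  obtains G where "finite G" "\<And>g. g \<in> G \<Longrightarrow> real_polynomial_function g" "\<And>g x. g \<in> G \<Longrightarrow> x \<in> V \<Longrightarrow> g x = 0"
    "\<And>p x v. real_polynomial_function p \<Longrightarrow> (\<And>y. y \<in> V \<Longrightarrow> p y = 0) \<Longrightarrow> x \<in> V \<Longrightarrow>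
       (\<And>g. g \<in> G \<Longrightarrow> grad g x \<bullet> v = 0) \<Longrightarrow> grad p x \<bullet> v = 0"
proof -
  let ?P = "{p :: real ^ 'N \<Rightarrow> real. real_polynomial_function p}"
  let ?I = "{p \<in> ?P. \<forall>y\<in>V. p y = 0}"
  have "ideal_on ?P ?I"
    by (auto simp: ideal_on_def zero_fun_def plus_fun_def times_fun_def intro: real_polynomial_function.intros)
  then obtain G where G: "finite G" "G \<subseteq> ?I" "?I \<subseteq> ideal_gen ?P G"
    using noetherian_polynomials[where 'N='N] unfolding noetherian_on_def by (metis (no_types, lifting) mem_Collect_eq subsetI)
  show ?thesis
  proof (rule that[OF G(1)])
    fix p x v assume p: "real_polynomial_function p" "\<And>y. y \<in> V \<Longrightarrow> p y = 0" "x \<in> V"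
      and v: "\<And>g. g \<in> G \<Longrightarrow> grad g x \<bullet> v = 0"
    have "p \<in> ideal_gen ?P G" using p G(3) by auto
    then show "grad p x \<bullet> v = 0"
      using ideal_gen_grad[of p G x v] G(2) p(3) v by auto
  qed (use G(2) in auto)
qed

section \<open>Degree bounds and dimension counts\<close>

definition monom_fun :: "('N \<Rightarrow> nat) \<Rightarrow> real ^ 'N \<Rightarrow> real" where
  "monom_fun e x = (\<Prod>i\<in>UNIV. (x $ i) ^ e i)"

definition exps :: "nat \<Rightarrow> ('N::finite \<Rightarrow> nat) set" where
  "exps K = {e. \<forall>i. e i \<le> K}"

text \<open>Degrees are bounded in each variable separately, so that there are
  \<open>Suc K ^ CARD('N)\<close> monomials and dimension counts become comparisons of
  powers.\<close>

definition deg_le :: "nat \<Rightarrow> (real ^ 'N \<Rightarrow> real) \<Rightarrow> bool" where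
  "deg_le K p \<longleftrightarrow> (\<exists>c. \<forall>x. p x = (\<Sum>e\<in>exps K. c e * monom_fun e x))"

lemma exps_PiE: "exps K = (UNIV :: 'N::finite set) \<rightarrow>\<^sub>E {..K}"
  by (auto simp: exps_def PiE_def Pi_def)

lemma finite_exps [simp]: "finite (exps K)"
  unfolding exps_PiE by (intro finite_PiE) auto

lemma card_exps: "card (exps K :: ('N::finite \<Rightarrow> nat) set) = Suc K ^ CARD('N)"
  unfolding exps_PiE by (subst card_funcsetE) auto

lemma deg_le_zero: "deg_le K (\<lambda>_. 0)"
  unfolding deg_le_def by (intro exI[of _ "\<lambda>_. 0"]) simp

lemma deg_le_add: "deg_le K p \<Longrightarrow> deg_le K q \<Longrightarrow> deg_le K (\<lambda>x. p x + q x)"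
  unfolding deg_le_def
  by (elim exE, rule_tac x = "\<lambda>e. c e + ca e" in exI) (simp add: algebra_simps sum.distrib)

lemma deg_le_sum: "finite S \<Longrightarrow> (\<And>i. i \<in> S \<Longrightarrow> deg_le K (p i)) \<Longrightarrow> deg_le K (\<lambda>x. \<Sum>i\<in>S. p i x)"
  by (induction S rule: finite_induct) (auto intro: deg_le_zero deg_le_add)

lemma deg_le_monom:
  fixes e :: "'N::finite \<Rightarrow> nat"
  assumes "e \<in> exps K" shows "deg_le K (\<lambda>x. c * monom_fun e x)"
proof -
  have "c * monom_fun e x = (\<Sum>e'\<in>exps K. (if e' = e then c else 0) * monom_fun e' x)" for x
    using assms by (simp add: if_distrib if_distribR sum.delta cong: if_cong)
  then show ?thesis unfolding deg_le_def by (intro exI[of _ "\<lambda>e'. if e' = e then c else 0"]) simp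
qed

lemma deg_le_mult:
  assumes "deg_le K p" "deg_le L q" shows "deg_le (K + L) (\<lambda>x. p x * q x)"
proof -
  obtain c d where c: "\<And>x. p x = (\<Sum>e\<in>exps K. c e * monom_fun e x)" and d: "\<And>x. q x = (\<Sum>e\<in>exps L. d e * monom_fun e x)"
    using assms by (auto simp: deg_le_def)
  have "p x * q x = (\<Sum>e\<in>exps K. \<Sum>e'\<in>exps L. (c e * d e') * monom_fun (\<lambda>i. e i + e' i) x)" for x
    by (simp add: c d sum_product monom_fun_def power_add prod.distrib mult_ac)
  moreover have "deg_le (K + L) (\<lambda>x. \<Sum>e\<in>exps K. \<Sum>e'\<in>exps L. (c e * d e') * monom_fun (\<lambda>i. e i + e' i) x)"
    by (intro deg_le_sum finite_exps deg_le_monom) (auto simp: exps_def add_mono)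
  ultimately show ?thesis by simp
qed

lemma deg_le_mono: "deg_le K p \<Longrightarrow> K \<le> L \<Longrightarrow> deg_le L p"
proof -
  assume "deg_le K p" "K \<le> L"
  then obtain c where c: "\<And>x. p x = (\<Sum>e\<in>exps K. c e * monom_fun e x)" by (auto simp: deg_le_def)
  have "deg_le L (\<lambda>x. \<Sum>e\<in>exps K. c e * monom_fun e x)"
    using \<open>K \<le> L\<close> by (intro deg_le_sum finite_exps deg_le_monom) (auto simp: exps_def intro: order_trans)
  moreover have "p = (\<lambda>x. \<Sum>e\<in>exps K. c e * monom_fun e x)" by (rule ext) (rule c)
  ultimately show ?thesis by simp
qed

lemma deg_le_const: "deg_le K (\<lambda>_. c)"
  using deg_le_monom[of "\<lambda>_. 0" K c] by (simp add: exps_def monom_fun_def)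

lemma deg_le_coord: "deg_le 1 (\<lambda>x. x $ i)"
proof -
  have "monom_fun (\<lambda>j. if j = i then 1 else 0) x = x $ i" for x :: "real ^ 'a"
    by (simp add: monom_fun_def if_distrib prod.delta cong: if_cong)
  then show ?thesis using deg_le_monom[of "\<lambda>j. if j = i then 1 else 0" 1 1] by (simp add: exps_def)
qed

lemma deg_le_linear:
  fixes f :: "real ^ 'N \<Rightarrow> real"
  assumes "linear f" shows "deg_le 1 f"
proof -
  have "f x = (\<Sum>i\<in>UNIV. f (axis i 1) * x $ i)" for x
  proof -
    have "f x = f (\<Sum>i\<in>UNIV. x $ i *\<^sub>R axis i 1)" using basis_expansion[of x] by (simp add: scalar_mult_eq_scaleR)
    then show ?thesis using assms by (simp add: linear_sum linear_scale mult.commute)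
  qed
  then have eq: "f = (\<lambda>x. \<Sum>i\<in>UNIV. f (axis i 1) * x $ i)" by (rule ext)
  have "deg_le 1 (\<lambda>x. \<Sum>i\<in>UNIV. f (axis i 1) * x $ i)"
    using deg_le_mult[OF deg_le_const[of 0] deg_le_coord] by (intro deg_le_sum) auto
  then show ?thesis by (subst eq)
qed

lemma real_polynomial_deg_le:
  fixes p :: "real ^ 'N \<Rightarrow> real"
  assumes "real_polynomial_function p" shows "\<exists>K. deg_le K p"
  using assms
proof (induction rule: real_polynomial_function.induct)
  case (linear f)
  then show ?case using deg_le_linear bounded_linear.linear by blast
next
  case (add f g)
  then obtain K L where "deg_le K f" "deg_le L g" by blast
  then have "deg_le (max K L) f" "deg_le (max K L) g" by (auto elim: deg_le_mono)
  then show ?case using deg_le_add by blast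
next
  case (mult f g)
  then show ?case using deg_le_mult by blast
qed (auto intro: deg_le_const)

lemma deg_le_power: "deg_le K p \<Longrightarrow> deg_le (n * K) (\<lambda>x. p x ^ n)"
proof (induction n)
  case 0
  show ?case using deg_le_const[of _ 1] by simp
next
  case (Suc n)
  then show ?case using deg_le_mult[of K p "n * K" "\<lambda>x. p x ^ n"] by simp
qed

lemma deg_le_prod:
  assumes "finite S" "\<And>i. i \<in> S \<Longrightarrow> deg_le K (p i)"
  shows "deg_le (card S * K) (\<lambda>x. \<Prod>i\<in>S. p i x)"
  using assms
proof (induction S rule: finite_induct)
  case empty
  show ?case using deg_le_const[of _ 1] by simp
next
  case (insert i S)
  then show ?case using deg_le_mult[of K "p i" "card S * K" "\<lambda>x. \<Prod>i\<in>S. p i x"] by simp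
qed

text \<open>Induction on the equations: one with a nonzero coefficient at \<open>i0\<close> serves
  to eliminate that unknown, which removes one equation and one unknown.\<close>

lemma underdetermined_system:
  fixes c :: "'i \<Rightarrow> 'j \<Rightarrow> real"
  assumes "finite J" "finite I" "card J < card I"
  shows "\<exists>l. (\<exists>i\<in>I. l i \<noteq> 0) \<and> (\<forall>j\<in>J. (\<Sum>i\<in>I. l i * c i j) = 0)"
  using assms
proof (induction J arbitrary: I c rule: finite_induct)
  case empty
  then obtain i where "i \<in> I" by fastforce
  then show ?case by (intro exI[of _ "\<lambda>_. 1"]) auto
next
  case (insert j J)
  show ?case
  proof (cases "\<forall>i\<in>I. c i j = 0")
    case True
    have "card J < card I" using insert by auto
    then obtain l where "\<exists>i\<in>I. l i \<noteq> 0" "\<forall>j\<in>J. (\<Sum>i\<in>I. l i * c i j) = 0"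
      using insert.IH[of I c] insert.prems by blast
    then show ?thesis using True by (intro exI[of _ l]) auto
  next
    case False
    then obtain i0 where i0: "i0 \<in> I" "c i0 j \<noteq> 0" by blast
    let ?c = "\<lambda>i k. c i k - c i j / c i0 j * c i0 k"
    have fin: "finite (I - {i0})" using insert by simp
    have "card J < card (I - {i0})" using insert i0 by auto
    then obtain l where l: "\<exists>i\<in>I - {i0}. l i \<noteq> 0" "\<forall>k\<in>J. (\<Sum>i\<in>I - {i0}. l i * ?c i k) = 0"
      using insert.IH[OF fin, of ?c] by blast
    \<comment> \<open>The eliminated unknown is recovered from equation \<open>j\<close>.\<close>
    define m where "m i = (if i = i0 then - (\<Sum>i\<in>I - {i0}. l i * c i j) / c i0 j else l i)" for i
    have msum: "(\<Sum>i\<in>I. m i * c i k) = m i0 * c i0 k + (\<Sum>i\<in>I - {i0}. l i * c i k)" for k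
      using i0 insert.prems by (subst sum.remove[of _ i0]) (auto simp: m_def intro!: sum.cong)
    have "(\<Sum>i\<in>I. m i * c i k) = 0" if "k \<in> insert j J" for k
    proof (cases "k = j")
      case True
      then show ?thesis unfolding msum using i0 by (simp add: m_def)
    next
      case False
      then have "(\<Sum>i\<in>I - {i0}. l i * ?c i k) = 0" using that l(2) by blast
      moreover have "(\<Sum>i\<in>I - {i0}. l i * ?c i k) = (\<Sum>i\<in>I - {i0}. l i * c i k) - (\<Sum>i\<in>I - {i0}. l i * c i j) / c i0 j * c i0 k"
        by (simp add: algebra_simps sum_subtractf sum_distrib_left sum_distrib_right sum_divide_distrib)
      ultimately show ?thesis unfolding msum by (simp add: m_def)
    qed
    moreover have "\<exists>i\<in>I. m i \<noteq> 0" using l(1) by (auto simp: m_def)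
    ultimately show ?thesis by blast
  qed
qed

text \<open>With the other variables fixed, the sum is a polynomial in one variable with infinitely
  many zeros, so its coefficients vanish; these are polynomials in the remaining variables, to which
  the induction hypothesis applies.\<close>

lemma polynomial_coeffs_zero_on_product:
  fixes c :: "('i \<Rightarrow> nat) \<Rightarrow> real"
  assumes "finite S" and "\<And>i. i \<in> S \<Longrightarrow> infinite (X i)"
    and "\<And>x. (\<And>i. i \<in> S \<Longrightarrow> x i \<in> X i) \<Longrightarrow> (\<Sum>e\<in>S \<rightarrow>\<^sub>E {..K}. c e * (\<Prod>i\<in>S. x i ^ e i)) = (0::real)"
  shows "\<forall>e\<in>S \<rightarrow>\<^sub>E {..K}. c e = 0"
  using assms
proof (induction S arbitrary: c rule: finite_induct)
  case empty
  then show ?case by simp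
next
  case (insert s S)
  have expand: "(\<Sum>e\<in>insert s S \<rightarrow>\<^sub>E {..K}. c e * (\<Prod>i\<in>insert s S. x i ^ e i))
     = (\<Sum>k\<le>K. (\<Sum>e\<in>S \<rightarrow>\<^sub>E {..K}. c (e(s := k)) * (\<Prod>i\<in>S. x i ^ e i)) * x s ^ k)" for x
  proof -
    have "(\<Sum>e\<in>insert s S \<rightarrow>\<^sub>E {..K}. c e * (\<Prod>i\<in>insert s S. x i ^ e i))
       = (\<Sum>(k, e)\<in>{..K} \<times> (S \<rightarrow>\<^sub>E {..K}). c (e(s := k)) * (\<Prod>i\<in>insert s S. x i ^ (e(s := k)) i))"
      unfolding PiE_insert_eq using insert.hyps
      by (subst sum.reindex[OF inj_combinator]) (auto simp: split_beta comp_def)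
    also have "\<dots> = (\<Sum>k\<le>K. \<Sum>e\<in>S \<rightarrow>\<^sub>E {..K}. c (e(s := k)) * (\<Prod>i\<in>insert s S. x i ^ (e(s := k)) i))"
      by (rule sum.cartesian_product[symmetric])
    also have "\<dots> = (\<Sum>k\<le>K. \<Sum>e\<in>S \<rightarrow>\<^sub>E {..K}. c (e(s := k)) * (\<Prod>i\<in>S. x i ^ e i) * x s ^ k)"
    proof (intro sum.cong refl)
      fix k e
      have "(\<Prod>i\<in>S. x i ^ (e(s := k)) i) = (\<Prod>i\<in>S. x i ^ e i)"
        using insert.hyps by (intro prod.cong) auto
      then show "c (e(s := k)) * (\<Prod>i\<in>insert s S. x i ^ (e(s := k)) i) = c (e(s := k)) * (\<Prod>i\<in>S. x i ^ e i) * x s ^ k"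
        using insert.hyps by (simp add: mult_ac)
    qed
    finally show ?thesis by (simp add: sum_distrib_right)
  qed
  have "\<forall>e\<in>S \<rightarrow>\<^sub>E {..K}. c (e(s := k)) = 0" if k: "k \<le> K" for k
  proof (rule insert.IH)
    show "infinite (X i)" if "i \<in> S" for i using insert.prems(1) that by simp
    fix x assume x: "\<And>i. i \<in> S \<Longrightarrow> x i \<in> X i"
    define q where "q k = (\<Sum>e\<in>S \<rightarrow>\<^sub>E {..K}. c (e(s := k)) * (\<Prod>i\<in>S. x i ^ e i))" for k
    have "(\<Sum>k\<le>K. q k * z ^ k) = 0" if "z \<in> X s" for z
    proof -
      have "(\<Sum>e\<in>insert s S \<rightarrow>\<^sub>E {..K}. c e * (\<Prod>i\<in>insert s S. (x(s := z)) i ^ e i)) = 0"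
        by (rule insert.prems(2)) (use x that in auto)
      moreover have "(\<Prod>i\<in>S. (x(s := z)) i ^ e i) = (\<Prod>i\<in>S. x i ^ e i)" for e :: "'i \<Rightarrow> nat"
        using insert.hyps by (intro prod.cong) auto
      ultimately show ?thesis unfolding expand by (simp add: q_def)
    qed
    then have "X s \<subseteq> {z. (\<Sum>k\<le>K. q k * z ^ k) = 0}" by blast
    then have "infinite {z. (\<Sum>k\<le>K. q k * z ^ k) = 0}" using insert.prems(1)[of s] finite_subset by blast
    then have "\<forall>k\<le>K. q k = 0" using polyfun_rootbound[where c = q and n = K] by blast
    then show "(\<Sum>e\<in>S \<rightarrow>\<^sub>E {..K}. c (e(s := k)) * (\<Prod>i\<in>S. x i ^ e i)) = 0" using k by (simp add: q_def)
  qed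
  then show ?case unfolding PiE_insert_eq by auto
qed

lemma polynomial_coeffs_zero_on_open:
  fixes c :: "('N::finite \<Rightarrow> nat) \<Rightarrow> real"
  assumes U: "open U" "U \<noteq> {}" and zero: "\<And>x. x \<in> U \<Longrightarrow> (\<Sum>e\<in>exps K. c e * monom_fun e x) = 0" and e: "e \<in> exps K"
  shows "c e = 0"
proof -
  obtain x0 where "x0 \<in> U" using U by blast
  then obtain A where A: "\<And>i. open (A i)" "\<And>i. x0 $ i \<in> A i" "\<And>y. (\<And>i. y $ i \<in> A i) \<Longrightarrow> y \<in> U"
    using U(1) unfolding open_vec_def by metis
  have "infinite (A i)" for i
  proof -
    obtain r where "r > 0" "ball (x0 $ i) r \<subseteq> A i" using A(1,2)[of i] openE by blast
    then show ?thesis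
      using infinite_super[of "{x0 $ i - r<..<x0 $ i + r}" "A i"] infinite_Ioo[of "x0 $ i - r" "x0 $ i + r"]
      by (simp add: ball_eq_greaterThanLessThan)
  qed
  moreover have "(\<Sum>e\<in>(UNIV :: 'N set) \<rightarrow>\<^sub>E {..K}. c e * (\<Prod>i\<in>UNIV. x i ^ e i)) = 0" if "\<And>i. x i \<in> A i" for x
    using zero[OF A(3), of "\<chi> i. x i"] that by (simp add: monom_fun_def exps_PiE)
  ultimately have "\<forall>e\<in>(UNIV :: 'N set) \<rightarrow>\<^sub>E {..K}. c e = 0"
    by (intro polynomial_coeffs_zero_on_product[of UNIV A]) auto
  then show ?thesis using e by (simp add: exps_PiE)
qed


text \<open>There are \<open>Suc E ^ (CARD('N) + 1)\<close> unknown coefficients. Substituting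
  \<open>F\<close> gives polynomials of degree at most \<open>K\<close> in each variable, hence
  \<open>Suc K ^ CARD('N)\<close> linear equations, and this number is at most
  \<open>Suc E ^ CARD('N) * E\<close>. The value of \<open>E\<close> is chosen to make the last
  estimate hold.\<close>

lemma coordinate_relation:
  fixes F :: "real ^ 'N \<Rightarrow> real ^ 'N" and i :: 'N
  assumes F: "\<And>j. deg_le d (\<lambda>x. F x $ j)" and E: "E = (1 + CARD('N) * d) ^ CARD('N)"
  obtains l :: "nat \<Rightarrow> ('N \<Rightarrow> nat) \<Rightarrow> real" where
    "\<exists>a\<le>E. \<exists>e\<in>exps E. l a e \<noteq> 0"
    "\<And>x. (\<Sum>a\<le>E. (\<Sum>e\<in>exps E. l a e * monom_fun e (F x)) * (x $ i) ^ a) = 0"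
proof -
  \<comment> \<open>Degree in each variable: \<open>E\<close> from the power of
    \<open>x $ i\<close>, and \<open>E * d\<close> from each of the \<open>CARD('N)\<close> powers
    of components of \<open>F\<close>.\<close>
  define K where "K = E + CARD('N) * (E * d)"
  let ?I = "{..E} \<times> (exps E :: ('N \<Rightarrow> nat) set)"
  let ?J = "exps K :: ('N \<Rightarrow> nat) set"
  have "deg_le K (\<lambda>x. monom_fun e (F x) * (x $ i) ^ a)" if a: "a \<le> E" and e: "e \<in> exps E" for a e
  proof -
    have "deg_le (E * d) (\<lambda>x. F x $ j ^ e j)" for j
      using deg_le_mono[OF deg_le_power[OF F[of j], of "e j"], of "E * d"] e by (simp add: exps_def)
    then have "deg_le (CARD('N) * (E * d)) (\<lambda>x. monom_fun e (F x))"
      unfolding monom_fun_def by (intro deg_le_prod) auto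
    moreover have "deg_le E (\<lambda>x. (x $ i) ^ a)"
      using deg_le_mono[OF deg_le_power[OF deg_le_coord[of i], of a], of E] a by simp
    ultimately show ?thesis using deg_le_mult by (fastforce simp: K_def add.commute)
  qed
  then have "\<forall>p\<in>?I. \<exists>c. \<forall>x. monom_fun (snd p) (F x) * (x $ i) ^ fst p = (\<Sum>e\<in>exps K. c e * monom_fun e x)"
    unfolding deg_le_def by auto
  then obtain c where c: "\<And>p x. p \<in> ?I \<Longrightarrow> monom_fun (snd p) (F x) * (x $ i) ^ fst p = (\<Sum>e\<in>exps K. c p e * monom_fun e x)"
    by metis
  have "card ?J < card ?I"
  proof -
    have "Suc K \<le> Suc E * (1 + CARD('N) * d)" by (simp add: K_def algebra_simps)
    then have "Suc K ^ CARD('N) \<le> (Suc E * (1 + CARD('N) * d)) ^ CARD('N)" by (rule power_mono) simp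
    also have "\<dots> = Suc E ^ CARD('N) * E" by (simp only: power_mult_distrib E)
    also have "\<dots> < Suc E ^ CARD('N) * Suc E" by simp
    finally show ?thesis by (simp add: card_exps card_cartesian_product mult.commute)
  qed
  then obtain l where l: "\<exists>p\<in>?I. l p \<noteq> 0" "\<forall>e\<in>?J. (\<Sum>p\<in>?I. l p * c p e) = 0"
    using underdetermined_system[of ?J ?I c] by auto
  show ?thesis
  proof (rule that[of "\<lambda>a e. l (a, e)"])
    show "\<exists>a\<le>E. \<exists>e\<in>exps E. l (a, e) \<noteq> 0" using l(1) by auto
    fix x :: "real ^ 'N"
    have "(\<Sum>a\<le>E. (\<Sum>e\<in>exps E. l (a, e) * monom_fun e (F x)) * (x $ i) ^ a)
       = (\<Sum>a\<le>E. \<Sum>e\<in>exps E. l (a, e) * (monom_fun e (F x) * (x $ i) ^ a))"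
      by (simp add: sum_distrib_right mult.assoc)
    also have "\<dots> = (\<Sum>p\<in>?I. l p * (monom_fun (snd p) (F x) * (x $ i) ^ fst p))"
      by (subst sum.cartesian_product) (simp add: split_beta)
    also have "\<dots> = (\<Sum>p\<in>?I. l p * (\<Sum>e\<in>?J. c p e * monom_fun e x))"
      by (intro sum.cong refl) (simp only: c)
    also have "\<dots> = (\<Sum>e\<in>?J. (\<Sum>p\<in>?I. l p * c p e) * monom_fun e x)"
      by (simp only: sum_distrib_left sum_distrib_right mult.assoc) (rule sum.swap)
    also have "\<dots> = 0" using l(2) by simp
    finally show "(\<Sum>a\<le>E. (\<Sum>e\<in>exps E. l (a, e) * monom_fun e (F x)) * (x $ i) ^ a) = 0" .
  qed
qed

lemma open_Int_dense_finite:
  fixes D :: "'i \<Rightarrow> 'a::topological_space set"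
  assumes "finite I" and D: "\<And>i. i \<in> I \<Longrightarrow> open (D i)" "\<And>i U. i \<in> I \<Longrightarrow> open U \<Longrightarrow> U \<noteq> {} \<Longrightarrow> U \<inter> D i \<noteq> {}"
    and W: "open W" "W \<noteq> {}"
  shows "\<exists>y\<in>W. \<forall>i\<in>I. y \<in> D i"
  using assms
proof (induction I arbitrary: W rule: finite_induct)
  case (insert i I)
  have "open (W \<inter> D i)" "W \<inter> D i \<noteq> {}" using insert.prems by auto
  then obtain y where "y \<in> W \<inter> D i" "\<forall>j\<in>I. y \<in> D j"
    using insert.IH[of "W \<inter> D i"] insert.prems by (metis insertCI)
  then show ?case by auto
qed auto

lemma continuous_on_monom_fun [continuous_intros]: "continuous_on S (monom_fun e)"
  unfolding monom_fun_def[abs_def] by (intro continuous_intros)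

text \<open>
  A Bezout bound without algebraic geometry: counting dimensions, every coordinate \<open>x $ i\<close> satisfies
  a polynomial relation over the components of \<open>F\<close>; nondegenerate zeros persist under a
  perturbation of the value of \<open>F\<close> at which these relations are nontrivial.
\<close>

lemma card_nondegenerate_zeros:
  fixes F :: "real ^ 'N \<Rightarrow> real ^ 'N"
  assumes F: "\<And>j. deg_le d (\<lambda>x. F x $ j)" and rp: "\<And>j. real_polynomial_function (\<lambda>x. F x $ j)"
    and E: "E = (1 + CARD('N) * d) ^ CARD('N)"
    and Z: "finite Z" "\<And>z. z \<in> Z \<Longrightarrow> F z = 0"
      "\<And>z v. z \<in> Z \<Longrightarrow> (\<And>j. grad (\<lambda>x. F x $ j) z \<bullet> v = 0) \<Longrightarrow> v = 0"
  shows "card Z \<le> E ^ CARD('N)"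
proof -
  define F' where "F' x h = (\<chi> j. grad (\<lambda>x. F x $ j) x \<bullet> h)" for x h
  have der: "(F has_derivative F' x) (at x)" for x
    unfolding F'_def
    by (subst has_derivative_componentwise_within)
       (auto simp: Basis_vec_def inner_axis intro!: polynomial_has_derivative rp)
  have contF': "continuous_on U (\<lambda>x. F' x h)" for U h
    unfolding F'_def by (intro continuous_on_vec_lambda continuous_intros polynomial_grad(2) rp)
  have linF': "linear (F' x)" for x
    using der[of x] by (rule has_derivative_linear)
  have injF': "inj (F' z)" if "z \<in> Z" for z
    unfolding linear_injective_0[OF linF']
    using Z(3)[OF that] by (auto simp: F'_def vec_eq_iff)
  \<comment> \<open>Disjoint balls around the zeros keep the perturbed zeros distinct.\<close>
  obtain r where r: "r > 0" "\<And>z w. z \<in> Z \<Longrightarrow> w \<in> Z \<Longrightarrow> z \<noteq> w \<Longrightarrow> ball z r \<inter> ball w r = {}"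
  proof -
    have "\<exists>r>0. \<forall>z\<in>Z. \<forall>w\<in>Z. z \<noteq> w \<longrightarrow> r \<le> dist z w"
    proof -
      have "\<exists>r>0. \<forall>w\<in>Z. w \<noteq> z \<longrightarrow> r \<le> dist z w" for z
        using finite_set_avoid[OF Z(1), of z] by metis
      then obtain \<rho> where \<rho>: "\<And>z. \<rho> z > 0" "\<And>z w. w \<in> Z \<Longrightarrow> w \<noteq> z \<Longrightarrow> \<rho> z \<le> dist z w" by metis
      show ?thesis
      proof (cases "Z = {}")
        case False
        let ?m = "Min (\<rho> ` Z)"
        have "?m > 0" using Z(1) False \<rho>(1) by (simp add: Min_gr_iff)
        moreover have "?m \<le> dist z w" if "z \<in> Z" "w \<in> Z" "z \<noteq> w" for z w
        proof -
          have "Min (\<rho> ` Z) \<le> \<rho> z" using Z(1) that by (intro Min_le) auto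
          also have "\<dots> \<le> dist z w" using that by (intro \<rho>(2)) auto
          finally show ?thesis .
        qed
        ultimately show ?thesis by blast
      qed (auto intro: exI[of _ 1])
    qed
    then obtain r where r: "r > 0" "\<And>z w. z \<in> Z \<Longrightarrow> w \<in> Z \<Longrightarrow> z \<noteq> w \<Longrightarrow> r \<le> dist z w" by blast
    show ?thesis
    proof (rule that[of "r / 2"])
      show "ball z (r / 2) \<inter> ball w (r / 2) = {}" if "z \<in> Z" "w \<in> Z" "z \<noteq> w" for z w
      proof (rule ccontr)
        assume "ball z (r / 2) \<inter> ball w (r / 2) \<noteq> {}"
        then obtain x where "dist z x < r / 2" "dist w x < r / 2" by auto
        then have "dist z w < r" using dist_triangle[of z w x] by (simp add: dist_commute)
        then show False using r(2)[OF that] by simp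
      qed
    qed (use r in simp)
  qed
  \<comment> \<open>By the inverse function theorem every value near 0 is still attained in the ball
    around \<open>z\<close>.\<close>
  have "\<exists>V. open V \<and> 0 \<in> V \<and> (\<forall>y\<in>V. \<exists>x\<in>ball z r. F x = y)" if z: "z \<in> Z" for z
  proof -
    have zin: "z \<in> ball z r" using r(1) by simp
    from inverse_function_euclidean[OF open_ball zin der contF' injF'[OF z]]
    obtain U' V g where V: "open U'" "U' \<subseteq> ball z r" "z \<in> U'" "open V" "F z \<in> V" "homeomorphism U' V F g"
      by metis
    have "\<exists>x\<in>ball z r. F x = y" if "y \<in> V" for y
      using V(2,6) that unfolding homeomorphism_def by (metis imageE subsetD)
    then show ?thesis using V(4,5) Z(2)[OF z] by auto
  qed
  then obtain V where V: "\<And>z. z \<in> Z \<Longrightarrow> open (V z)" "\<And>z. z \<in> Z \<Longrightarrow> 0 \<in> V z"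
    "\<And>z y. z \<in> Z \<Longrightarrow> y \<in> V z \<Longrightarrow> \<exists>x\<in>ball z r. F x = y" by metis
  let ?W = "\<Inter>z\<in>Z. V z"
  have "0 \<in> ?W" using V(2) by blast
  then have W: "open ?W" "?W \<noteq> {}" using V(1) Z(1) by auto
  have "\<forall>i. \<exists>l :: nat \<Rightarrow> ('N \<Rightarrow> nat) \<Rightarrow> real. (\<exists>a\<le>E. \<exists>e\<in>exps E. l a e \<noteq> 0) \<and>
    (\<forall>x. (\<Sum>a\<le>E. (\<Sum>e\<in>exps E. l a e * monom_fun e (F x)) * (x $ i) ^ a) = 0)"
  proof
    fix i
    show "\<exists>l :: nat \<Rightarrow> ('N \<Rightarrow> nat) \<Rightarrow> real. (\<exists>a\<le>E. \<exists>e\<in>exps E. l a e \<noteq> 0) \<and>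
      (\<forall>x. (\<Sum>a\<le>E. (\<Sum>e\<in>exps E. l a e * monom_fun e (F x)) * (x $ i) ^ a) = 0)"
      by (rule coordinate_relation[OF F E, of i]) blast
  qed
  from choice[OF this] obtain l :: "'N \<Rightarrow> nat \<Rightarrow> ('N \<Rightarrow> nat) \<Rightarrow> real" where
    l: "\<And>i. \<exists>a\<le>E. \<exists>e\<in>exps E. l i a e \<noteq> 0"
      "\<And>i x. (\<Sum>a\<le>E. (\<Sum>e\<in>exps E. l i a e * monom_fun e (F x)) * (x $ i) ^ a) = 0" by blast
  \<comment> \<open>The values \<open>y\<close> at which the relation for coordinate
    \<open>i\<close> remains a nonzero polynomial in that coordinate. A polynomial with a nonzero
    coefficient cannot vanish on an open set, so \<open>D i\<close> is open and dense.\<close>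
  define D where "D i = {y. \<exists>a\<le>E. (\<Sum>e\<in>exps E. l i a e * monom_fun e y) \<noteq> 0}" for i
  have Dopen: "open (D i)" for i
  proof -
    have "D i = (\<Union>a\<in>{..E}. {y. (\<Sum>e\<in>exps E. l i a e * monom_fun e y) \<noteq> 0})" by (auto simp: D_def)
    moreover have "open {y. (\<Sum>e\<in>exps E. l i a e * monom_fun e y) \<noteq> 0}" for a
      by (intro open_Collect_neq continuous_intros)
    ultimately show ?thesis by auto
  qed
  have Ddense: "U \<inter> D i \<noteq> {}" if U: "open U" "U \<noteq> {}" for i U
  proof
    assume "U \<inter> D i = {}"
    then have *: "(\<Sum>e\<in>exps E. l i a e * monom_fun e y) = 0" if "y \<in> U" "a \<le> E" for a y
      using that by (auto simp: D_def)
    obtain a e where "a \<le> E" "e \<in> exps E" "l i a e \<noteq> 0" using l(1) by blast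
    then show False using polynomial_coeffs_zero_on_open[OF U, where K = E and c = "l i a" and e = e] * by blast
  qed
  have "\<exists>y\<in>?W. \<forall>i\<in>UNIV. y \<in> D i"
    by (rule open_Int_dense_finite[OF finite_class.finite_UNIV Dopen Ddense W])
  then obtain y where y: "y \<in> ?W" "\<And>i. y \<in> D i" by blast
  \<comment> \<open>It contains the \<open>i\<close>-th coordinate of every solution of
    \<open>F x = y\<close>, and it has at most \<open>E\<close> elements.\<close>
  define S where "S i = {s. (\<Sum>a\<le>E. (\<Sum>e\<in>exps E. l i a e * monom_fun e y) * s ^ a) = 0}" for i
  have S: "finite (S i)" "card (S i) \<le> E" for i
  proof -
    obtain a where "a \<le> E" "(\<Sum>e\<in>exps E. l i a e * monom_fun e y) \<noteq> 0" using y(2)[of i] by (auto simp: D_def)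
    then show "finite (S i)" "card (S i) \<le> E"
      unfolding S_def using polyfun_rootbound[where c = "\<lambda>a. \<Sum>e\<in>exps E. l i a e * monom_fun e y" and n = E] by auto
  qed
  have "\<exists>x. x \<in> ball z r \<and> F x = y" if "z \<in> Z" for z
    using V(3)[OF that, of y] y(1) that by blast
  then have "\<exists>g. \<forall>z\<in>Z. g z \<in> ball z r \<and> F (g z) = y" by (intro bchoice) blast
  then obtain g where g: "\<And>z. z \<in> Z \<Longrightarrow> g z \<in> ball z r" "\<And>z. z \<in> Z \<Longrightarrow> F (g z) = y" by blast
  have inj: "inj_on (\<lambda>z i. g z $ i) Z"
  proof (rule inj_onI)
    fix z w assume zw: "z \<in> Z" "w \<in> Z" "(\<lambda>i. g z $ i) = (\<lambda>i. g w $ i)"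
    then have eq: "g z = g w" by (simp add: vec_eq_iff fun_eq_iff)
    have "g w \<in> ball z r \<inter> ball w r" using g(1)[OF zw(1)] g(1)[OF zw(2)] eq by simp
    then show "z = w" using r(2)[OF zw(1,2)] by blast
  qed
  have sub: "(\<lambda>z i. g z $ i) ` Z \<subseteq> Pi\<^sub>E UNIV S"
  proof (auto simp: PiE_def Pi_def S_def)
    fix z i assume "z \<in> Z"
    then show "(\<Sum>a\<le>E. (\<Sum>e\<in>exps E. l i a e * monom_fun e y) * (g z $ i) ^ a) = 0"
      using l(2)[of i "g z"] g(2) by simp
  qed
  have "card Z \<le> card (Pi\<^sub>E UNIV S)"
    by (rule card_inj_on_le[OF inj sub]) (auto intro: finite_PiE S)
  also have "\<dots> = (\<Prod>i\<in>UNIV. card (S i))" by (simp add: card_PiE)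
  also have "\<dots> \<le> (\<Prod>i\<in>(UNIV :: 'N set). E)"
    by (intro prod_mono conjI S) simp
  finally show ?thesis by simp
qed

text \<open>At a nondegenerate zero the gradients of \<open>Q\<close> span the space, so
  \<open>CARD('N)\<close> of them already do. The point is therefore a nondegenerate zero of one of
  the \<open>card Q ^ CARD('N)\<close> square systems formed from \<open>Q\<close>, to each of which
  \<open>card_nondegenerate_zeros\<close> applies.\<close>

lemma finite_common_nondegenerate_zeros:
  fixes Q :: "(real ^ 'N \<Rightarrow> real) set"
  assumes Q: "finite Q" "\<And>q. q \<in> Q \<Longrightarrow> real_polynomial_function q" "\<And>q. q \<in> Q \<Longrightarrow> deg_le d q"
  defines "Z \<equiv> {x. (\<forall>q\<in>Q. q x = 0) \<and> (\<forall>v. (\<forall>q\<in>Q. grad q x \<bullet> v = 0) \<longrightarrow> v = 0)}"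
  shows "finite Z \<and> card Z \<le> card Q ^ CARD('N) * ((1 + CARD('N) * d) ^ CARD('N)) ^ CARD('N)"
proof -
  define E where "E = (1 + CARD('N) * d) ^ CARD('N)"
  let ?S = "(UNIV :: 'N set) \<rightarrow>\<^sub>E Q"
  define Zs where "Zs \<sigma> = {x. (\<forall>j. \<sigma> j x = 0) \<and> (\<forall>v. (\<forall>j. grad (\<sigma> j) x \<bullet> v = 0) \<longrightarrow> v = 0)}"
    for \<sigma> :: "'N \<Rightarrow> real ^ 'N \<Rightarrow> real"
  have finS: "finite ?S" using Q(1) by (intro finite_PiE) auto
  \<comment> \<open>The bound for square systems presupposes a finite set of zeros; applied to all
    finite subsets, it yields finiteness as well.\<close>
  have bound: "finite (Zs \<sigma>) \<and> card (Zs \<sigma>) \<le> E ^ CARD('N)" if \<sigma>: "\<sigma> \<in> ?S" for \<sigma>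
  proof (rule finite_if_finite_subsets_card_bdd)
    fix Y assume Y: "Y \<subseteq> Zs \<sigma>" "finite Y"
    have \<sigma>Q: "\<sigma> j \<in> Q" for j using \<sigma> by auto
    show "card Y \<le> E ^ CARD('N)"
    proof (rule card_nondegenerate_zeros[where F = "\<lambda>x. \<chi> j. \<sigma> j x" and d = d, OF _ _ E_def Y(2)])
      show "deg_le d (\<lambda>x. (\<chi> j. \<sigma> j x) $ j)" "real_polynomial_function (\<lambda>x. (\<chi> j. \<sigma> j x) $ j)" for j
        using Q(2,3)[OF \<sigma>Q[of j]] by simp_all
      show "(\<chi> j. \<sigma> j z) = 0" if "z \<in> Y" for z
        using Y(1) that by (auto simp: Zs_def vec_eq_iff)
      show "v = 0" if "z \<in> Y" "\<And>j. grad (\<lambda>x. (\<chi> j. \<sigma> j x) $ j) z \<bullet> v = 0" for z v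
        using Y(1) that by (auto simp: Zs_def)
    qed
  qed
  have sub: "Z \<subseteq> (\<Union>\<sigma>\<in>?S. Zs \<sigma>)"
  proof
    fix x assume x: "x \<in> Z"
    let ?G = "(\<lambda>q. grad q x) ` Q"
    have "span ?G = UNIV"
    proof (rule ccontr)
      assume "span ?G \<noteq> UNIV"
      then obtain v where v: "v \<noteq> 0" "\<And>w. w \<in> span ?G \<Longrightarrow> v \<bullet> w = 0"
        using span_not_univ_subset_hyperplane[of ?G] by auto
      have "grad q x \<bullet> v = 0" if "q \<in> Q" for q
      proof -
        have "grad q x \<in> span ?G" using that by (intro span_base imageI)
        then show ?thesis using v(2)[of "grad q x"] by (simp add: inner_commute)
      qed
      then show False using x v(1) unfolding Z_def by blast
    qed
    note spanG = this
    obtain B where B: "B \<subseteq> ?G" "independent B" "?G \<subseteq> span B" "card B = dim ?G"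
      by (rule basis_exists[of ?G])
    have "dim ?G = dim (span ?G)" by simp
    then have dimG: "dim ?G = CARD('N)" unfolding spanG by simp
    have "span ?G \<subseteq> span B" using B(3) by (rule span_minimal) simp
    then have spanB: "span B = UNIV" unfolding spanG by blast
    have "finite B" using B(2) by (rule independent_imp_finite)
    then obtain b where b: "bij_betw b (UNIV :: 'N set) B"
      using finite_same_card_bij[of "UNIV :: 'N set" B] B(4) dimG by auto
    have "\<exists>q\<in>Q. b j = grad q x" for j
      using b B(1) by (auto simp: bij_betw_def)
    then obtain \<sigma> where \<sigma>: "\<And>j. \<sigma> j \<in> Q" "\<And>j. b j = grad (\<sigma> j) x" by metis
    have "v = 0" if v: "\<And>j. grad (\<sigma> j) x \<bullet> v = 0" for v
    proof -
      have "orthogonal v w" if "w \<in> B" for w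
        using that b v \<sigma>(2) by (auto simp: bij_betw_def orthogonal_def inner_commute)
      then have "orthogonal v v" using orthogonal_to_span[of v B v] spanB by auto
      then show ?thesis by (simp add: orthogonal_self)
    qed
    then have "x \<in> Zs \<sigma>" using x \<sigma>(1) by (auto simp: Zs_def Z_def)
    moreover have "\<sigma> \<in> ?S" using \<sigma>(1) by auto
    ultimately show "x \<in> (\<Union>\<sigma>\<in>?S. Zs \<sigma>)" by blast
  qed
  have fin: "finite (\<Union>\<sigma>\<in>?S. Zs \<sigma>)" using finS bound by blast
  have le: "card (\<Union>\<sigma>\<in>?S. Zs \<sigma>) \<le> card Q ^ CARD('N) * E ^ CARD('N)"
  proof -
    have "card (\<Union>\<sigma>\<in>?S. Zs \<sigma>) \<le> (\<Sum>\<sigma>\<in>?S. card (Zs \<sigma>))" by (rule card_UN_le[OF finS])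
    also have "\<dots> \<le> of_nat (card ?S) * E ^ CARD('N)" using bound by (intro sum_bounded_above) auto
    finally show ?thesis by (simp add: card_funcsetE)
  qed
  have "finite Z" using sub fin by (rule finite_subset)
  moreover have "card Z \<le> card Q ^ CARD('N) * E ^ CARD('N)"
    using card_mono[OF fin sub] le by (rule order_trans)
  ultimately show ?thesis by (simp add: E_def)
qed

section \<open>Charts of algebraic manifolds\<close>

lemma local_parametrizationD:
  assumes "local_parametrization M U \<phi> J"
  shows "open U" "openin (top_of_set M) (\<phi> ` U)" "\<phi> ` U \<subseteq> M" "inj_on \<phi> U"
    "\<And>u. u \<in> U \<Longrightarrow> (\<phi> has_derivative (\<lambda>h. J u *v h)) (at u)"
    "continuous_on U J" "continuous_on U \<phi>" "\<And>u. u \<in> U \<Longrightarrow> inj ((*v) (J u))"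
proof -
  obtain \<psi> where \<psi>: "homeomorphism U (\<phi> ` U) \<phi> \<psi>" using assms by (auto simp: local_parametrization_def)
  show "inj_on \<phi> U" 
    by (rule inj_on_inverseI[where g = \<psi>]) (use \<psi> in \<open>simp add: homeomorphism_def\<close>)
  show "continuous_on U \<phi>" using \<psi> by (simp add: homeomorphism_def)
  have "openin (top_of_set M) (\<phi> ` U)" using assms by (simp add: local_parametrization_def)
  then show "\<phi> ` U \<subseteq> M" by (rule openin_imp_subset)
qed (use assms in \<open>auto simp: local_parametrization_def\<close>)

lemma local_parametrization_empty: "local_parametrization M {} \<phi> J"
  by (auto simp: local_parametrization_def homeomorphism_def)

lemma algebraic_manifold_varietyE:
  assumes "algebraic_manifold n M"
  obtains V Ob where "open Ob" "M = nonsingular_points V \<inter> Ob" "M \<subseteq> V" "\<And>x. x \<in> M \<Longrightarrow> nonsingular_of_dim n V x"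
proof -
  obtain V where V: "openin (top_of_set (nonsingular_points V)) M" "\<And>x. x \<in> M \<Longrightarrow> nonsingular_of_dim n V x"
    using assms by (auto simp: algebraic_manifold_def)
  then obtain Ob where "open Ob" "M = nonsingular_points V \<inter> Ob" by (auto simp: openin_open)
  moreover have "M \<subseteq> V" using V(2) by (auto simp: nonsingular_of_dim_def)
  ultimately show ?thesis using that V(2) by blast
qed

lemma nonsingular_of_dim_gradE:
  fixes V :: "(real ^ 'N) set"
  assumes "nonsingular_of_dim n V x"
  obtains k p U where "k + n = CARD('N)" "\<And>i. i < k \<Longrightarrow> real_polynomial_function (p i)"
    "\<And>i y. i < k \<Longrightarrow> y \<in> V \<Longrightarrow> p i y = 0" "open U" "x \<in> U" "V \<inter> U = {y. \<forall>i<k. p i y = 0} \<inter> U"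
    "inj_on (\<lambda>i. grad (p i) x) {..<k}" "independent ((\<lambda>i. grad (p i) x) ` {..<k})"
proof -
  obtain k p g U where *: "k + n = CARD('N)" "\<forall>i<k. real_polynomial_function (p i) \<and> (\<forall>y\<in>V. p i y = 0)"
    "open U" "x \<in> U" "V \<inter> U = {y. \<forall>i<k. p i y = 0} \<inter> U" "\<forall>i<k. GDERIV (p i) x :> g i"
    "inj_on g {..<k}" "independent (g ` {..<k})"
    using assms unfolding nonsingular_of_dim_def by blast
  have g: "grad (p i) x = g i" if "i < k" for i using *(6) that by (intro grad_eqI) blast
  have "inj_on (\<lambda>i. grad (p i) x) {..<k}" using *(7) by (simp add: inj_on_def g)
  moreover have "(\<lambda>i. grad (p i) x) ` {..<k} = g ` {..<k}" using g by (intro image_cong) auto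
  ultimately show ?thesis using that[of k p U] * by simp
qed

text \<open>The tangent space as computed from equations;
  \<open>tangent_space_local_parametrization\<close> relates it to the tangent space defined by
  curves.\<close>

definition grad_kernel :: "nat \<Rightarrow> (nat \<Rightarrow> real ^ 'N \<Rightarrow> real) \<Rightarrow> real ^ 'N \<Rightarrow> (real ^ 'N) set" where
  "grad_kernel k p x = {v. \<forall>i<k. grad (p i) x \<bullet> v = 0}"

lemma grad_kernel:
  fixes p :: "nat \<Rightarrow> real ^ 'N \<Rightarrow> real"
  assumes "inj_on (\<lambda>i. grad (p i) x) {..<k}" "independent ((\<lambda>i. grad (p i) x) ` {..<k})"
  shows "subspace (grad_kernel k p x)" "dim (grad_kernel k p x) + k = CARD('N)"
proof -
  let ?g = "\<lambda>i. grad (p i) x"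
  let ?S = "span (?g ` {..<k})"
  show "subspace (grad_kernel k p x)"
    by (auto simp: grad_kernel_def subspace_def inner_add_right)
  have "grad_kernel k p x = {y \<in> UNIV. \<forall>x\<in>?S. orthogonal x y}"
  proof (intro set_eqI iffI)
    fix v assume v: "v \<in> grad_kernel k p x"
    have "orthogonal v w" if "w \<in> ?S" for w
      by (rule orthogonal_to_span[OF that]) (use v in \<open>auto simp: grad_kernel_def orthogonal_def inner_commute\<close>)
    then show "v \<in> {y \<in> UNIV. \<forall>x\<in>?S. orthogonal x y}" by (auto simp: orthogonal_commute)
  next
    fix v assume "v \<in> {y \<in> UNIV. \<forall>x\<in>?S. orthogonal x y}"
    then show "v \<in> grad_kernel k p x"
      by (auto simp: grad_kernel_def orthogonal_def span_base)
  qed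
  moreover have "dim ?S = k"
    using dim_span_eq_card_independent[OF assms(2)] card_image[OF assms(1)] by simp
  ultimately show "dim (grad_kernel k p x) + k = CARD('N)"
    using dim_subspace_orthogonal_to_vectors[of ?S UNIV] by simp
qed

text \<open>Differentiate \<open>p i\<close> along a curve in \<open>M\<close>, where it is
  constantly zero.\<close>

lemma tangent_in_grad_kernel:
  assumes p: "\<And>i. i < k \<Longrightarrow> real_polynomial_function (p i)" "\<And>i y. i < k \<Longrightarrow> y \<in> M \<Longrightarrow> p i y = 0"
  shows "tangent_space M x \<subseteq> grad_kernel k p x"
proof
  fix v assume "v \<in> tangent_space M x"
  then obtain \<gamma> e where \<gamma>: "0 < e" "\<gamma> ` {-e<..<e} \<subseteq> M" "\<gamma> 0 = x" "(\<gamma> has_vector_derivative v) (at 0)"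
    by (auto simp: tangent_space_def)
  have "grad (p i) x \<bullet> v = 0" if i: "i < k" for i
  proof -
    have "((p i \<circ> \<gamma>) has_derivative (\<lambda>h. grad (p i) x \<bullet> h) \<circ> (\<lambda>t. t *\<^sub>R v)) (at 0)"
      using \<gamma>(4) polynomial_has_derivative[OF p(1)[OF i], of x]
      by (intro diff_chain_at) (simp_all add: \<gamma>(3) has_vector_derivative_def)
    moreover have "((p i \<circ> \<gamma>) has_derivative (\<lambda>_. 0)) (at 0)"
    proof (rule has_derivative_transform_within_open[OF _ open_greaterThanLessThan[of "- e" e]])
      show "((\<lambda>_. 0 :: real) has_derivative (\<lambda>_. 0)) (at 0)" by simp
      show "0 = (p i \<circ> \<gamma>) t" if "t \<in> {-e<..<e}" for t
      proof -
        have "\<gamma> t \<in> M" using \<gamma>(2) that by blast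
        then show ?thesis using p(2)[OF i] by simp
      qed
    qed (use \<gamma> in auto)
    ultimately have "(\<lambda>h. grad (p i) x \<bullet> h) \<circ> (\<lambda>t. t *\<^sub>R v) = (\<lambda>_. 0)"
      by (rule has_derivative_unique)
    from fun_cong[OF this, of 1] show ?thesis by simp
  qed
  then show "v \<in> grad_kernel k p x" by (simp add: grad_kernel_def)
qed

text \<open>The chart maps a short line segment in the parameter domain to a curve with the
  prescribed velocity.\<close>

lemma range_subset_tangent:
  assumes lp: "local_parametrization M U \<phi> J" and u: "u \<in> U"
  shows "range ((*v) (J u)) \<subseteq> tangent_space M (\<phi> u)"
proof
  note L = local_parametrizationD[OF lp]
  fix v assume "v \<in> range ((*v) (J u))"
  then obtain h where v: "v = J u *v h" by auto
  let ?l = "\<lambda>t :: real. u + t *\<^sub>R h"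
  have "open (?l -` U)" by (intro open_vimage L(1) continuous_intros)
  moreover have "0 \<in> ?l -` U" using u by simp
  ultimately obtain e where e: "e > 0" "ball 0 e \<subseteq> ?l -` U" using openE by blast
  then have inU: "?l t \<in> U" if "t \<in> {-e<..<e}" for t
    using subsetD[OF e(2), of t] that by (simp add: dist_real_def abs_less_iff)
  let ?\<gamma> = "\<lambda>t. \<phi> (?l t)"
  have der: "(?\<gamma> has_vector_derivative J (?l t) *v h) (at t)" if "t \<in> {-e<..<e}" for t
  proof -
    have "(?l has_derivative (\<lambda>s. s *\<^sub>R h)) (at t)" by (auto intro!: derivative_eq_intros)
    from diff_chain_at[OF this L(5)[OF inU[OF that]]]
    show ?thesis by (simp add: has_vector_derivative_def comp_def matrix_vector_mult_scaleR)
  qed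
  have "continuous_on {-e<..<e} (\<lambda>t. J (?l t))"
    by (rule continuous_on_compose2[OF L(6)]) (use inU in \<open>auto intro!: continuous_intros\<close>)
  then have cont: "continuous_on {-e<..<e} (\<lambda>t. J (?l t) *v h)"
    unfolding matrix_vector_mult_def by (intro continuous_on_vec_lambda continuous_intros)
  have "?\<gamma> C1_differentiable_on {-e<..<e}"
    unfolding C1_differentiable_on_def
    by (intro exI[of _ "\<lambda>t. J (?l t) *v h"] conjI ballI der cont)
  moreover have "?\<gamma> ` {-e<..<e} \<subseteq> M" using inU L(3) by auto
  moreover have "(?\<gamma> has_vector_derivative v) (at 0)" using der[of 0] e(1) v by simp
  ultimately show "v \<in> tangent_space M (\<phi> u)"
    unfolding tangent_space_def using e(1) by (intro CollectI exI[of _ ?\<gamma>] exI[of _ e]) simp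
qed

text \<open>The tangent space lies between the range of the Jacobian and the kernel of the
  gradients, two subspaces of the same dimension. In particular it is a subspace, which the
  definition by curves does not show.\<close>

lemma tangent_space_local_parametrization:
  fixes M :: "(real ^ 'N) set" and J :: "real ^ 'n \<Rightarrow> real ^ 'n ^ 'N"
  assumes lp: "local_parametrization M U \<phi> J" and u: "u \<in> U"
    and p: "k + CARD('n) = CARD('N)" "\<And>i. i < k \<Longrightarrow> real_polynomial_function (p i)"
      "\<And>i y. i < k \<Longrightarrow> y \<in> M \<Longrightarrow> p i y = 0"
      "inj_on (\<lambda>i. grad (p i) (\<phi> u)) {..<k}" "independent ((\<lambda>i. grad (p i) (\<phi> u)) ` {..<k})"
  shows "tangent_space M (\<phi> u) = range ((*v) (J u))" "grad_kernel k p (\<phi> u) = range ((*v) (J u))"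
proof -
  note L = local_parametrizationD[OF lp]
  have 1: "range ((*v) (J u)) \<subseteq> tangent_space M (\<phi> u)" by (rule range_subset_tangent[OF lp u])
  have 2: "tangent_space M (\<phi> u) \<subseteq> grad_kernel k p (\<phi> u)" by (rule tangent_in_grad_kernel[OF p(2,3)])
  have "dim (range ((*v) (J u))) = CARD('n)"
    using dim_image_eq[of "(*v) (J u)" UNIV] L(8)[OF u] by simp
  moreover have "dim (grad_kernel k p (\<phi> u)) = CARD('n)" using grad_kernel(2)[OF p(4,5)] p(1) by simp
  moreover have "subspace (range ((*v) (J u)))" by (intro linear_subspace_image) auto
  ultimately have "range ((*v) (J u)) = grad_kernel k p (\<phi> u)"
    using 1 2 grad_kernel(1)[OF p(4,5)] by (intro subspace_dim_equal) auto
  then show "tangent_space M (\<phi> u) = range ((*v) (J u))" "grad_kernel k p (\<phi> u) = range ((*v) (J u))"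
    using 1 2 by auto
qed

lemma continuous_on_det [continuous_intros]:
  fixes A :: "'a::topological_space \<Rightarrow> real ^ 'n ^ 'n"
  assumes "continuous_on S A" shows "continuous_on S (\<lambda>x. det (A x))"
  unfolding det_def by (intro continuous_intros assms)

text \<open>By Cramer's rule.\<close>

lemma continuous_on_inv_linear:
  fixes f' :: "'a::topological_space \<Rightarrow> real ^ 'n \<Rightarrow> real ^ 'n"
  assumes lin: "\<And>x. x \<in> S \<Longrightarrow> linear (f' x)" and bij: "\<And>x. x \<in> S \<Longrightarrow> bij (f' x)"
    and cont: "\<And>h. continuous_on S (\<lambda>x. f' x h)"
  shows "continuous_on S (\<lambda>x. inv (f' x) b)"
proof -
  let ?A = "\<lambda>x. matrix (f' x)"
  let ?c = "\<lambda>x. (\<chi> k. det (\<chi> i j. if j = k then b $ i else ?A x $ i $ j) / det (?A x))"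
  have det0: "det (?A x) \<noteq> 0" if "x \<in> S" for x
    using det_nz_iff_inj[OF lin[OF that]] bij[OF that] by (simp add: bij_is_inj)
  have entry: "continuous_on S (\<lambda>x. ?A x $ i $ j)" for i j
    unfolding matrix_def by (simp, intro continuous_intros cont)
  have contA: "continuous_on S ?A"
    unfolding matrix_def by (intro continuous_on_vec_lambda continuous_intros cont)
  have "continuous_on S ?c"
  proof (intro continuous_on_vec_lambda continuous_on_divide continuous_on_det contA ballI)
    show "continuous_on S (\<lambda>x. if j = k then b $ i else ?A x $ i $ j)" for i j k
      by (cases "j = k") (auto intro: continuous_intros entry)
  qed (use det0 in auto)
  moreover have "?c x = inv (f' x) b" if "x \<in> S" for x
  proof -
    have "?A x *v inv (f' x) b = f' x (inv (f' x) b)"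
      using lin[OF that] by (simp add: matrix_works)
    also have "\<dots> = b" using bij[OF that] by (simp add: bij_is_surj surj_f_inv_f)
    finally have "inv (f' x) b = ?c x" using cramer[OF det0[OF that], of "inv (f' x) b" b] by simp
    then show ?thesis by simp
  qed
  ultimately show ?thesis by (rule continuous_on_eq)
qed

lemma independent_of_dual:
  fixes g :: "nat \<Rightarrow> 'a::euclidean_space"
  assumes h: "\<And>i. i < k \<Longrightarrow> \<exists>h. \<forall>j<k. g j \<bullet> h = (if i = j then 1 else 0)"
  shows "inj_on g {..<k}" "independent (g ` {..<k})"
proof -
  show "inj_on g {..<k}"
  proof (rule inj_onI)
    fix i j assume ij: "i \<in> {..<k}" "j \<in> {..<k}" "g i = g j"
    obtain h where h: "\<forall>l<k. g l \<bullet> h = (if i = l then 1 else 0)" using assms[of i] ij by auto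
    then have "(1::real) = (if i = j then 1 else 0)" using ij by (metis lessThan_iff)
    then show "i = j" by (simp split: if_splits)
  qed
  show "independent (g ` {..<k})"
  proof
    assume "dependent (g ` {..<k})"
    then obtain i where i: "i < k" "g i \<in> span (g ` {..<k} - {g i})" by (auto simp: dependent_def)
    obtain h where h: "\<And>l. l < k \<Longrightarrow> g l \<bullet> h = (if i = l then 1 else 0)" using assms[OF i(1)] by auto
    have "orthogonal h (g i)"
    proof (rule orthogonal_to_span[OF i(2)])
      fix w assume "w \<in> g ` {..<k} - {g i}"
      then obtain l where "l < k" "w = g l" "l \<noteq> i" by auto
      then show "orthogonal h w" using h[of l] by (simp add: orthogonal_def inner_commute)
    qed
    then show False using h[of i] i(1) by (simp add: orthogonal_def inner_commute)
  qed
qed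

lemma ex_orthonormal_matrix:
  fixes K :: "(real ^ 'N) set"
  assumes K: "subspace K" "dim K = CARD('n)"
  obtains E :: "real ^ 'n ^ 'N" where "transpose E ** E = mat 1" "range ((*v) E) = K"
    "\<And>v. v \<in> K \<Longrightarrow> E *v (transpose E *v v) = v"
proof -
  obtain B where B: "B \<subseteq> K" "pairwise orthogonal B" "\<And>x. x \<in> B \<Longrightarrow> norm x = 1"
    "independent B" "card B = CARD('n)" "span B = K"
    using orthonormal_basis_subspace[OF K(1)] K(2) by metis
  have finB: "finite B" using B(4) by (rule independent_imp_finite)
  then obtain e where e: "bij_betw e (UNIV :: 'n set) B"
    using finite_same_card_bij[of "UNIV :: 'n set" B] B(5) by auto
  have eB: "e j \<in> B" and einj: "e i = e j \<longleftrightarrow> i = j" for i j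
    using e by (auto simp: bij_betw_def inj_eq)
  have ee: "e i \<bullet> e j = (if i = j then 1 else 0)" for i j
    using B(2,3) eB[of i] eB[of j] einj by (auto simp: pairwise_def orthogonal_def norm_eq_1)
  define E :: "real ^ 'n ^ 'N" where "E = (\<chi> i j. e j $ i)"
  have Eh: "E *v h = (\<Sum>j\<in>UNIV. h $ j *\<^sub>R e j)" for h
    by (simp add: E_def vec_eq_iff matrix_vector_mult_def mult.commute)
  have Et: "transpose E *v v = (\<chi> j. v \<bullet> e j)" for v
    by (simp add: E_def vec_eq_iff matrix_vector_mult_def transpose_def inner_vec_def mult.commute)
  have EEt: "E *v (transpose E *v v) = v" if "v \<in> K" for v
  proof -
    have "E *v (transpose E *v v) = (\<Sum>b\<in>B. (v \<bullet> b) *\<^sub>R b)"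
      unfolding Eh Et using sum.reindex_bij_betw[OF e, of "\<lambda>b. (v \<bullet> b) *\<^sub>R b"] by simp
    also have "\<dots> = v" by (rule orthonormal_representation) (use B finB that in auto)
    finally show ?thesis .
  qed
  show ?thesis
  proof (rule that[of E])
    show "transpose E ** E = mat 1"
      by (simp add: E_def vec_eq_iff matrix_matrix_mult_def transpose_def mat_def ee[unfolded inner_vec_def, simplified])
    show "range ((*v) E) = K"
    proof
      show "range ((*v) E) \<subseteq> K"
      proof
        fix v assume "v \<in> range ((*v) E)"
        then obtain h where "v = E *v h" by auto
        then show "v \<in> K" unfolding Eh using B(1) eB K(1)
          by (auto intro!: subspace_sum subspace_scale)
      qed
      show "K \<subseteq> range ((*v) E)" using EEt by (metis rangeI subsetI)
    qed
  qed (rule EEt)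
qed

text \<open>The implicit function theorem, arranged to give coordinates directly. \<open>F\<close>
  combines the equations, as coefficients of the independent gradients \<open>g i\<close>, with the
  orthogonal projection to their common kernel. It is a local diffeomorphism at \<open>x\<close>
  under which \<open>M\<close> corresponds to the points of that kernel; \<open>E\<close>
  parametrizes the kernel, and the local inverse \<open>H\<close> carries it to
  \<open>M\<close>.\<close>

lemma local_parametrization_exists:
  fixes M :: "(real ^ 'N) set"
  assumes M: "algebraic_manifold CARD('n) M" and x: "x \<in> M"
  shows "\<exists>(W :: (real ^ 'n) set) \<phi> J. local_parametrization M W \<phi> J \<and> x \<in> \<phi> ` W"
proof -
  obtain V Ob where V: "open Ob" "M = nonsingular_points V \<inter> Ob" "M \<subseteq> V" "\<And>x. x \<in> M \<Longrightarrow> nonsingular_of_dim CARD('n) V x"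
    by (rule algebraic_manifold_varietyE[OF M]) (rule that; assumption)
  obtain k p U where p: "k + CARD('n) = CARD('N)" "\<And>i. i < k \<Longrightarrow> real_polynomial_function (p i)"
    "\<And>i y. i < k \<Longrightarrow> y \<in> V \<Longrightarrow> p i y = 0" "open U" "x \<in> U" "V \<inter> U = {y. \<forall>i<k. p i y = 0} \<inter> U"
    "inj_on (\<lambda>i. grad (p i) x) {..<k}" "independent ((\<lambda>i. grad (p i) x) ` {..<k})"
    by (rule nonsingular_of_dim_gradE[OF V(4)[OF x]]) (rule that; assumption)
  define g where "g i = grad (p i) x" for i
  let ?K = "grad_kernel k p x"
  have K: "subspace ?K" "dim ?K = CARD('n)" using grad_kernel[OF p(7,8)] p(1) by auto
  obtain E :: "real ^ 'n ^ 'N" where E: "transpose E ** E = mat 1" "range ((*v) E) = ?K"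
    "\<And>v. v \<in> ?K \<Longrightarrow> E *v (transpose E *v v) = v"
    using ex_orthonormal_matrix[OF K] by metis
  have EtE: "transpose E *v (E *v u) = u" for u using E(1) by (simp add: matrix_vector_mul_assoc del: transpose_matrix_vector)
  \<comment> \<open>The span of the gradients at \<open>x\<close> meets their common kernel only in
    0.\<close>
  have gsum0: "(\<Sum>i<k. c i *\<^sub>R g i) = 0" if "(\<Sum>i<k. c i *\<^sub>R g i) + E *v u = 0 \<or> (\<Sum>i<k. c i *\<^sub>R g i) \<in> ?K" for c u
  proof -
    let ?w = "\<Sum>i<k. c i *\<^sub>R g i"
    have "?w \<in> ?K"
    proof -
      have "?w = E *v (- u) \<or> ?w \<in> ?K"
        using that by (auto simp: eq_neg_iff_add_eq_0 linear_neg[OF matrix_vector_mul_linear])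
      then show ?thesis using E(2) by auto
    qed
    then have "g i \<bullet> ?w = 0" if "i < k" for i using that by (simp add: grad_kernel_def g_def)
    then have "?w \<bullet> ?w = 0" by (simp add: inner_sum_left)
    then show ?thesis by simp
  qed
  have gind: "c i = 0" if "(\<Sum>i<k. c i *\<^sub>R g i) = 0" "i < k" for c i
  proof -
    have inj: "inj_on g {..<k}" and ind: "independent (g ` {..<k})"
      using p(7,8) by (simp_all add: g_def[abs_def])
    have "(\<Sum>v\<in>g ` {..<k}. c (the_inv_into {..<k} g v) *\<^sub>R v) = 0"
      using that(1) by (simp add: sum.reindex[OF inj] the_inv_into_f_f[OF inj])
    then have "c (the_inv_into {..<k} g (g i)) = 0"
      using independentD[OF ind finite_imageI[OF finite_lessThan] subset_refl, of "\<lambda>v. c (the_inv_into {..<k} g v)" "g i"] that(2) by auto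
    then show ?thesis using the_inv_into_f_f[OF inj, of i] that(2) by simp
  qed
  define F where "F y = (\<Sum>i<k. p i y *\<^sub>R g i) + E *v (transpose E *v (y - x))" for y
  define F' where "F' y h = (\<Sum>i<k. (grad (p i) y \<bullet> h) *\<^sub>R g i) + E *v (transpose E *v h)" for y h
  have derF: "(F has_derivative F' y) (at y)" for y
  proof -
    have 1: "((\<lambda>y. E *v (transpose E *v (y - x))) has_derivative (\<lambda>h. E *v (transpose E *v h))) (at y)"
    proof -
      have "bounded_linear (\<lambda>h. E *v (transpose E *v h))"
        using bounded_linear_compose[OF matrix_vector_mul_bounded_linear[of E] matrix_vector_mul_bounded_linear[of "transpose E"]]
        by simp
      then have "((\<lambda>h. E *v (transpose E *v h)) has_derivative (\<lambda>h. E *v (transpose E *v h))) (at (y - x))"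
        by (rule bounded_linear_imp_has_derivative)
      moreover have "((\<lambda>y. y - x) has_derivative (\<lambda>h. h)) (at y)" by (auto intro!: derivative_eq_intros)
      ultimately show ?thesis using diff_chain_at by (fastforce simp: comp_def)
    qed
    have 2: "((\<lambda>y. \<Sum>i<k. p i y *\<^sub>R g i) has_derivative (\<lambda>h. \<Sum>i<k. (grad (p i) y \<bullet> h) *\<^sub>R g i)) (at y)"
      by (intro has_derivative_sum has_derivative_scaleR_left polynomial_has_derivative p(2)) simp
    show ?thesis unfolding F_def[abs_def] F'_def[abs_def] by (rule has_derivative_add[OF 2 1])
  qed
  have contF': "continuous_on S (\<lambda>y. F' y h)" for S h
    unfolding F'_def by (intro continuous_intros polynomial_grad(2) p(2)) simp
  have linF': "linear (F' y)" for y using derF[of y] by (rule has_derivative_linear)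
  have injF': "inj (F' x)"
    unfolding linear_injective_0[OF linF']
  proof (intro allI impI)
    fix h assume h: "F' x h = 0"
    have w0: "(\<Sum>i<k. (g i \<bullet> h) *\<^sub>R g i) = 0"
      by (rule gsum0[where u = "transpose E *v h"]) (use h in \<open>simp add: F'_def g_def\<close>)
    then have "h \<in> ?K" using gind[OF w0] by (auto simp: grad_kernel_def g_def)
    moreover have "E *v (transpose E *v h) = 0" using h w0 by (simp add: F'_def g_def)
    ultimately show "h = 0" using E(3) by simp
  qed
  have U0: "open (U \<inter> Ob)" "x \<in> U \<inter> Ob" using p(4,5) V(1,2) x by auto
  obtain U' Vt H where H: "open U'" "U' \<subseteq> U \<inter> Ob" "x \<in> U'" "open Vt" "F x \<in> Vt" "homeomorphism U' Vt F H"
    "\<And>y. y \<in> Vt \<Longrightarrow> (H has_derivative inv (F' (H y))) (at y)" "\<And>y. y \<in> Vt \<Longrightarrow> bij (F' (H y))"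
    using inverse_function_euclidean[OF U0 derF contF' injF'] by metis
  have HF: "\<And>z. z \<in> U' \<Longrightarrow> F z \<in> Vt \<and> H (F z) = z" and FH: "\<And>y. y \<in> Vt \<Longrightarrow> H y \<in> U' \<and> F (H y) = y"
    and contF: "continuous_on U' F" and contH: "continuous_on Vt H"
    using H(6) by (auto simp: homeomorphism_def)
  \<comment> \<open>Common zeros of the \<open>p i\<close> in \<open>U'\<close> are nonsingular of
    the same dimension: surjectivity of \<open>F' z\<close> provides vectors dual to the gradients
    at \<open>z\<close>, which are therefore independent.\<close>
  have inM: "z \<in> M" if z: "z \<in> U'" "\<And>i. i < k \<Longrightarrow> p i z = 0" for z
  proof -
    have zV: "z \<in> V" using p(6) z H(2) by blast
    have bij: "bij (F' z)" using H(8)[of "F z"] HF[OF z(1)] by simp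
    have dual: "\<exists>h. \<forall>j<k. grad (p j) z \<bullet> h = (if i = j then 1 else 0)" if i: "i < k" for i
    proof -
      obtain h where h: "F' z h = g i" using bij by (metis bij_is_surj surjD)
      define c where "c j = grad (p j) z \<bullet> h - (if i = j then 1 else 0)" for j
      have "(\<Sum>j<k. (if i = j then 1 else 0) *\<^sub>R g j) = (\<Sum>j<k. if i = j then g j else 0)"
        by (intro sum.cong) auto
      then have d: "(\<Sum>j<k. (if i = j then 1 else 0) *\<^sub>R g j) = g i" using i by simp
      have eq: "(\<Sum>j<k. c j *\<^sub>R g j) = (\<Sum>j<k. (grad (p j) z \<bullet> h) *\<^sub>R g j) - g i"
        by (simp only: c_def scaleR_diff_left sum_subtractf d)
      have "(\<Sum>j<k. c j *\<^sub>R g j) = 0"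
        by (rule gsum0[where u = "transpose E *v h"]) (use h in \<open>simp add: eq F'_def algebra_simps\<close>)
      then have "c j = 0" if "j < k" for j using gind that by blast
      then show ?thesis by (intro exI[of _ h]) (simp add: c_def)
    qed
    have "nonsingular_of_dim CARD('n) V z"
      unfolding nonsingular_of_dim_def
    proof (intro conjI zV, intro exI conjI)
      show "k + CARD('n) = CARD('N)" by (rule p(1))
      show "\<forall>i<k. real_polynomial_function (p i) \<and> (\<forall>y\<in>V. p i y = 0)" using p(2,3) by blast
      show "open U" by (rule p(4))
      show "z \<in> U" using z H(2) by blast
      show "V \<inter> U = {y. \<forall>i<k. p i y = 0} \<inter> U" by (rule p(6))
      show "\<forall>i<k. GDERIV (p i) z :> grad (p i) z" using polynomial_grad(1) p(2) by blast
      show "inj_on (\<lambda>i. grad (p i) z) {..<k}" by (rule independent_of_dual(1)) (rule dual)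
      show "independent ((\<lambda>i. grad (p i) z) ` {..<k})" by (rule independent_of_dual(2)) (rule dual)
    qed
    then show "z \<in> M" using V(2) z(1) H(2) by (auto simp: nonsingular_points_def)
  qed
  define W where "W = {u. E *v u \<in> Vt}"
  define \<phi> where "\<phi> u = H (E *v u)" for u
  define \<psi> where "\<psi> y = transpose E *v F y" for y
  define J where "J u = (\<chi> i j. inv (F' (\<phi> u)) (E *v axis j 1) $ i)" for u
  have contE: "continuous_on S ((*v) E)" for S by (intro linear_continuous_on matrix_vector_mul_bounded_linear)
  have contEt: "continuous_on S ((*v) (transpose E))" for S by (intro linear_continuous_on matrix_vector_mul_bounded_linear)
  have openW: "open W" unfolding W_def using open_vimage[OF H(4) contE] by (simp add: vimage_def)
  have \<phi>W: "\<phi> ` W = M \<inter> U'"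
  proof (intro equalityI subsetI)
    fix z assume "z \<in> \<phi> ` W"
    then obtain u where u: "E *v u \<in> Vt" "z = H (E *v u)" by (auto simp: W_def \<phi>_def)
    have zU: "z \<in> U'" and Fz: "F z = E *v u" using FH[OF u(1)] u(2) by auto
    \<comment> \<open>Since \<open>F z\<close> lies in the kernel, so does its component along the
      gradients, which is therefore zero together with all \<open>p i z\<close>.\<close>
    have "(\<Sum>i<k. p i z *\<^sub>R g i) = E *v (u - transpose E *v (z - x))"
      using Fz by (simp add: F_def matrix_vector_mult_diff_distrib algebra_simps del: transpose_matrix_vector)
    then have "(\<Sum>i<k. p i z *\<^sub>R g i) \<in> ?K" using E(2) by auto
    then have s0: "(\<Sum>i<k. p i z *\<^sub>R g i) = 0" by (intro gsum0) auto
    have "p i z = 0" if "i < k" for i using gind[OF s0 that] .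
    then show "z \<in> M \<inter> U'" using inM zU by blast
  next
    fix z assume z: "z \<in> M \<inter> U'"
    then have "p i z = 0" if "i < k" for i using p(3)[OF that] V(3) by blast
    then have "F z = E *v (transpose E *v (z - x))" by (simp add: F_def)
    then show "z \<in> \<phi> ` W" using HF[of z] z by (auto simp: W_def \<phi>_def image_iff intro!: exI[of _ "transpose E *v (z - x)"])
  qed
  have bijH: "bij (F' (\<phi> u))" and derH: "(H has_derivative inv (F' (\<phi> u))) (at (E *v u))" if "u \<in> W" for u
    using H(7,8) that by (auto simp: W_def \<phi>_def)
  have lininv: "linear (inv (F' (\<phi> u)))" if "u \<in> W" for u
    using derH[OF that] by (rule has_derivative_linear)
  have Jmv: "J u *v h = inv (F' (\<phi> u)) (E *v h)" if "u \<in> W" for u h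
  proof -
    have "linear (\<lambda>h. inv (F' (\<phi> u)) (E *v h))"
      using linear_compose[OF matrix_vector_mul_linear[of E] lininv[OF that]] by (simp add: comp_def)
    moreover have "J u = matrix (\<lambda>h. inv (F' (\<phi> u)) (E *v h))" by (simp add: J_def matrix_def)
    ultimately show ?thesis by (simp add: matrix_works)
  qed
  have cont\<phi>: "continuous_on W \<phi>"
    unfolding \<phi>_def by (rule continuous_on_compose2[OF contH contE]) (auto simp: W_def)
  have "local_parametrization M W \<phi> J"
    unfolding local_parametrization_def
  proof (intro conjI ballI)
    show "open W" by (rule openW)
    show "openin (top_of_set M) (\<phi> ` W)" unfolding \<phi>W using H(1) by (auto simp: openin_open)
    show "\<exists>\<psi>. homeomorphism W (\<phi> ` W) \<phi> \<psi>"
    proof (intro exI[of _ \<psi>] homeomorphismI cont\<phi>)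
      have "continuous_on (\<phi> ` W) F" using contF \<phi>W by (auto intro: continuous_on_subset)
      then show "continuous_on (\<phi> ` W) \<psi>"
        unfolding \<psi>_def by (rule continuous_on_compose2[OF contEt]) auto
      show *: "\<psi> (\<phi> u) = u" if "u \<in> W" for u
        using that FH EtE by (simp add: \<psi>_def \<phi>_def W_def del: transpose_matrix_vector)
      show "\<psi> ` (\<phi> ` W) \<subseteq> W" using * by auto
      show "\<phi> (\<psi> y) = y" if "y \<in> \<phi> ` W" for y using that * by auto
    qed auto
    fix u assume u: "u \<in> W"
    have "((H \<circ> (*v) E) has_derivative inv (F' (\<phi> u)) \<circ> (*v) E) (at u)"
      by (rule diff_chain_at[OF has_derivative_matrix_vector_mult derH[OF u]])
    moreover have "inv (F' (\<phi> u)) \<circ> (*v) E = (*v) (J u)"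
      by (simp add: fun_eq_iff Jmv[OF u])
    moreover have "H \<circ> (*v) E = \<phi>" by (simp add: fun_eq_iff \<phi>_def)
    ultimately show "(\<phi> has_derivative (*v) (J u)) (at u)" by simp
    have "inj (inv (F' (\<phi> u)))" using bijH[OF u] by (simp add: bij_imp_bij_inv bij_is_inj)
    moreover have "inj ((*v) E)" by (rule injI) (metis EtE)
    ultimately have "inj (\<lambda>h. inv (F' (\<phi> u)) (E *v h))" by (auto simp: inj_def)
    moreover have "(*v) (J u) = (\<lambda>h. inv (F' (\<phi> u)) (E *v h))" by (simp add: fun_eq_iff Jmv[OF u])
    ultimately show "inj ((*v) (J u))" by simp
  next
    have "continuous_on W (\<lambda>u. inv (F' (\<phi> u)) b)" for b
    proof (rule continuous_on_inv_linear)
      show "continuous_on W (\<lambda>u. F' (\<phi> u) h)" for h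
        by (rule continuous_on_compose2[OF contF'[of UNIV] cont\<phi>]) auto
    qed (use linF' bijH in auto)
    then show "continuous_on W J"
      unfolding J_def by (intro continuous_on_vec_lambda continuous_intros)
  qed
  moreover have "x \<in> \<phi> ` W" using \<phi>W x H(3) by blast
  ultimately show ?thesis by blast
qed

lemma countable_atlas:
  fixes M :: "(real ^ 'N) set"
  assumes M: "algebraic_manifold CARD('n) M"
  obtains U :: "nat \<Rightarrow> (real ^ 'n) set" and \<phi> J where
    "\<And>i. local_parametrization M (U i) (\<phi> i) (J i)" "(\<Union>i. \<phi> i ` U i) = M"
proof -
  let ?F = "{\<phi> ` U | (U :: (real ^ 'n) set) \<phi> J. local_parametrization M U \<phi> J}"
  have op: "openin (top_of_set M) S" if "S \<in> ?F" for S using that local_parametrizationD(2) by blast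
  obtain F where F: "F \<subseteq> ?F" "countable F" "\<Union>F = \<Union>?F" 
    by (rule Lindelof_openin[of ?F M], rule op, assumption) (rule that; assumption)
  have "\<Union>?F = M"
  proof
    show "\<Union>?F \<subseteq> M" by (rule Union_least) (rule openin_imp_subset[OF op])
    show "M \<subseteq> \<Union>?F"
    proof
      fix x assume "x \<in> M"
      from local_parametrization_exists[OF M this] obtain U :: "(real ^ 'n) set" and \<phi> J
        where lp: "local_parametrization M U \<phi> J" and x: "x \<in> \<phi> ` U" by (elim exE conjE)
      have "\<phi> ` U \<in> ?F" by (intro CollectI exI[of _ U] exI[of _ \<phi>] exI[of _ J] conjI refl lp)
      with x show "x \<in> \<Union>?F" by (rule UnionI[rotated])
    qed
  qed
  \<comment> \<open>The empty set, image of the empty chart, ensures that the family can be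
    enumerated by the natural numbers even when \<open>M\<close> is empty.\<close>
  define F0 where "F0 = insert {} F"
  have F0: "F0 \<noteq> {}" "countable F0" "\<Union>F0 = M" using F(2,3) \<open>\<Union>?F = M\<close> by (auto simp: F0_def)
  have "\<exists>(U :: (real ^ 'n) set) \<phi> J. local_parametrization M U \<phi> J \<and> \<phi> ` U = S" if "S \<in> F0" for S
  proof (cases "S = {}")
    case True
    then show ?thesis
      by (intro exI[of _ "{}"] exI[of _ "\<lambda>_. 0"] conjI local_parametrization_empty) simp
  next
    case False
    then have "S \<in> ?F" using that F(1) by (auto simp only: F0_def)
    then show ?thesis by (elim CollectE exE conjE) (intro exI conjI, assumption, simp)
  qed
  then have "\<forall>i. \<exists>(U :: (real ^ 'n) set) \<phi> J. local_parametrization M U \<phi> J \<and> \<phi> ` U = from_nat_into F0 i"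
    using from_nat_into[OF F0(1)] by blast
  from choice[OF this] obtain U :: "nat \<Rightarrow> (real ^ 'n) set" where
    "\<forall>i. \<exists>\<phi> J. local_parametrization M (U i) \<phi> J \<and> \<phi> ` U i = from_nat_into F0 i" by blast
  from choice[OF this] obtain \<phi> where
    "\<forall>i. \<exists>J. local_parametrization M (U i) (\<phi> i) J \<and> \<phi> i ` U i = from_nat_into F0 i" by blast
  from choice[OF this] obtain J where *: "\<And>i. local_parametrization M (U i) (\<phi> i) (J i)"
    "\<And>i. \<phi> i ` U i = from_nat_into F0 i" by blast
  have "(\<Union>i. \<phi> i ` U i) = M"
    using range_from_nat_into[OF F0(1,2)] F0(3) by (simp add: *(2))
  then show ?thesis using that *(1) by blast
qed

lemma measurable_completion_AE:
  assumes f: "f \<in> M \<rightarrow>\<^sub>M N" and eq: "AE x in M. f x = g x" and g: "g \<in> space M \<rightarrow> space N"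
  shows "g \<in> completion M \<rightarrow>\<^sub>M N"
proof (rule measurableI)
  show "g x \<in> space N" if "x \<in> space (completion M)" for x using g that by auto
  fix A assume A: "A \<in> sets N"
  show "g -` A \<inter> space (completion M) \<in> sets (completion M)"
  proof (rule completion.in_sets_AE)
    have "AE x in completion M. f x = g x" using eq by (rule AE_completion)
    then show "AE x in completion M. x \<in> f -` A \<inter> space M \<longleftrightarrow> x \<in> g -` A \<inter> space (completion M)"
      by eventually_elim auto
    show "f -` A \<inter> space M \<in> sets (completion M)" using measurable_sets[OF f A] by auto
  qed auto
qed

text \<open>Continuous images of Borel sets need not be Borel. A relatively closed subset of an open
  set is a countable union of compact sets, however, and so is its image.\<close>

lemma borel_continuous_image_relatively_closed:
  fixes f :: "'a::euclidean_space \<Rightarrow> 'b::euclidean_space"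
  assumes S: "open S" and f: "continuous_on S f" and C: "C \<subseteq> S" "closedin (top_of_set S) C"
  shows "f ` C \<in> sets borel"
proof -
  obtain K where K: "\<And>n :: nat. compact (K n)" "\<And>n. K n \<subseteq> S" "\<Union>(range K) = S"
    apply (rule open_Union_compact_subsets[OF S])
    subgoal for C by (rule that[of C]) auto
    done
  obtain T where T: "closed T" "C = S \<inter> T" using C(2) by (auto simp: closedin_closed)
  have "C = (\<Union>n. K n \<inter> T)" using K(3) T(2) by auto
  then have "f ` C = (\<Union>n. f ` (K n \<inter> T))" by auto
  moreover have "compact (f ` (K n \<inter> T))" for n
    using K(1,2)[of n] T(1) f by (intro compact_continuous_image) (auto intro: continuous_on_subset)
  then have "f ` (K n \<inter> T) \<in> sets borel" for n by (intro borel_closed compact_imp_closed)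
  ultimately show ?thesis by auto
qed

lemma borel_homeomorphism_image:
  fixes f :: "'a::topological_space \<Rightarrow> 'b::topological_space"
  assumes h: "homeomorphism W V f g" and op: "open W" "open V" and D: "D \<in> sets borel" "D \<subseteq> W"
  shows "f ` D \<in> sets borel"
proof -
  have "f ` D = g -` D \<inter> V"
  proof (intro equalityI subsetI)
    fix y assume "y \<in> f ` D"
    then obtain x where x: "x \<in> D" "y = f x" by auto
    then have "x \<in> W" using D(2) by blast
    then have "g y = x" "y \<in> V" using h x(2) by (auto simp: homeomorphism_def)
    then show "y \<in> g -` D \<inter> V" using x(1) by simp
  next
    fix y assume y: "y \<in> g -` D \<inter> V"
    then have "f (g y) = y" using h by (simp add: homeomorphism_def)
    then show "y \<in> f ` D" using y by (metis IntD1 imageI vimageD)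
  qed
  moreover have "g -` D \<inter> V \<in> sets borel"
    using borel_measurable_continuous_on_restrict[of V g] h op(2) D(1)
    by (auto simp: homeomorphism_def in_borel_measurable_borel dest!: measurable_sets[of _ _ _ D]
        simp: space_restrict_space sets_restrict_space_iff)
  ultimately show ?thesis by simp
qed

lemma borel_Pair_section:
  fixes S :: "('a::topological_space \<times> 'b::topological_space) set"
  assumes "S \<in> sets borel" shows "Pair a -` S \<in> sets borel"
proof -
  have "Pair a \<in> borel_measurable borel" by (intro borel_measurable_continuous_onI continuous_intros)
  from measurable_sets[OF this assms] show ?thesis by simp
qed

section \<open>Slices through a chart\<close>

lemma bounded_bilinear_matrix_vector_mult:
  "bounded_bilinear ((*v) :: real ^ 'N ^ 'n \<Rightarrow> real ^ 'N \<Rightarrow> real ^ 'n)"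
proof -
  have "bilinear ((*v) :: real ^ 'N ^ 'n \<Rightarrow> real ^ 'N \<Rightarrow> real ^ 'n)"
    unfolding bilinear_def
    by (auto intro!: linearI simp: matrix_vector_mult_add_rdistrib matrix_vector_right_distrib
        scaleR_matrix_vector_assoc matrix_vector_mult_scaleR)
  then show ?thesis by (rule bilinear_conv_bounded_bilinear[THEN iffD1])
qed

lemmas continuous_on_matrix_vector_mult [continuous_intros] =
  bounded_bilinear.continuous_on[OF bounded_bilinear_matrix_vector_mult]

lemma continuous_on_matrix_matrix_mult [continuous_intros]:
  fixes A :: "'a::topological_space \<Rightarrow> real ^ 'm ^ 'n" and B :: "'a \<Rightarrow> real ^ 'k ^ 'm"
  assumes "continuous_on S A" "continuous_on S B"
  shows "continuous_on S (\<lambda>x. A x ** B x)"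
  unfolding matrix_matrix_mult_def by (intro continuous_on_vec_lambda continuous_intros assms)

text \<open>The point \<open>\<phi> u\<close> lies on the subspace given by \<open>(A, b)\<close>
  exactly when \<open>slice_map \<phi>\<close> sends \<open>(A, u)\<close> to \<open>(A, b)\<close>.
  Counting points thus becomes counting preimages of a map between spaces of equal
  dimension.\<close>

definition slice_map :: "(real ^ 'n \<Rightarrow> real ^ 'N) \<Rightarrow> (real ^ 'N ^ 'n) \<times> (real ^ 'n) \<Rightarrow> (real ^ 'N ^ 'n) \<times> (real ^ 'n)" where
  "slice_map \<phi> p = (fst p, fst p *v \<phi> (snd p))"

text \<open>\<open>A ** J u\<close> is the restriction of \<open>A\<close> to the tangent space, in
  chart coordinates; it is singular where the subspace fails to be transversal.\<close>

definition slice_critical :: "(real ^ 'n) set \<Rightarrow> (real ^ 'n \<Rightarrow> real ^ 'n ^ 'N) \<Rightarrow> ((real ^ 'N ^ 'n) \<times> (real ^ 'n)) set" where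
  "slice_critical U J = {p. snd p \<in> U \<and> det (fst p ** J (snd p)) = 0}"

text \<open>The derivative is block triangular, with the identity in the matrix direction and the
  invertible \<open>A ** J u\<close> in the \<open>u\<close> direction.\<close>

lemma slice_local_homeomorphism:
  fixes \<phi> :: "real ^ 'n \<Rightarrow> real ^ 'N"
  assumes lp: "local_parametrization M U \<phi> J" and p0: "snd p0 \<in> U" "det (fst p0 ** J (snd p0)) \<noteq> 0"
  obtains W V g where "open W" "p0 \<in> W" "open V" "homeomorphism W V (slice_map \<phi>) g"
    "W \<subseteq> {p. snd p \<in> U \<and> det (fst p ** J (snd p)) \<noteq> 0}"
proof -
  note L = local_parametrizationD[OF lp]
  let ?S = "UNIV \<times> U :: ((real ^ 'N ^ 'n) \<times> (real ^ 'n)) set"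
  have openS: "open ?S" using L(1) by (intro open_Times) auto
  have cJ: "continuous_on ?S (\<lambda>p. J (snd p))"
    by (rule continuous_on_compose2[OF L(6)]) (auto intro!: continuous_intros)
  have c\<phi>: "continuous_on ?S (\<lambda>p. \<phi> (snd p))"
    by (rule continuous_on_compose2[OF L(7)]) (auto intro!: continuous_intros)
  have cdet: "continuous_on ?S (\<lambda>p. det (fst p ** J (snd p)))"
    by (intro continuous_on_det continuous_on_matrix_matrix_mult cJ continuous_intros)
  let ?R = "{p. snd p \<in> U \<and> det (fst p ** J (snd p)) \<noteq> 0}"
  have "?R = ?S \<inter> (\<lambda>p. det (fst p ** J (snd p))) -` (- {0})" by auto
  then have openR: "open ?R"
    using continuous_open_preimage[OF cdet openS, of "- {0}"] by auto
  define f' where "f' p h = (fst h, fst p *v (J (snd p) *v snd h) + fst h *v \<phi> (snd p))"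
    for p h :: "(real ^ 'N ^ 'n) \<times> (real ^ 'n)"
  have der: "(slice_map \<phi> has_derivative f' p) (at p)" if "p \<in> ?R" for p
  proof -
    have 1: "((\<lambda>p. \<phi> (snd p)) has_derivative (\<lambda>h. J (snd p) *v snd h)) (at p)"
    proof -
      have "(snd has_derivative snd) (at p)" by (auto intro!: derivative_eq_intros)
      then show ?thesis using diff_chain_at[of snd snd p \<phi>] L(5)[of "snd p"] that by (auto simp: comp_def)
    qed
    have 2: "(fst has_derivative fst) (at p)" by (auto intro!: derivative_eq_intros)
    have "((\<lambda>p. fst p *v \<phi> (snd p)) has_derivative (\<lambda>h. fst p *v (J (snd p) *v snd h) + fst h *v \<phi> (snd p))) (at p)"
      by (rule bounded_bilinear.FDERIV[OF bounded_bilinear_matrix_vector_mult 2 1])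
    from has_derivative_Pair[OF 2 this] show ?thesis
      by (simp add: slice_map_def[abs_def] f'_def[abs_def])
  qed
  have RS: "?R \<subseteq> ?S" by auto
  have cont: "continuous_on ?R (\<lambda>p. f' p h)" for h
    unfolding f'_def
    by (intro continuous_intros continuous_on_subset[OF cJ RS] continuous_on_subset[OF c\<phi> RS])
  have lin: "linear (f' p0)"
    using der[of p0] p0 has_derivative_linear by auto
  have inj: "inj (f' p0)"
    unfolding linear_injective_0[OF lin]
  proof (intro allI impI)
    fix h assume h: "f' p0 h = 0"
    then have 0: "fst h = 0" by (simp add: f'_def zero_prod_def)
    then have "(fst p0 ** J (snd p0)) *v snd h = 0"
      using h by (simp add: f'_def zero_prod_def matrix_vector_mul_assoc)
    moreover have "invertible (fst p0 ** J (snd p0))" using p0(2) by (simp add: invertible_det_nz)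
    ultimately have "snd h = 0"
      unfolding invertible_left_inverse matrix_left_invertible_ker by blast
    with 0 show "h = 0" by (simp add: prod_eq_iff)
  qed
  have p0R: "p0 \<in> ?R" using p0 by simp
  obtain W V g where W: "open W" "W \<subseteq> ?R" "p0 \<in> W" "open V" "homeomorphism W V (slice_map \<phi>) g"
    by (rule inverse_function_euclidean[OF openR p0R der cont inj], assumption) (rule that; assumption)
  then show ?thesis using that by blast
qed

text \<open>Sard's theorem for each fixed \<open>A\<close>: the section of the image consists of the critical values of \<open>u \<mapsto> A *v \<phi> u\<close>.\<close>

lemma slice_critical_null:
  fixes \<phi> :: "real ^ 'n \<Rightarrow> real ^ 'N"
  assumes lp: "local_parametrization M U \<phi> J"
  shows "slice_map \<phi> ` slice_critical U J \<in> null_sets lborel"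
proof -
  note L = local_parametrizationD[OF lp]
  let ?S = "UNIV \<times> U :: ((real ^ 'N ^ 'n) \<times> (real ^ 'n)) set"
  let ?N = "slice_map \<phi> ` slice_critical U J"
  have openS: "open ?S" using L(1) by (intro open_Times) auto
  have cJ: "continuous_on ?S (\<lambda>p. J (snd p))"
    by (rule continuous_on_compose2[OF L(6)]) (auto intro!: continuous_intros)
  have c\<phi>: "continuous_on ?S (\<lambda>p. \<phi> (snd p))"
    by (rule continuous_on_compose2[OF L(7)]) (auto intro!: continuous_intros)
  have cdet: "continuous_on ?S (\<lambda>p. det (fst p ** J (snd p)))"
    by (intro continuous_on_det continuous_on_matrix_matrix_mult cJ continuous_intros)
  \<comment> \<open>The critical set is relatively closed, so its image is Borel; this permits
    integration over the sections with fixed \<open>A\<close>.\<close>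
  have N: "?N \<in> sets borel"
  proof (rule borel_continuous_image_relatively_closed[OF openS])
    show "continuous_on ?S (slice_map \<phi>)" unfolding slice_map_def by (intro continuous_intros c\<phi>)
    show "slice_critical U J \<subseteq> ?S" by (auto simp: slice_critical_def)
    have "slice_critical U J = ?S \<inter> (\<lambda>p. det (fst p ** J (snd p))) -` {0}" by (auto simp: slice_critical_def)
    then show "closedin (top_of_set ?S) (slice_critical U J)"
      using continuous_closedin_preimage[OF cdet, of "{0}"] by simp
  qed
  have "emeasure lborel ?N = emeasure (lborel \<Otimes>\<^sub>M lborel) ?N" by (simp add: lborel_prod)
  also have "\<dots> = (\<integral>\<^sup>+A. emeasure lborel (Pair A -` ?N) \<partial>lborel)"
    using N by (intro sigma_finite_measure.emeasure_pair_measure_alt sigma_finite_lborel) (simp only: lborel_prod sets_lborel)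
  also have "\<dots> = (\<integral>\<^sup>+(A :: real ^ 'N ^ 'n). 0 \<partial>lborel)"
  proof (rule nn_integral_cong)
    fix A :: "real ^ 'N ^ 'n"
    let ?C = "{u \<in> U. det (A ** J u) = 0}"
    have sec: "Pair A -` ?N = (\<lambda>u. A *v \<phi> u) ` ?C"
      by (auto simp: slice_critical_def slice_map_def image_iff)
    have "negligible ((\<lambda>u. A *v \<phi> u) ` ?C)"
    proof (rule negligible_critical_image)
      fix u assume u: "u \<in> ?C"
      have "((\<lambda>u. A *v \<phi> u) has_derivative (\<lambda>h. A *v (J u *v h))) (at u)"
        using diff_chain_at[OF L(5)[of u] has_derivative_matrix_vector_mult[of A]] u by (simp add: comp_def)
      then show "((\<lambda>u. A *v \<phi> u) has_derivative (\<lambda>h. A *v (J u *v h))) (at u within ?C)"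
        by (rule has_derivative_at_withinI)
      show "det (matrix (\<lambda>h. A *v (J u *v h))) = 0" using u by (simp add: matrix_vector_mul_assoc)
    qed
    moreover have "Pair A -` ?N \<in> sets borel"
      by (rule borel_Pair_section[OF N])
    ultimately show "emeasure lborel (Pair A -` ?N) = 0"
      by (simp add: sec negligible_iff_null_sets null_sets_completion_iff null_setsD1)
  qed
  finally show ?thesis using N by (auto simp: null_sets_def)
qed

text \<open>The counting measure rather than \<open>card\<close>, so that infinite sets count as
  infinity and the count is countably additive.\<close>

definition slice_count :: "'a set \<Rightarrow> ennreal" where
  "slice_count S = emeasure (count_space UNIV) S"

text \<open>The density, in the chart, of the expected number of points;
  \<open>slice_density_eq_alpha\<close> evaluates it as \<open>alpha\<close> times the volume
  density.\<close>

definition slice_density :: "(real ^ 'n \<Rightarrow> real ^ 'N) \<Rightarrow> (real ^ 'n \<Rightarrow> real ^ 'n ^ 'N) \<Rightarrow> real ^ 'n \<Rightarrow> ennreal" where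
  "slice_density \<phi> J u = (\<integral>\<^sup>+A. ennreal (gauss_dens (A *v \<phi> u)) * ennreal \<bar>det (A ** J u)\<bar> \<partial>(gauss :: (real ^ 'N ^ 'n) measure))"

text \<open>By Lindelof's theorem the regular points are covered by countably many open sets that
  \<open>slice_map \<phi>\<close> maps homeomorphically onto open sets. Making the cover disjoint
  preserves injectivity and Borel images.\<close>

lemma slice_pieces:
  fixes \<phi> :: "real ^ 'n \<Rightarrow> real ^ 'N"
  assumes lp: "local_parametrization M U \<phi> J"
  obtains D :: "nat \<Rightarrow> ((real ^ 'N ^ 'n) \<times> (real ^ 'n)) set" where
    "\<And>i. D i \<in> sets borel" "disjoint_family D"
    "(\<Union>i. D i) = {p. snd p \<in> U \<and> det (fst p ** J (snd p)) \<noteq> 0}"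
    "\<And>i. inj_on (slice_map \<phi>) (D i)"
    "\<And>i C. C \<in> sets borel \<Longrightarrow> slice_map \<phi> ` (D i \<inter> C) \<in> sets borel"
proof -
  let ?R = "{p :: (real ^ 'N ^ 'n) \<times> (real ^ 'n). snd p \<in> U \<and> det (fst p ** J (snd p)) \<noteq> 0}"
  let ?F = "{W. open W \<and> W \<subseteq> ?R \<and> (\<exists>V g. open V \<and> homeomorphism W V (slice_map \<phi>) g)}"
  obtain F where F: "F \<subseteq> ?F" "countable F" "\<Union>F = \<Union>?F"
    by (rule Lindelof[of ?F], elim CollectE conjE, assumption) (rule that; assumption)
  have UF: "\<Union>F = ?R"
  proof
    show "\<Union>F \<subseteq> ?R" using F(1) by blast
    show "?R \<subseteq> \<Union>F"
    proof
      fix p assume p: "p \<in> ?R"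
      then have p': "snd p \<in> U" "det (fst p ** J (snd p)) \<noteq> 0" by auto
      obtain W V g where W: "open W" "p \<in> W" "open V" "homeomorphism W V (slice_map \<phi>) g" "W \<subseteq> ?R"
        by (rule slice_local_homeomorphism[OF lp p']) (rule that; assumption)
      then have "W \<in> ?F" by blast
      then show "p \<in> \<Union>F" unfolding F(3) using W(2) by blast
    qed
  qed
  define F0 where "F0 = insert {} F"
  have empty: "{} \<in> ?F" by (auto simp: homeomorphism_def intro!: exI[of _ "{}"])
  have F0: "F0 \<noteq> {}" "countable F0" "\<Union>F0 = ?R" "F0 \<subseteq> ?F"
    using F(1,2) UF empty by (auto simp: F0_def)
  define W where "W i = from_nat_into F0 i" for i
  have W: "W i \<in> ?F" for i using from_nat_into[OF F0(1), of i] F0(4) by (auto simp: W_def)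
  have UW: "(\<Union>i. W i) = ?R"
    using range_from_nat_into[OF F0(1,2)] F0(3) by (simp add: W_def)
  let ?D = "disjointed W"
  have DW: "?D i \<subseteq> W i" for i by (rule disjointed_subset)
  have Wb: "W i \<in> sets borel" for i using W by auto
  have Db: "?D i \<in> sets borel" for i
  proof -
    have "range W \<subseteq> sets borel" using Wb by auto
    from sets.range_disjointed_sets[OF this] show ?thesis by auto
  qed
  show ?thesis
  proof (rule that[of ?D])
    show "disjoint_family ?D" by (rule disjoint_family_disjointed)
    show "(\<Union>i. ?D i) = ?R" using UN_disjointed_eq[of W] UW by simp
    fix i
    obtain V g where Vg: "open V" "homeomorphism (W i) V (slice_map \<phi>) g" "open (W i)" using W[of i] by auto
    show "inj_on (slice_map \<phi>) (?D i)"
      by (rule inj_on_inverseI[where g = g]) (use Vg(2) DW[of i] in \<open>auto simp: homeomorphism_def\<close>)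
    show "slice_map \<phi> ` (?D i \<inter> C) \<in> sets borel" if "C \<in> sets borel" for C
      by (rule borel_homeomorphism_image[OF Vg(2,3,1)]) (use Db that DW[of i] in auto)
  qed (rule Db)
qed

lemma borel_measurable_slice_kernel:
  fixes \<phi> :: "real ^ 'n \<Rightarrow> real ^ 'N"
  assumes lp: "local_parametrization M U \<phi> J"
  shows "(\<lambda>p. ennreal (gauss_dens (fst p *v \<phi> (snd p))) * ennreal \<bar>det (fst p ** J (snd p))\<bar> * indicator (UNIV \<times> U) p)
    \<in> borel_measurable (borel :: ((real ^ 'N ^ 'n) \<times> (real ^ 'n)) measure)"
proof -
  note L = local_parametrizationD[OF lp]
  let ?S = "UNIV \<times> U :: ((real ^ 'N ^ 'n) \<times> (real ^ 'n)) set"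
  have openS: "open ?S" using L(1) by (intro open_Times) auto
  have cJ: "continuous_on ?S (\<lambda>p. J (snd p))"
    by (rule continuous_on_compose2[OF L(6)]) (auto intro!: continuous_intros)
  have c\<phi>: "continuous_on ?S (\<lambda>p. \<phi> (snd p))"
    by (rule continuous_on_compose2[OF L(7)]) (auto intro!: continuous_intros)
  have cdet: "continuous_on ?S (\<lambda>p. det (fst p ** J (snd p)))"
    by (intro continuous_on_det continuous_on_matrix_matrix_mult cJ continuous_intros)
  have cd: "continuous_on S (gauss_dens :: real ^ 'n \<Rightarrow> real)" for S
    unfolding gauss_dens_def[abs_def] by (intro continuous_intros) auto
  have "continuous_on ?S (\<lambda>p. gauss_dens (fst p *v \<phi> (snd p)) * \<bar>det (fst p ** J (snd p))\<bar>)"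
    by (intro continuous_intros cdet continuous_on_compose2[OF cd[of UNIV]] c\<phi>) auto
  then have "(\<lambda>p. indicator ?S p *\<^sub>R (gauss_dens (fst p *v \<phi> (snd p)) * \<bar>det (fst p ** J (snd p))\<bar>)) \<in> borel_measurable borel"
    using openS by (intro borel_measurable_continuous_on_indicator) auto
  then have m: "(\<lambda>p. ennreal (indicator ?S p *\<^sub>R (gauss_dens (fst p *v \<phi> (snd p)) * \<bar>det (fst p ** J (snd p))\<bar>))) \<in> borel_measurable borel"
    by measurable
  have eq: "(\<lambda>p. ennreal (indicator ?S p *\<^sub>R (gauss_dens (fst p *v \<phi> (snd p)) * \<bar>det (fst p ** J (snd p))\<bar>)))
      = (\<lambda>p. ennreal (gauss_dens (fst p *v \<phi> (snd p))) * ennreal \<bar>det (fst p ** J (snd p))\<bar> * indicator ?S p)"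
    by (auto simp: fun_eq_iff indicator_def ennreal_mult)
  show ?thesis using m unfolding eq .
qed

lemma borel_measurable_slice_density:
  fixes \<phi> :: "real ^ 'n \<Rightarrow> real ^ 'N"
  assumes lp: "local_parametrization M U \<phi> J"
  shows "(\<lambda>u. slice_density \<phi> J u * indicator U u) \<in> borel_measurable borel"
proof -
  interpret g: sigma_finite_measure "gauss :: (real ^ 'N ^ 'n) measure"
    by (rule prob_space_imp_sigma_finite[OF prob_space_gauss])
  let ?k = "\<lambda>p. ennreal (gauss_dens (fst p *v \<phi> (snd p))) * ennreal \<bar>det (fst p ** J (snd p))\<bar> * indicator (UNIV \<times> U) p"
  have sw: "(\<lambda>(u, A). (A, u)) \<in> borel_measurable (borel :: ((real ^ 'n) \<times> (real ^ 'N ^ 'n)) measure)"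
    by (intro borel_measurable_continuous_onI) (auto simp: split_beta intro!: continuous_intros)
  have "(\<lambda>q. ?k (case q of (u, A) \<Rightarrow> (A, u))) \<in> borel_measurable (borel :: ((real ^ 'n) \<times> (real ^ 'N ^ 'n)) measure)"
    by (rule measurable_compose[OF sw borel_measurable_slice_kernel[OF lp]])
  moreover have "sets ((borel :: (real ^ 'n) measure) \<Otimes>\<^sub>M (gauss :: (real ^ 'N ^ 'n) measure)) = sets borel"
    by (simp add: borel_prod[symmetric] cong: sets_pair_measure_cong)
  ultimately have "(\<lambda>q. ?k (case q of (u, A) \<Rightarrow> (A, u))) \<in> borel_measurable ((borel :: (real ^ 'n) measure) \<Otimes>\<^sub>M (gauss :: (real ^ 'N ^ 'n) measure))"
    by (simp cong: measurable_cong_sets)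
  from g.borel_measurable_nn_integral_fst[OF this]
  have "(\<lambda>u. \<integral>\<^sup>+A. ?k (A, u) \<partial>gauss) \<in> borel_measurable borel" by simp
  moreover have "(\<lambda>u. \<integral>\<^sup>+A. ?k (A, u) \<partial>gauss) = (\<lambda>u. slice_density \<phi> J u * indicator U u)"
    by (auto simp: fun_eq_iff slice_density_def indicator_def)
  ultimately show ?thesis by simp
qed

text \<open>Each piece contributes at most one point to a slice, so the number of regular points is
  the sum of the indicators of the images of the pieces. That sum is the Borel function
  \<open>c\<close>; off the critical values it is the full count. Its expectation is computed piece
  by piece for fixed \<open>A\<close>, summed, and exchanged with the integral over
  \<open>A\<close>.\<close>

lemma slice_count_chart:
  fixes \<phi> :: "real ^ 'n \<Rightarrow> real ^ 'N"
  assumes lp: "local_parametrization M U \<phi> J" and B: "B \<in> sets borel"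
  shows "\<exists>c\<in>borel_measurable borel.
     (\<forall>\<omega>. \<omega> \<notin> slice_map \<phi> ` slice_critical U J \<longrightarrow> slice_count {u\<in>U. u \<in> B \<and> fst \<omega> *v \<phi> u = snd \<omega>} = c \<omega>) \<and>
     (\<integral>\<^sup>+\<omega>. c \<omega> \<partial>gauss) = (\<integral>\<^sup>+u. slice_density \<phi> J u * indicator (U \<inter> B) u \<partial>lborel)"
proof -
  note L = local_parametrizationD[OF lp]
  let ?S = "UNIV \<times> U :: ((real ^ 'N ^ 'n) \<times> (real ^ 'n)) set"
  let ?R = "{p :: (real ^ 'N ^ 'n) \<times> (real ^ 'n). snd p \<in> U \<and> det (fst p ** J (snd p)) \<noteq> 0}"
  obtain D :: "nat \<Rightarrow> ((real ^ 'N ^ 'n) \<times> (real ^ 'n)) set" where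
    D: "\<And>i. D i \<in> sets borel" "disjoint_family D" "(\<Union>i. D i) = ?R"
    "\<And>i. inj_on (slice_map \<phi>) (D i)"
    "\<And>i C. C \<in> sets borel \<Longrightarrow> slice_map \<phi> ` (D i \<inter> C) \<in> sets borel"
    by (rule slice_pieces[OF lp]) (rule that; assumption)
  have DR: "u \<in> U" "det (A ** J u) \<noteq> 0" if "(A, u) \<in> D i" for A u i
  proof -
    have "(A, u) \<in> (\<Union>i. D i)" using that by blast
    then show "u \<in> U" "det (A ** J u) \<noteq> 0" unfolding D(3) by auto
  qed
  let ?C = "UNIV \<times> B :: ((real ^ 'N ^ 'n) \<times> (real ^ 'n)) set"
  have Cb: "?C \<in> sets borel"
    using B by (subst borel_prod[symmetric]) (intro pair_measureI, auto)
  let ?P = "\<lambda>i. slice_map \<phi> ` (D i \<inter> ?C)"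
  have Pb[measurable]: "?P i \<in> sets borel" for i by (rule D(5)[OF Cb])
  define c :: "(real ^ 'N ^ 'n) \<times> (real ^ 'n) \<Rightarrow> ennreal" where "c \<omega> = (\<Sum>i. indicator (?P i) \<omega>)" for \<omega>
  have c[measurable]: "c \<in> borel_measurable borel" unfolding c_def by measurable
  have count: "slice_count {u\<in>U. u \<in> B \<and> fst \<omega> *v \<phi> u = snd \<omega>} = c \<omega>"
    if \<omega>: "\<omega> \<notin> slice_map \<phi> ` slice_critical U J" for \<omega>
  proof -
    let ?Q = "\<lambda>i. {u\<in>U. u \<in> B \<and> fst \<omega> *v \<phi> u = snd \<omega> \<and> (fst \<omega>, u) \<in> D i}"
    have reg: "det (fst \<omega> ** J u) \<noteq> 0" if "u \<in> U" "fst \<omega> *v \<phi> u = snd \<omega>" for u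
    proof
      assume "det (fst \<omega> ** J u) = 0"
      then have "\<omega> = slice_map \<phi> (fst \<omega>, u)" "(fst \<omega>, u) \<in> slice_critical U J"
        using that by (auto simp: slice_map_def slice_critical_def prod_eq_iff)
      then show False using \<omega> by blast
    qed
    have "{u\<in>U. u \<in> B \<and> fst \<omega> *v \<phi> u = snd \<omega>} = (\<Union>i. ?Q i)"
    proof (intro equalityI subsetI)
      fix u assume u: "u \<in> {u\<in>U. u \<in> B \<and> fst \<omega> *v \<phi> u = snd \<omega>}"
      then have "(fst \<omega>, u) \<in> ?R" using reg by auto
      then obtain i where "(fst \<omega>, u) \<in> D i" using D(3) by blast
      then show "u \<in> (\<Union>i. ?Q i)" using u by auto
    qed auto
    moreover have "disjoint_family ?Q" using D(2) by (fastforce simp: disjoint_family_on_def)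
    ultimately have "slice_count {u\<in>U. u \<in> B \<and> fst \<omega> *v \<phi> u = snd \<omega>} = (\<Sum>i. emeasure (count_space UNIV) (?Q i))"
      unfolding slice_count_def by (simp add: suminf_emeasure)
    also have "(\<lambda>i. emeasure (count_space UNIV) (?Q i)) = (\<lambda>i. indicator (?P i) \<omega>)"
    proof
      fix i
      have uniq: "u = v" if "u \<in> ?Q i" "v \<in> ?Q i" for u v
      proof -
        have "slice_map \<phi> (fst \<omega>, u) = slice_map \<phi> (fst \<omega>, v)" using that by (simp add: slice_map_def)
        then have "(fst \<omega>, u) = (fst \<omega>, v)" using D(4)[of i] that by (auto dest: inj_onD)
        then show ?thesis by simp
      qed
      show "emeasure (count_space UNIV) (?Q i) = indicator (?P i) \<omega>"
      proof (cases "?Q i = {}")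
        case True
        have "\<omega> \<notin> ?P i"
        proof
          assume "\<omega> \<in> ?P i"
          then obtain A u where Au: "(A, u) \<in> D i" "u \<in> B" "\<omega> = (A, A *v \<phi> u)" by (auto simp: slice_map_def)
          then have "u \<in> U" using DR(1) by blast
          then have "u \<in> ?Q i" using Au by simp
          then show False using True by blast
        qed
        then show ?thesis unfolding True by simp
      next
        case False
        then obtain u where u: "u \<in> ?Q i" by blast
        then have eq: "?Q i = {u}" using uniq by blast
        have "\<omega> \<in> ?P i"
          using u by (intro image_eqI[of _ _ "(fst \<omega>, u)"]) (auto simp: slice_map_def prod_eq_iff)
        then show ?thesis unfolding eq by simp
      qed
    qed
    finally show ?thesis by (simp add: c_def)
  qed
  let ?k = "\<lambda>A u. ennreal (gauss_dens (A *v \<phi> u)) * ennreal \<bar>det (A ** J u)\<bar>"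
  have m2: "(\<lambda>p. ?k (fst p) (snd p) * indicator ?S p * indicator ?C p) \<in> borel_measurable borel"
  proof -
    have "(\<lambda>p. indicator ?C p :: ennreal) \<in> borel_measurable borel" using Cb by simp
    from borel_measurable_times_ennreal[OF borel_measurable_slice_kernel[OF lp] this] show ?thesis .
  qed
  interpret g1: sigma_finite_measure "gauss :: (real ^ 'n) measure"
    by (rule prob_space_imp_sigma_finite[OF prob_space_gauss])
  have int_piece: "(\<integral>\<^sup>+b. indicator (?P i) (A, b) \<partial>gauss) = (\<integral>\<^sup>+u. ?k A u * indicator {u \<in> B. (A, u) \<in> D i} u \<partial>lborel)" for A i
  proof -
    let ?f = "\<lambda>u. A *v \<phi> u" and ?f' = "\<lambda>u h. A *v (J u *v h)"
    let ?T = "{u \<in> B. (A, u) \<in> D i}"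
    have TU: "?T \<subseteq> U" using DR(1) by blast
    have Tb: "?T \<in> sets borel"
    proof -
      have "Pair A -` D i \<in> sets borel"
        by (rule borel_Pair_section[OF D(1)])
      moreover have "?T = B \<inter> Pair A -` D i" by auto
      ultimately show ?thesis using B by simp
    qed
    have sec: "Pair A -` ?P i = ?f ` ?T"
    proof (intro equalityI subsetI)
      fix b assume "b \<in> ?f ` ?T"
      then obtain u where u: "u \<in> ?T" "b = ?f u" by blast
      then have "(A, b) = slice_map \<phi> (A, u)" "(A, u) \<in> D i \<inter> ?C" by (auto simp: slice_map_def)
      then show "b \<in> Pair A -` ?P i" unfolding vimage_eq by (rule image_eqI)
    qed (auto simp: slice_map_def)
    have fTb: "?f ` ?T \<in> sets borel"
      using borel_Pair_section[OF Pb[of i], of A] unfolding sec .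
    have matd: "det (matrix (?f' u)) = det (A ** J u)" for u by (simp add: matrix_vector_mul_assoc)
    have "(\<integral>\<^sup>+b. indicator (?P i) (A, b) \<partial>gauss) = (\<integral>\<^sup>+b. indicator (?f ` ?T) b \<partial>gauss)"
      by (intro nn_integral_cong) (simp add: sec[symmetric] indicator_def)
    also have "\<dots> = (\<integral>\<^sup>+b. ennreal (gauss_dens b) * indicator (?f ` ?T) b \<partial>lborel)"
      using fTb by (subst nn_integral_gauss) auto
    also have "\<dots> = (\<integral>\<^sup>+u. ennreal (gauss_dens (?f u)) * ennreal \<bar>det (matrix (?f' u))\<bar> * indicator ?T u \<partial>lborel)"
    proof (rule nn_integral_differentiable_image[OF Tb fTb])
      fix u assume u: "u \<in> ?T"
      have "(?f has_derivative ?f' u) (at u)"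
        using diff_chain_at[OF L(5)[of u] has_derivative_matrix_vector_mult[of A]] u TU by (auto simp: comp_def)
      then show "(?f has_derivative ?f' u) (at u within ?T)" by (rule has_derivative_at_withinI)
    next
      show "inj_on ?f ?T"
      proof (rule inj_onI)
        fix u v assume uv: "u \<in> ?T" "v \<in> ?T" "?f u = ?f v"
        then have "slice_map \<phi> (A, u) = slice_map \<phi> (A, v)" by (simp add: slice_map_def)
        then have "(A, u) = (A, v)" using D(4)[of i] uv by (auto dest: inj_onD)
        then show "u = v" by simp
      qed
      have "continuous_on U (\<lambda>u. \<bar>det (A ** J u)\<bar>)"
        by (intro continuous_intros L(6))
      then have "(\<lambda>u. indicator U u *\<^sub>R \<bar>det (A ** J u)\<bar>) \<in> borel_measurable borel"
        using L(1) by (intro borel_measurable_continuous_on_indicator) auto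
      then have "(\<lambda>u. indicator ?T u * (indicator U u *\<^sub>R \<bar>det (A ** J u)\<bar>)) \<in> borel_measurable borel"
        using Tb by measurable
      moreover have "(\<lambda>u. indicator ?T u * (indicator U u *\<^sub>R \<bar>det (A ** J u)\<bar>)) = (\<lambda>u. indicator ?T u * \<bar>det (matrix (?f' u))\<bar>)"
        using TU by (auto simp: fun_eq_iff indicator_def matd)
      ultimately show "(\<lambda>u. indicator ?T u * \<bar>det (matrix (?f' u))\<bar>) \<in> borel_measurable borel" by simp
    qed simp
    finally show ?thesis by (simp add: matd)
  qed
  have kP[measurable]: "(\<lambda>u. ?k A u * indicator {u \<in> B. (A, u) \<in> D i} u) \<in> borel_measurable lborel" for A i
  proof -
    have "(\<lambda>u. (\<lambda>p. ?k (fst p) (snd p) * indicator ?S p * indicator ?C p) (A, u) * indicator (D i) (A, u)) \<in> borel_measurable borel"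
    proof (rule borel_measurable_times_ennreal)
      have pm: "(\<lambda>u. (A, u)) \<in> borel_measurable borel" by (intro borel_measurable_continuous_onI continuous_intros)
      show "(\<lambda>u. ?k (fst (A, u)) (snd (A, u)) * indicator ?S (A, u) * indicator ?C (A, u)) \<in> borel_measurable borel"
        by (rule measurable_compose[OF pm m2])
      show "(\<lambda>u. indicator (D i) (A, u) :: ennreal) \<in> borel_measurable borel"
        by (rule measurable_compose[OF pm]) (use D(1) in simp)
    qed
    moreover have "(\<lambda>u. (\<lambda>p. ?k (fst p) (snd p) * indicator ?S p * indicator ?C p) (A, u) * indicator (D i) (A, u)) =
       (\<lambda>u. ?k A u * indicator {u \<in> B. (A, u) \<in> D i} u)"
      using DR(1) by (auto simp: fun_eq_iff indicator_def)
    ultimately show ?thesis by simp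
  qed
  have "(\<integral>\<^sup>+\<omega>. c \<omega> \<partial>gauss) = (\<Sum>i. \<integral>\<^sup>+\<omega>. indicator (?P i) \<omega> \<partial>gauss)"
    unfolding c_def by (rule nn_integral_suminf) measurable
  also have "\<dots> = (\<Sum>i. \<integral>\<^sup>+A. \<integral>\<^sup>+b. indicator (?P i) (A, b) \<partial>gauss \<partial>gauss)"
  proof (intro suminf_cong)
    fix i
    have "indicator (?P i) \<in> borel_measurable ((gauss :: (real ^ 'N ^ 'n) measure) \<Otimes>\<^sub>M (gauss :: (real ^ 'n) measure))"
      unfolding gauss_distr_Pair by measurable
    from g1.nn_integral_fst[OF this]
    show "(\<integral>\<^sup>+\<omega>. indicator (?P i) \<omega> \<partial>gauss) = (\<integral>\<^sup>+A. \<integral>\<^sup>+b. indicator (?P i) (A, b) \<partial>gauss \<partial>gauss)"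
      by (simp add: gauss_distr_Pair)
  qed
  also have "\<dots> = (\<integral>\<^sup>+A. (\<Sum>i. \<integral>\<^sup>+b. indicator (?P i) (A, b) \<partial>gauss) \<partial>gauss)"
  proof (rule nn_integral_suminf[symmetric])
    fix i
    have "indicator (?P i) \<in> borel_measurable ((gauss :: (real ^ 'N ^ 'n) measure) \<Otimes>\<^sub>M (gauss :: (real ^ 'n) measure))"
      unfolding gauss_distr_Pair by measurable
    from g1.borel_measurable_nn_integral_fst[OF this]
    show "(\<lambda>A. \<integral>\<^sup>+b. indicator (?P i) (A, b) \<partial>gauss) \<in> borel_measurable gauss" .
  qed
  also have "\<dots> = (\<integral>\<^sup>+A. (\<integral>\<^sup>+u. ?k A u * indicator (U \<inter> B) u \<partial>lborel) \<partial>gauss)"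
  proof (rule nn_integral_cong)
    fix A :: "real ^ 'N ^ 'n"
    have "(\<Sum>i. \<integral>\<^sup>+b. indicator (?P i) (A, b) \<partial>gauss) = (\<integral>\<^sup>+u. (\<Sum>i. ?k A u * indicator {u \<in> B. (A, u) \<in> D i} u) \<partial>lborel)"
      unfolding int_piece by (rule nn_integral_suminf[symmetric]) (rule kP)
    also have "\<dots> = (\<integral>\<^sup>+u. ?k A u * indicator (U \<inter> B) u \<partial>lborel)"
    proof (rule nn_integral_cong)
      fix u
      have un: "(\<Union>i. {u \<in> B. (A, u) \<in> D i}) = {u \<in> U \<inter> B. det (A ** J u) \<noteq> 0}"
      proof (intro equalityI subsetI)
        fix v assume "v \<in> {u \<in> U \<inter> B. det (A ** J u) \<noteq> 0}"
        then have "(A, v) \<in> (\<Union>i. D i)" and "v \<in> B" unfolding D(3) by auto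
        then show "v \<in> (\<Union>i. {u \<in> B. (A, u) \<in> D i})" by blast
      qed (use DR in blast)
      have "(\<Sum>i. ?k A u * indicator {u \<in> B. (A, u) \<in> D i} u) = ?k A u * (\<Sum>i. indicator {u \<in> B. (A, u) \<in> D i} u)"
        by (rule ennreal_suminf_cmult)
      also have "(\<Sum>i. indicator {u \<in> B. (A, u) \<in> D i} u :: ennreal) = indicator {u \<in> U \<inter> B. det (A ** J u) \<noteq> 0} u"
        unfolding un[symmetric]
        by (rule suminf_indicator) (use D(2) in \<open>fastforce simp: disjoint_family_on_def\<close>)
      \<comment> \<open>Critical points may be readmitted, since the determinant factor vanishes
        there.\<close>
      also have "?k A u * \<dots> = ?k A u * indicator (U \<inter> B) u"
        by (cases "det (A ** J u) = 0") (simp_all add: indicator_def)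
      finally show "(\<Sum>i. ?k A u * indicator {u \<in> B. (A, u) \<in> D i} u) = ?k A u * indicator (U \<inter> B) u" .
    qed
    finally show "(\<Sum>i. \<integral>\<^sup>+b. indicator (?P i) (A, b) \<partial>gauss) = (\<integral>\<^sup>+u. ?k A u * indicator (U \<inter> B) u \<partial>lborel)" .
  qed
  also have "\<dots> = (\<integral>\<^sup>+u. (\<integral>\<^sup>+A. ?k A u * indicator (U \<inter> B) u \<partial>gauss) \<partial>lborel)"
  proof (rule pair_sigma_finite.Fubini'[symmetric])
    show "pair_sigma_finite (gauss :: (real ^ 'N ^ 'n) measure) (lborel :: (real ^ 'n) measure)"
      by (simp add: pair_sigma_finite_def sigma_finite_lborel prob_space_imp_sigma_finite prob_space_gauss)
    have "sets ((gauss :: (real ^ 'N ^ 'n) measure) \<Otimes>\<^sub>M (lborel :: (real ^ 'n) measure)) = sets borel"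
      by (simp add: borel_prod[symmetric] cong: sets_pair_measure_cong)
    moreover have "(\<lambda>p. ?k (fst p) (snd p) * indicator ?S p * indicator ?C p) = (\<lambda>(A, u). ?k A u * indicator (U \<inter> B) u)"
      by (auto simp: fun_eq_iff indicator_def)
    ultimately show "(\<lambda>(A, u). ?k A u * indicator (U \<inter> B) u) \<in> borel_measurable ((gauss :: (real ^ 'N ^ 'n) measure) \<Otimes>\<^sub>M (lborel :: (real ^ 'n) measure))"
      using m2 by (simp cong: measurable_cong_sets)
  qed
  also have "\<dots> = (\<integral>\<^sup>+u. slice_density \<phi> J u * indicator (U \<inter> B) u \<partial>lborel)"
    unfolding slice_density_def by (intro nn_integral_cong) (simp add: indicator_def)
  finally show ?thesis using c count by blast
qed

lemma chart_image_sets: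
  assumes lp: "local_parametrization M U \<phi> J" and D: "D \<in> sets borel" "D \<subseteq> U"
  shows "\<phi> ` D \<in> sets (restrict_space borel M)"
proof -
  obtain \<psi> where \<psi>: "homeomorphism U (\<phi> ` U) \<phi> \<psi>" using lp by (auto simp: local_parametrization_def)
  obtain Ob where Ob: "open Ob" "\<phi> ` U = M \<inter> Ob"
    using local_parametrizationD(2)[OF lp] by (auto simp: openin_open)
  have "\<psi> \<in> borel_measurable (restrict_space borel (\<phi> ` U))"
    using \<psi> by (intro borel_measurable_continuous_on_restrict) (simp add: homeomorphism_def)
  from measurable_sets[OF this D(1)]
  have "\<psi> -` D \<inter> \<phi> ` U \<in> sets (restrict_space borel (\<phi> ` U))" by (simp add: space_restrict_space)
  then obtain A where A: "A \<in> sets borel" "\<psi> -` D \<inter> \<phi> ` U = \<phi> ` U \<inter> A"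
    by (auto simp: sets_restrict_space)
  have "\<phi> ` D = \<psi> -` D \<inter> \<phi> ` U"
  proof (intro equalityI subsetI)
    fix y assume "y \<in> \<phi> ` D"
    then obtain u where u: "u \<in> D" "y = \<phi> u" by auto
    then have "\<psi> y = u" using \<psi> D(2) by (auto simp: homeomorphism_def)
    then show "y \<in> \<psi> -` D \<inter> \<phi> ` U" using u D(2) by auto
  next
    fix y assume y: "y \<in> \<psi> -` D \<inter> \<phi> ` U"
    then obtain u where u: "u \<in> U" "y = \<phi> u" by blast
    then have "\<psi> y = u" using \<psi> by (simp add: homeomorphism_def)
    then show "y \<in> \<phi> ` D" using y u(2) by blast
  qed
  also have "\<dots> = \<phi> ` U \<inter> A" by (rule A(2))
  also have "\<dots> = M \<inter> (Ob \<inter> A)" unfolding Ob(2) by (rule Int_assoc)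
  finally have "\<phi> ` D = M \<inter> (Ob \<inter> A)" .
  moreover have "Ob \<inter> A \<in> sets borel" using Ob(1) A(1) by auto
  ultimately show ?thesis unfolding sets_restrict_space by blast
qed

lemma chart_preimage_sets:
  assumes lp: "local_parametrization M U \<phi> J" and B: "B \<in> sets (restrict_space borel M)"
  shows "{u\<in>U. \<phi> u \<in> B} \<in> sets borel"
proof -
  note L = local_parametrizationD[OF lp]
  obtain A where A: "A \<in> sets borel" "B = M \<inter> A" using B by (auto simp: sets_restrict_space)
  have "\<phi> \<in> borel_measurable (restrict_space borel U)" by (rule borel_measurable_continuous_on_restrict[OF L(7)])
  from measurable_sets[OF this A(1)] have "\<phi> -` A \<inter> U \<in> sets borel"
    using L(1) by (simp add: space_restrict_space sets_restrict_space_iff)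
  moreover have "{u\<in>U. \<phi> u \<in> B} = \<phi> -` A \<inter> U" using L(3) A(2) by auto
  ultimately show ?thesis by simp
qed

lemma affine_slice_iff: "x \<in> affine_slice \<omega> \<longleftrightarrow> fst \<omega> *v x = snd \<omega>"
  by (cases \<omega>) (simp add: affine_slice_def)

lemma AE_gauss_of_null_lborel:
  assumes "N \<in> null_sets lborel" shows "AE x in gauss. x \<notin> N"
proof -
  have "AE x in lborel. x \<notin> N" using assms by (rule AE_not_in)
  then show ?thesis unfolding gauss_def by (subst AE_density) (auto elim: eventually_mono)
qed

text \<open>The count agrees with a Borel function only off the critical values; hence measurability
  with respect to the completion.\<close>

lemma slice_count_in_chart:
  fixes \<phi> :: "real ^ 'n \<Rightarrow> real ^ 'N"
  assumes lp: "local_parametrization M U \<phi> J" and B: "B \<in> sets (restrict_space borel M)" "B \<subseteq> \<phi> ` U"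
  shows "(\<lambda>\<omega> :: (real ^ 'N ^ 'n) \<times> (real ^ 'n). slice_count (B \<inter> affine_slice \<omega>)) \<in> borel_measurable (completion gauss)"
    "(\<integral>\<^sup>+\<omega>. slice_count (B \<inter> affine_slice (\<omega> :: (real ^ 'N ^ 'n) \<times> (real ^ 'n))) \<partial>completion gauss)
       = (\<integral>\<^sup>+u. slice_density \<phi> J u * indicator {u\<in>U. \<phi> u \<in> B} u \<partial>lborel)"
proof -
  note L = local_parametrizationD[OF lp]
  let ?B = "{u\<in>U. \<phi> u \<in> B}"
  have Bb: "?B \<in> sets borel" by (rule chart_preimage_sets[OF lp B(1)])
  have eq: "slice_count (B \<inter> affine_slice \<omega>) = slice_count {u\<in>U. u \<in> ?B \<and> fst \<omega> *v \<phi> u = snd \<omega>}" for \<omega> :: "(real ^ 'N ^ 'n) \<times> (real ^ 'n)"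
  proof -
    let ?X = "{u\<in>U. u \<in> ?B \<and> fst \<omega> *v \<phi> u = snd \<omega>}"
    have im: "B \<inter> affine_slice \<omega> = \<phi> ` ?X" using B(2) by (auto simp: affine_slice_iff)
    have inj: "inj_on \<phi> ?X" by (rule inj_on_subset[OF L(4)]) auto
    show ?thesis
      unfolding im slice_count_def using inj by (simp add: emeasure_count_space finite_image_iff card_image)
  qed
  obtain c where c: "c \<in> borel_measurable borel"
    "\<And>\<omega>. \<omega> \<notin> slice_map \<phi> ` slice_critical U J \<Longrightarrow> slice_count {u\<in>U. u \<in> ?B \<and> fst \<omega> *v \<phi> u = snd \<omega>} = c \<omega>"
    "(\<integral>\<^sup>+\<omega>. c \<omega> \<partial>gauss) = (\<integral>\<^sup>+u. slice_density \<phi> J u * indicator (U \<inter> ?B) u \<partial>lborel)"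
    using slice_count_chart[OF lp Bb] by blast
  have ae: "AE \<omega> in gauss. c \<omega> = slice_count (B \<inter> affine_slice \<omega>)"
    using AE_gauss_of_null_lborel[OF slice_critical_null[OF lp]]
    by eventually_elim (simp only: eq, rule c(2)[symmetric])
  show "(\<lambda>\<omega> :: (real ^ 'N ^ 'n) \<times> (real ^ 'n). slice_count (B \<inter> affine_slice \<omega>)) \<in> borel_measurable (completion gauss)"
    by (rule measurable_completion_AE[OF _ ae]) (use c(1) in \<open>auto cong: measurable_cong_sets\<close>)
  have "(\<integral>\<^sup>+\<omega>. slice_count (B \<inter> affine_slice (\<omega> :: (real ^ 'N ^ 'n) \<times> (real ^ 'n))) \<partial>completion gauss) = (\<integral>\<^sup>+\<omega>. c \<omega> \<partial>gauss)"
    unfolding nn_integral_completion using ae by (intro nn_integral_cong_AE) (auto elim: eventually_mono)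
  also have "U \<inter> ?B = ?B" by blast
  then have "(\<integral>\<^sup>+\<omega>. c \<omega> \<partial>gauss) = (\<integral>\<^sup>+u. slice_density \<phi> J u * indicator ?B u \<partial>lborel)" using c(3) by simp
  finally show "(\<integral>\<^sup>+\<omega>. slice_count (B \<inter> affine_slice (\<omega> :: (real ^ 'N ^ 'n) \<times> (real ^ 'n))) \<partial>completion gauss)
       = (\<integral>\<^sup>+u. slice_density \<phi> J u * indicator ?B u \<partial>lborel)" .
qed

section \<open>From charts to the whole manifold\<close>

lemma disjoint_chart_cover:
  fixes M :: "(real ^ 'N) set"
  assumes M: "algebraic_manifold CARD('n) M"
  obtains U :: "nat \<Rightarrow> (real ^ 'n) set" and \<phi> J C where
    "\<And>i. local_parametrization M (U i) (\<phi> i) (J i)" "\<And>i. C i \<in> sets (restrict_space borel M)"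
    "\<And>i. C i \<subseteq> \<phi> i ` U i" "disjoint_family C" "(\<Union>i. C i) = M"
proof -
  obtain U :: "nat \<Rightarrow> (real ^ 'n) set" and \<phi> J where
    a: "\<And>i. local_parametrization M (U i) (\<phi> i) (J i)" "(\<Union>i. \<phi> i ` U i) = M"
    by (rule countable_atlas[OF M]) (rule that; assumption)
  have s: "\<phi> i ` U i \<in> sets (restrict_space borel M)" for i
    using chart_image_sets[OF a(1), of "U i" i] local_parametrizationD(1)[OF a(1)] by simp
  let ?C = "disjointed (\<lambda>i. \<phi> i ` U i)"
  show ?thesis
  proof (rule that[of U \<phi> J ?C])
    have "range (\<lambda>i. \<phi> i ` U i) \<subseteq> sets (restrict_space borel M)" using s by blast
    from sets.range_disjointed_sets[OF this] show "?C i \<in> sets (restrict_space borel M)" for i by auto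
    show "?C i \<subseteq> \<phi> i ` U i" for i by (rule disjointed_subset)
    show "disjoint_family ?C" by (rule disjoint_family_disjointed)
    show "(\<Union>i. ?C i) = M" using UN_disjointed_eq a(2) by metis
  qed (rule a(1))
qed

lemma borel_measurable_slice_count:
  fixes M :: "(real ^ 'N) set"
  assumes M: "algebraic_manifold CARD('n) M" and B: "B \<in> sets (restrict_space borel M)"
  shows "(\<lambda>\<omega> :: (real ^ 'N ^ 'n) \<times> (real ^ 'n). slice_count (B \<inter> affine_slice \<omega>)) \<in> borel_measurable (completion gauss)"
proof -
  obtain U :: "nat \<Rightarrow> (real ^ 'n) set" and \<phi> J C where
    a: "\<And>i. local_parametrization M (U i) (\<phi> i) (J i)" "\<And>i. C i \<in> sets (restrict_space borel M)"
    "\<And>i. C i \<subseteq> \<phi> i ` U i" "disjoint_family C" "(\<Union>i. C i) = M"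
    by (rule disjoint_chart_cover[OF M]) (rule that; assumption)
  have BM: "B \<subseteq> M" using B sets.sets_into_space[of B "restrict_space borel M"] by (simp add: space_restrict_space)
  have "slice_count (B \<inter> affine_slice \<omega>) = (\<Sum>i. slice_count (B \<inter> C i \<inter> affine_slice \<omega>))" for \<omega> :: "(real ^ 'N ^ 'n) \<times> (real ^ 'n)"
  proof -
    have "B \<inter> affine_slice \<omega> = (\<Union>i. B \<inter> C i \<inter> affine_slice \<omega>)" using BM a(5) by blast
    moreover have "disjoint_family (\<lambda>i. B \<inter> C i \<inter> affine_slice \<omega>)"
      using a(4) by (fastforce simp: disjoint_family_on_def)
    ultimately show ?thesis unfolding slice_count_def by (simp add: suminf_emeasure)
  qed
  moreover have "(\<lambda>\<omega> :: (real ^ 'N ^ 'n) \<times> (real ^ 'n). slice_count (B \<inter> C i \<inter> affine_slice \<omega>)) \<in> borel_measurable (completion gauss)" for i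
    by (rule slice_count_in_chart(1)[OF a(1)]) (use B a(2,3) in auto)
  ultimately show ?thesis by simp
qed

text \<open>The intensity measure of the random set of points of \<open>M\<close> on a slice. Its
  definition mentions no chart; charts only enter the proofs of measurability and its
  evaluation.\<close>

definition slice_measure :: "'n::finite itself \<Rightarrow> (real ^ 'N) set \<Rightarrow> (real ^ 'N) measure" where
  "slice_measure _ M = measure_of M (sets (restrict_space borel M))
     (\<lambda>B. \<integral>\<^sup>+\<omega>. slice_count (B \<inter> affine_slice (\<omega> :: (real ^ 'N ^ 'n) \<times> (real ^ 'n))) \<partial>completion gauss)"

lemma space_slice_measure [simp]: "space (slice_measure TYPE('n::finite) M) = M"
  unfolding slice_measure_def by (rule space_measure_of) (use sets.space_closed[of "restrict_space borel M"] in \<open>simp add: space_restrict_space\<close>)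

lemma sets_slice_measure [simp]: "sets (slice_measure TYPE('n::finite) M) = sets (restrict_space borel M)"
proof -
  have "sets (slice_measure TYPE('n) M) = sigma_sets M (sets (restrict_space borel M))"
    unfolding slice_measure_def
    by (rule sets_measure_of) (use sets.space_closed[of "restrict_space borel M"] in \<open>simp add: space_restrict_space\<close>)
  also have "\<dots> = sets (restrict_space borel M)"
    using sets.sigma_sets_eq[of "restrict_space borel M"] by (simp add: space_restrict_space)
  finally show ?thesis .
qed

lemma emeasure_slice_measure:
  fixes M :: "(real ^ 'N) set"
  assumes M: "algebraic_manifold CARD('n) M" and B: "B \<in> sets (restrict_space borel M)"
  shows "emeasure (slice_measure TYPE('n) M) B = (\<integral>\<^sup>+\<omega>. slice_count (B \<inter> affine_slice (\<omega> :: (real ^ 'N ^ 'n) \<times> (real ^ 'n))) \<partial>completion gauss)"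
proof (rule emeasure_measure_of[OF slice_measure_def])
  show "sets (restrict_space borel M) \<subseteq> Pow M"
    using sets.space_closed[of "restrict_space borel M"] by (simp add: space_restrict_space)
  show "positive (sets (slice_measure TYPE('n) M)) (\<lambda>B. \<integral>\<^sup>+\<omega>. slice_count (B \<inter> affine_slice (\<omega> :: (real ^ 'N ^ 'n) \<times> (real ^ 'n))) \<partial>completion gauss)"
    by (simp add: positive_def slice_count_def)
  show "countably_additive (sets (slice_measure TYPE('n) M)) (\<lambda>B. \<integral>\<^sup>+\<omega>. slice_count (B \<inter> affine_slice (\<omega> :: (real ^ 'N ^ 'n) \<times> (real ^ 'n))) \<partial>completion gauss)"
  proof (rule countably_additiveI)
    fix A :: "nat \<Rightarrow> (real ^ 'N) set"
    assume A: "range A \<subseteq> sets (slice_measure TYPE('n) M)" "disjoint_family A"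
    have "(\<Sum>i. \<integral>\<^sup>+\<omega>. slice_count (A i \<inter> affine_slice (\<omega> :: (real ^ 'N ^ 'n) \<times> (real ^ 'n))) \<partial>completion gauss)
      = (\<integral>\<^sup>+\<omega>. (\<Sum>i. slice_count (A i \<inter> affine_slice (\<omega> :: (real ^ 'N ^ 'n) \<times> (real ^ 'n)))) \<partial>completion gauss)"
      using A by (intro nn_integral_suminf[symmetric] borel_measurable_slice_count[OF M]) auto
    also have "\<dots> = (\<integral>\<^sup>+\<omega>. slice_count (\<Union> (range A) \<inter> affine_slice (\<omega> :: (real ^ 'N ^ 'n) \<times> (real ^ 'n))) \<partial>completion gauss)"
    proof (rule nn_integral_cong)
      fix \<omega> :: "(real ^ 'N ^ 'n) \<times> (real ^ 'n)"
      have "disjoint_family (\<lambda>i. A i \<inter> affine_slice \<omega>)" using A(2) by (fastforce simp: disjoint_family_on_def)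
      then have "(\<Sum>i. slice_count (A i \<inter> affine_slice \<omega>)) = slice_count (\<Union>i. A i \<inter> affine_slice \<omega>)"
        unfolding slice_count_def by (intro suminf_emeasure) auto
      then show "(\<Sum>i. slice_count (A i \<inter> affine_slice \<omega>)) = slice_count (\<Union> (range A) \<inter> affine_slice \<omega>)" by simp
    qed
    finally show "(\<Sum>i. \<integral>\<^sup>+\<omega>. slice_count (A i \<inter> affine_slice (\<omega> :: (real ^ 'N ^ 'n) \<times> (real ^ 'n))) \<partial>completion gauss)
      = (\<integral>\<^sup>+\<omega>. slice_count (\<Union> (range A) \<inter> affine_slice (\<omega> :: (real ^ 'N ^ 'n) \<times> (real ^ 'n))) \<partial>completion gauss)" .
  qed
qed (use B in simp)

text \<open>Campbell's formula for the random point set. For indicators it is the definition of the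
  intensity measure, and sums and monotone limits pass through all the integrals involved.\<close>

lemma nn_integral_slice_measure:
  fixes M :: "(real ^ 'N) set"
  assumes M: "algebraic_manifold CARD('n) M" and g: "g \<in> borel_measurable (slice_measure TYPE('n) M)"
  shows "(\<lambda>\<omega> :: (real ^ 'N ^ 'n) \<times> (real ^ 'n). \<integral>\<^sup>+x. g x \<partial>count_space (M \<inter> affine_slice \<omega>)) \<in> borel_measurable (completion gauss) \<and>
    (\<integral>\<^sup>+x. g x \<partial>slice_measure TYPE('n) M) =
    (\<integral>\<^sup>+\<omega>. (\<integral>\<^sup>+x. g x \<partial>count_space (M \<inter> affine_slice (\<omega> :: (real ^ 'N ^ 'n) \<times> (real ^ 'n)))) \<partial>completion gauss)"
  using g
proof (induction rule: borel_measurable_induct)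
  case (cong f g)
  have "(\<integral>\<^sup>+x. f x \<partial>count_space (M \<inter> affine_slice \<omega>)) = (\<integral>\<^sup>+x. g x \<partial>count_space (M \<inter> affine_slice \<omega>))"
    for \<omega> :: "(real ^ 'N ^ 'n) \<times> (real ^ 'n)"
    using cong(3) by (intro nn_integral_cong) auto
  moreover have "(\<integral>\<^sup>+x. f x \<partial>slice_measure TYPE('n) M) = (\<integral>\<^sup>+x. g x \<partial>slice_measure TYPE('n) M)"
    using cong(3) by (intro nn_integral_cong) auto
  ultimately show ?case using cong(4) by simp
next
  case (set A)
  then have A: "A \<in> sets (restrict_space borel M)" by simp
  have AM: "A \<subseteq> M" using A sets.sets_into_space[of A "restrict_space borel M"] by (simp add: space_restrict_space)
  have "(\<integral>\<^sup>+x. indicator A x \<partial>count_space (M \<inter> affine_slice \<omega>)) = slice_count (A \<inter> affine_slice \<omega>)"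
    for \<omega> :: "(real ^ 'N ^ 'n) \<times> (real ^ 'n)"
  proof -
    have "(\<integral>\<^sup>+x. indicator A x \<partial>count_space (M \<inter> affine_slice \<omega>)) = (\<integral>\<^sup>+x. indicator A x * indicator (M \<inter> affine_slice \<omega>) x \<partial>count_space UNIV)"
      by (simp add: nn_integral_count_space_indicator)
    also have "\<dots> = (\<integral>\<^sup>+x. indicator (A \<inter> affine_slice \<omega>) x \<partial>count_space UNIV)"
      using AM by (intro nn_integral_cong) (auto simp: indicator_def)
    finally show ?thesis by (simp add: slice_count_def)
  qed
  then show ?case
    using borel_measurable_slice_count[OF M A] emeasure_slice_measure[OF M A] A by simp
next
  case (mult u c)
  have "(\<integral>\<^sup>+x. c * u x \<partial>count_space (M \<inter> affine_slice \<omega>)) = c * (\<integral>\<^sup>+x. u x \<partial>count_space (M \<inter> affine_slice \<omega>))"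
    for \<omega> :: "(real ^ 'N ^ 'n) \<times> (real ^ 'n)"
    by (intro nn_integral_cmult) simp
  then show ?case using mult by (simp add: nn_integral_cmult borel_measurable_times_ennreal)
next
  case (add u v)
  have "(\<integral>\<^sup>+x. v x + u x \<partial>count_space (M \<inter> affine_slice \<omega>)) = (\<integral>\<^sup>+x. v x \<partial>count_space (M \<inter> affine_slice \<omega>)) + (\<integral>\<^sup>+x. u x \<partial>count_space (M \<inter> affine_slice \<omega>))"
    for \<omega> :: "(real ^ 'N ^ 'n) \<times> (real ^ 'n)"
    by (intro nn_integral_add) simp_all
  then show ?case using add by (simp add: nn_integral_add borel_measurable_add)
next
  case (seq W)
  let ?I = "\<lambda>i (\<omega> :: (real ^ 'N ^ 'n) \<times> (real ^ 'n)). \<integral>\<^sup>+x. W i x \<partial>count_space (M \<inter> affine_slice \<omega>)"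
  have eq: "(\<integral>\<^sup>+x. (SUP i. W i) x \<partial>count_space (M \<inter> affine_slice \<omega>)) = (SUP i. ?I i \<omega>)"
    for \<omega> :: "(real ^ 'N ^ 'n) \<times> (real ^ 'n)"
    unfolding SUP_apply using \<open>incseq W\<close> by (intro nn_integral_monotone_convergence_SUP) auto
  have inc: "incseq ?I"
    using \<open>incseq W\<close> by (auto simp: incseq_def le_fun_def intro!: nn_integral_mono)
  have m: "?I i \<in> borel_measurable (completion gauss)" for i using seq.IH by simp
  have "(\<integral>\<^sup>+x. (SUP i. W i) x \<partial>slice_measure TYPE('n) M) = (SUP i. \<integral>\<^sup>+x. W i x \<partial>slice_measure TYPE('n) M)"
    unfolding SUP_apply using seq.hyps(1) \<open>incseq W\<close> by (intro nn_integral_monotone_convergence_SUP) auto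
  also have "\<dots> = (SUP i. \<integral>\<^sup>+\<omega>. ?I i \<omega> \<partial>completion gauss)" using seq.IH by simp
  also have "\<dots> = (\<integral>\<^sup>+\<omega>. (SUP i. ?I i \<omega>) \<partial>completion gauss)"
    by (rule nn_integral_monotone_convergence_SUP[OF inc m, symmetric])
  finally show ?case unfolding eq using m by simp
qed

section \<open>The weight \<open>alpha\<close> and the volume measure\<close>

text \<open>The remainder is tested against the complement of the complement of \<open>T\<close>,
  which contains \<open>T\<close>. Uniqueness holds because a vector lying both in a set and in its
  orthogonal complement is orthogonal to itself.\<close>

lemma orth_proj_orthogonal_comp:
  assumes y: "y \<in> T" and w: "w \<in> orthogonal_comp T"
  shows "orth_proj (orthogonal_comp T) (y + w) = w"
  unfolding orth_proj_def
proof (rule the_equality)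
  have y2: "y \<in> orthogonal_comp (orthogonal_comp T)" using y orthogonal_comp_subset by blast
  show "w \<in> orthogonal_comp T \<and> y + w - w \<in> orthogonal_comp (orthogonal_comp T)" using w y2 by simp
  fix z assume z: "z \<in> orthogonal_comp T \<and> y + w - z \<in> orthogonal_comp (orthogonal_comp T)"
  have "y + w - z - y \<in> orthogonal_comp (orthogonal_comp T)"
    by (rule subspace_diff[OF subspace_orthogonal_comp conjunct2[OF z] y2])
  then have 1: "w - z \<in> orthogonal_comp (orthogonal_comp T)" by simp
  have 2: "w - z \<in> orthogonal_comp T" using z w by (intro subspace_diff subspace_orthogonal_comp) auto
  have "orthogonal (w - z) (w - z)" using 1 2 by (auto simp: orthogonal_comp_def)
  then show "z = w" by (simp add: orthogonal_self)
qed

text \<open>With \<open>J = E ** R\<close> the Gram determinant is the square of the determinant of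
  \<open>R\<close>, and \<open>R\<close> inherits injectivity from \<open>J\<close>.\<close>

lemma gram_det_pos:
  fixes J :: "real ^ 'n ^ 'N"
  assumes "inj ((*v) J)" shows "det (transpose J ** J) > 0"
proof -
  obtain E :: "real ^ 'n ^ 'N" and R :: "real ^ 'n ^ 'n" where JE: "J = E ** R" "transpose E ** E = mat 1"
    using ex_orthonormal_factor[OF assms] by metis
  have "transpose J ** J = transpose R ** (transpose E ** E) ** R"
    by (simp add: JE(1) matrix_transpose_mul matrix_mul_assoc)
  then have d: "det (transpose J ** J) = (det R)\<^sup>2" by (simp add: JE(2) det_mul power2_eq_square)
  have "R *v v = 0 \<Longrightarrow> v = 0" for v
  proof -
    assume "R *v v = 0"
    then have "J *v v = J *v 0" by (simp add: JE(1) matrix_vector_mul_assoc[symmetric])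
    then show "v = 0" by (rule injD[OF assms])
  qed
  then have "invertible R" unfolding invertible_left_inverse matrix_left_invertible_ker by blast
  then show ?thesis unfolding d by (simp add: invertible_det_nz)
qed

lemma tangent_space_eq_range:
  fixes M :: "(real ^ 'N) set" and J :: "real ^ 'n \<Rightarrow> real ^ 'n ^ 'N"
  assumes M: "algebraic_manifold CARD('n) M" and lp: "local_parametrization M U \<phi> J" and u: "u \<in> U"
  shows "tangent_space M (\<phi> u) = range ((*v) (J u))"
proof -
  obtain V Ob where V: "open Ob" "M = nonsingular_points V \<inter> Ob" "M \<subseteq> V" "\<And>x. x \<in> M \<Longrightarrow> nonsingular_of_dim CARD('n) V x"
    by (rule algebraic_manifold_varietyE[OF M]) (rule that; assumption)
  have x: "\<phi> u \<in> M" using local_parametrizationD(3)[OF lp] u by blast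
  obtain k p W where p: "k + CARD('n) = CARD('N)" "\<And>i. i < k \<Longrightarrow> real_polynomial_function (p i)"
    "\<And>i y. i < k \<Longrightarrow> y \<in> V \<Longrightarrow> p i y = 0" "open W" "\<phi> u \<in> W" "V \<inter> W = {y. \<forall>i<k. p i y = 0} \<inter> W"
    "inj_on (\<lambda>i. grad (p i) (\<phi> u)) {..<k}" "independent ((\<lambda>i. grad (p i) (\<phi> u)) ` {..<k})"
    by (rule nonsingular_of_dim_gradE[OF V(4)[OF x]]) (rule that; assumption)
  have pM: "p i y = 0" if "i < k" "y \<in> M" for i y using p(3)[OF that(1)] V(3) that(2) by blast
  show ?thesis by (rule tangent_space_local_parametrization(1)[OF lp u p(1,2) pM p(7,8)])
qed

text \<open>Splitting \<open>\<phi> u\<close> into its tangential part \<open>y\<close> and its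
  normal part \<open>w\<close> makes \<open>nn_integral_gauss_slice\<close> applicable, and
  \<open>w\<close> is the normal projection that occurs in \<open>alpha\<close>. The lower bound
  replaces the square root in the numerator by 1.\<close>

lemma slice_density_eq_alpha:
  fixes M :: "(real ^ 'N) set" and J :: "real ^ 'n \<Rightarrow> real ^ 'n ^ 'N"
  assumes M: "algebraic_manifold CARD('n) M" and lp: "local_parametrization M U \<phi> J" and u: "u \<in> U"
  shows "slice_density \<phi> J u = ennreal (alpha CARD('n) M (\<phi> u) * sqrt (det (transpose (J u) ** J u)))"
    "alpha CARD('n) M (\<phi> u) \<ge> Gamma ((real CARD('n) + 1) / 2) / sqrt pi ^ (CARD('n) + 1) / (1 + (norm (\<phi> u))\<^sup>2) powr ((real CARD('n) + 1) / 2)"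
proof -
  let ?T = "range ((*v) (J u))"
  have T: "subspace ?T" by (intro linear_subspace_image) auto
  obtain y w where yw: "y \<in> span ?T" "\<And>v. v \<in> span ?T \<Longrightarrow> orthogonal w v" "\<phi> u = y + w"
    using orthogonal_subspace_decomp_exists[of ?T "\<phi> u"] by metis
  have yT: "y \<in> ?T" using yw(1) T by (simp add: span_eq_iff[THEN iffD2])
  then obtain p where p: "y = J u *v p" by auto
  have w: "w \<bullet> (J u *v h) = 0" for h using yw(2)[of "J u *v h"] by (simp add: orthogonal_def span_base)
  have wN: "w \<in> orthogonal_comp ?T" using w by (auto simp: orthogonal_comp_def orthogonal_def inner_commute)
  have proj: "orth_proj (normal_space M (\<phi> u)) (\<phi> u) = w"
  proof -
    have "orth_proj (orthogonal_comp ?T) (y + w) = w" by (rule orth_proj_orthogonal_comp[OF yT wN])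
    then show ?thesis by (simp only: normal_space_def tangent_space_eq_range[OF M lp u] yw(3)[symmetric])
  qed
  have ip: "\<phi> u \<bullet> w = (norm w)\<^sup>2"
    unfolding yw(3) p power2_norm_eq_inner using w[of p] by (simp add: inner_add_left inner_add_right inner_commute)
  let ?g = "Gamma ((real CARD('n) + 1) / 2) / sqrt pi ^ (CARD('n) + 1)"
  have al: "alpha CARD('n) M (\<phi> u) = sqrt (1 + (norm w)\<^sup>2) / (1 + (norm (\<phi> u))\<^sup>2) powr ((real CARD('n) + 1) / 2) * ?g"
    unfolding alpha_def proj ip by simp
  show "slice_density \<phi> J u = ennreal (alpha CARD('n) M (\<phi> u) * sqrt (det (transpose (J u) ** J u)))"
    unfolding slice_density_def al
    by (rule nn_integral_gauss_slice[OF local_parametrizationD(8)[OF lp u] _ w]) (simp add: yw(3) p)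
  have g: "?g > 0" by (simp add: Gamma_real_pos)
  have "1 + (norm (\<phi> u))\<^sup>2 > 0" by (simp add: add_pos_nonneg)
  then have pw: "(1 + (norm (\<phi> u))\<^sup>2) powr ((real CARD('n) + 1) / 2) > 0" by simp
  have "1 \<le> sqrt (1 + (norm w)\<^sup>2)" by simp
  then have "1 * ?g / (1 + (norm (\<phi> u))\<^sup>2) powr ((real CARD('n) + 1) / 2) \<le> sqrt (1 + (norm w)\<^sup>2) * ?g / (1 + (norm (\<phi> u))\<^sup>2) powr ((real CARD('n) + 1) / 2)"
    using g pw by (intro divide_right_mono mult_right_mono) auto
  then show "alpha CARD('n) M (\<phi> u) \<ge> ?g / (1 + (norm (\<phi> u))\<^sup>2) powr ((real CARD('n) + 1) / 2)"
    unfolding al by (simp add: mult.commute)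
qed

lemma alpha_lower_bound:
  fixes M :: "(real ^ 'N) set"
  assumes M: "algebraic_manifold CARD('n::finite) M" and x: "x \<in> M"
  shows "alpha CARD('n) M x \<ge> Gamma ((real CARD('n) + 1) / 2) / sqrt pi ^ (CARD('n) + 1) / (1 + (norm x)\<^sup>2) powr ((real CARD('n) + 1) / 2)"
    "alpha CARD('n) M x > 0"
proof -
  obtain U :: "(real ^ 'n) set" and \<phi> J where lp: "local_parametrization M U \<phi> J" and "x \<in> \<phi> ` U"
    using local_parametrization_exists[OF M x] by (elim exE conjE)
  then obtain u where "u \<in> U" "x = \<phi> u" by blast
  then show 1: "alpha CARD('n) M x \<ge> Gamma ((real CARD('n) + 1) / 2) / sqrt pi ^ (CARD('n) + 1) / (1 + (norm x)\<^sup>2) powr ((real CARD('n) + 1) / 2)"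
    using slice_density_eq_alpha(2)[OF M lp] by simp
  have "Gamma ((real CARD('n) + 1) / 2) / sqrt pi ^ (CARD('n) + 1) / (1 + (norm x)\<^sup>2) powr ((real CARD('n) + 1) / 2) > 0"
  proof (intro divide_pos_pos)
    have "1 + (norm x)\<^sup>2 > 0" by (simp add: add_pos_nonneg)
    then show "(1 + (norm x)\<^sup>2) powr ((real CARD('n) + 1) / 2) > 0" by simp
  qed (auto intro!: Gamma_real_pos)
  with 1 show "alpha CARD('n) M x > 0" by linarith
qed

text \<open>\<open>alpha\<close> involves tangent spaces, whose dependence on the point is not
  explicit. In a chart it is the slice density divided by the Gram root, both measurable, and
  countably many charts cover \<open>M\<close>.\<close>

lemma borel_measurable_alpha:
  fixes M :: "(real ^ 'N) set"
  assumes M: "algebraic_manifold CARD('n::finite) M"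
  shows "alpha CARD('n) M \<in> borel_measurable (restrict_space borel M)"
proof -
  obtain U :: "nat \<Rightarrow> (real ^ 'n) set" and \<phi> J C where
    a: "\<And>i. local_parametrization M (U i) (\<phi> i) (J i)" "\<And>i. C i \<in> sets (restrict_space borel M)"
    "\<And>i. C i \<subseteq> \<phi> i ` U i" "disjoint_family C" "(\<Union>i. C i) = M"
    by (rule disjoint_chart_cover[OF M]) (rule that; assumption)
  show ?thesis
  proof (rule measurableI)
    fix S :: "real set" assume S: "S \<in> sets borel"
    have "\<exists>D. D \<in> sets borel \<and> D \<subseteq> U i \<and> alpha CARD('n) M -` S \<inter> \<phi> i ` U i = \<phi> i ` D" for i
    proof -
      note L = local_parametrizationD[OF a(1)[of i]]
      let ?d = "\<lambda>u. enn2real (slice_density (\<phi> i) (J i) u * indicator (U i) u) / (indicator (U i) u *\<^sub>R sqrt (det (transpose (J i u) ** J i u)))"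
      have "continuous_on (U i) (\<lambda>u. transpose (J i u))"
        unfolding transpose_def by (intro continuous_on_vec_lambda continuous_intros L(6))
      then have "continuous_on (U i) (\<lambda>u. sqrt (det (transpose (J i u) ** J i u)))"
        by (intro continuous_intros L(6))
      then have m: "(\<lambda>u. indicator (U i) u *\<^sub>R sqrt (det (transpose (J i u) ** J i u))) \<in> borel_measurable borel"
        using L(1) by (intro borel_measurable_continuous_on_indicator) auto
      have dm: "?d \<in> borel_measurable borel"
        using m borel_measurable_slice_density[OF a(1)[of i]] by measurable
      have d: "?d u = alpha CARD('n) M (\<phi> i u)" if u: "u \<in> U i" for u
      proof -
        have "det (transpose (J i u) ** J i u) > 0" using gram_det_pos[OF L(8)[OF u]] .
        moreover have "alpha CARD('n) M (\<phi> i u) > 0" using L(3) u by (intro alpha_lower_bound(2)[OF M]) blast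
        ultimately show ?thesis using u by (simp add: slice_density_eq_alpha(1)[OF M a(1) u])
      qed
      let ?D = "?d -` S \<inter> U i"
      have "?d -` S \<in> sets borel" using measurable_sets[OF dm S] by simp
      then have "?D \<in> sets borel" using L(1) by auto
      moreover have "alpha CARD('n) M -` S \<inter> \<phi> i ` U i = \<phi> i ` ?D"
      proof (intro equalityI subsetI)
        fix x assume "x \<in> alpha CARD('n) M -` S \<inter> \<phi> i ` U i"
        then obtain u where u: "u \<in> U i" "x = \<phi> i u" "alpha CARD('n) M (\<phi> i u) \<in> S" by blast
        then have "u \<in> ?D" using d[OF u(1)] by (simp only: vimage_def) simp
        then show "x \<in> \<phi> i ` ?D" using u(2) by blast
      next
        fix x assume "x \<in> \<phi> i ` ?D"
        then obtain u where u: "u \<in> U i" "x = \<phi> i u" "?d u \<in> S" by blast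
        then have "alpha CARD('n) M x \<in> S" using d[OF u(1)] by simp
        then show "x \<in> alpha CARD('n) M -` S \<inter> \<phi> i ` U i" using u by blast
      qed
      ultimately show ?thesis by blast
    qed
    then have s: "alpha CARD('n) M -` S \<inter> \<phi> i ` U i \<in> sets (restrict_space borel M)" for i
      using chart_image_sets[OF a(1)] by metis
    have "alpha CARD('n) M -` S \<inter> M = (\<Union>i. (alpha CARD('n) M -` S \<inter> \<phi> i ` U i) \<inter> C i)"
      using a(3,5) by blast
    moreover have "\<dots> \<in> sets (restrict_space borel M)" using s a(2) by (intro sets.countable_UN sets.Int) auto
    ultimately show "alpha CARD('n) M -` S \<inter> space (restrict_space borel M) \<in> sets (restrict_space borel M)"
      by (simp add: space_restrict_space)
  qed simp
qed

lemma emeasure_slice_measure_chart: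
  fixes M :: "(real ^ 'N) set" and J :: "real ^ 'n \<Rightarrow> real ^ 'n ^ 'N"
  assumes M: "algebraic_manifold CARD('n) M" and lp: "local_parametrization M U \<phi> J"
    and B: "B \<in> sets (restrict_space borel M)" "B \<subseteq> \<phi> ` U"
  shows "emeasure (slice_measure TYPE('n) M) B = (\<integral>\<^sup>+u. slice_density \<phi> J u * indicator {u\<in>U. \<phi> u \<in> B} u \<partial>lborel)"
  unfolding emeasure_slice_measure[OF M B(1)] by (rule slice_count_in_chart(2)[OF lp B])

text \<open>Restricted to \<open>B\<close>, the measure is the image under the chart of Lebesgue
  measure with density \<open>slice_density\<close>; this extends the formula from sets to
  functions.\<close>

lemma nn_integral_slice_measure_chart:
  fixes M :: "(real ^ 'N) set" and J :: "real ^ 'n \<Rightarrow> real ^ 'n ^ 'N"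
  assumes M: "algebraic_manifold CARD('n) M" and lp: "local_parametrization M U \<phi> J"
    and B: "B \<in> sets (restrict_space borel M)" "B \<subseteq> \<phi> ` U"
    and g: "g \<in> borel_measurable (restrict_space borel M)"
  shows "(\<integral>\<^sup>+x. g x * indicator B x \<partial>slice_measure TYPE('n) M)
    = (\<integral>\<^sup>+u. g (\<phi> u) * slice_density \<phi> J u * indicator {u\<in>U. \<phi> u \<in> B} u \<partial>lborel)"
proof (cases "B = {}")
  case False
  let ?S = "restrict_space borel M :: (real ^ 'N) measure"
  let ?\<nu> = "slice_measure TYPE('n) M"
  let ?B = "{u\<in>U. \<phi> u \<in> B}"
  note L = local_parametrizationD[OF lp]
  obtain x0 where x0: "x0 \<in> B" using False by blast
  have BM: "B \<subseteq> M" using B(2) L(3) by blast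
  have Bb: "?B \<in> sets borel" by (rule chart_preimage_sets[OF lp B(1)])
  \<comment> \<open>The chart is extended by a point of \<open>B\<close> to a map of the whole
    parameter space into \<open>M\<close>, and the density vanishes on the added part. The empty
    \<open>B\<close> is split off because it has no such point.\<close>
  define \<phi>0 where "\<phi>0 u = (if u \<in> U then \<phi> u else x0)" for u
  have "\<phi>0 \<in> borel_measurable borel"
    unfolding \<phi>0_def[abs_def] using L(1) by (intro borel_measurable_continuous_on_if L(7)) auto
  then have \<phi>0: "\<phi>0 \<in> borel \<rightarrow>\<^sub>M ?S"
    using L(3) x0 BM by (intro measurable_restrict_space2) (force simp: \<phi>0_def)+
  let ?d = "\<lambda>u. slice_density \<phi> J u * indicator ?B u"
  have d: "?d \<in> borel_measurable borel"
  proof -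
    have "(\<lambda>u. slice_density \<phi> J u * indicator U u * indicator ?B u) \<in> borel_measurable borel"
      by (rule borel_measurable_times_ennreal[OF borel_measurable_slice_density[OF lp] borel_measurable_indicator]) (simp add: Bb)
    moreover have "(\<lambda>u. slice_density \<phi> J u * indicator U u * indicator ?B u) = ?d"
      by (auto simp: fun_eq_iff indicator_def)
    ultimately show ?thesis by simp
  qed
  have iB: "indicator B \<in> borel_measurable ?\<nu>" by (rule borel_measurable_indicator) (simp add: B(1))
  have eq: "density ?\<nu> (indicator B) = distr (density lborel ?d) ?S \<phi>0"
  proof (rule measure_eqI)
    fix A assume "A \<in> sets (density ?\<nu> (indicator B))"
    then have A: "A \<in> sets ?S" by simp
    have AB: "A \<inter> B \<in> sets ?S" using A B(1) by auto
    have "emeasure (density ?\<nu> (indicator B)) A = (\<integral>\<^sup>+x. indicator B x * indicator A x \<partial>?\<nu>)"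
      using A by (intro emeasure_density iB) simp
    also have "\<dots> = (\<integral>\<^sup>+x. indicator (A \<inter> B) x \<partial>?\<nu>)"
      by (intro nn_integral_cong) (auto simp: indicator_def)
    also have "\<dots> = emeasure ?\<nu> (A \<inter> B)" using AB by (intro nn_integral_indicator) simp
    also have "\<dots> = (\<integral>\<^sup>+u. slice_density \<phi> J u * indicator {u\<in>U. \<phi> u \<in> A \<inter> B} u \<partial>lborel)"
      using B(2) by (intro emeasure_slice_measure_chart[OF M lp AB]) auto
    also have "\<dots> = (\<integral>\<^sup>+u. ?d u * indicator (\<phi>0 -` A) u \<partial>lborel)"
      by (intro nn_integral_cong) (auto simp: indicator_def \<phi>0_def)
    also have "\<dots> = emeasure (density lborel ?d) (\<phi>0 -` A)"
      using d measurable_sets[OF \<phi>0 A] by (intro emeasure_density[symmetric]) auto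
    also have "\<dots> = emeasure (distr (density lborel ?d) ?S \<phi>0) A"
      using \<phi>0 A by (subst emeasure_distr) (auto cong: measurable_cong_sets)
    finally show "emeasure (density ?\<nu> (indicator B)) A = emeasure (distr (density lborel ?d) ?S \<phi>0) A" .
  qed simp
  have "(\<integral>\<^sup>+x. g x * indicator B x \<partial>?\<nu>) = (\<integral>\<^sup>+x. g x \<partial>density ?\<nu> (indicator B))"
    using g B(1) by (subst nn_integral_density) (auto simp: mult.commute cong: measurable_cong_sets)
  also have "\<dots> = (\<integral>\<^sup>+u. g (\<phi>0 u) \<partial>density lborel ?d)"
    unfolding eq using \<phi>0 g by (intro nn_integral_distr) (auto cong: measurable_cong_sets)
  also have "\<dots> = (\<integral>\<^sup>+u. ?d u * g (\<phi>0 u) \<partial>lborel)"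
    using d measurable_compose[OF \<phi>0 g] by (intro nn_integral_density) auto
  also have "\<dots> = (\<integral>\<^sup>+u. g (\<phi> u) * slice_density \<phi> J u * indicator ?B u \<partial>lborel)"
    by (intro nn_integral_cong) (auto simp: indicator_def \<phi>0_def mult.commute)
  finally show ?thesis .
qed simp

text \<open>Every Borel set splits into countably many pieces, each inside one chart, where the
  defining formula prescribes the measure.\<close>

lemma volume_measure_unique:
  fixes M :: "(real ^ 'N) set"
  assumes M: "algebraic_manifold CARD('n::finite) M"
    and \<mu>: "is_volume_measure TYPE('n) M \<mu>" and \<nu>: "is_volume_measure TYPE('n) M \<nu>"
  shows "\<mu> = \<nu>"
proof (rule measure_eqI)
  have s: "sets \<mu> = sets (restrict_space borel M)" "sets \<nu> = sets (restrict_space borel M)"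
    using \<mu> \<nu> by (auto simp: is_volume_measure_def)
  show "sets \<mu> = sets \<nu>" using s by simp
  fix B assume "B \<in> sets \<mu>"
  then have B: "B \<in> sets (restrict_space borel M)" using s by simp
  obtain U :: "nat \<Rightarrow> (real ^ 'n) set" and \<phi> J C where
    a: "\<And>i. local_parametrization M (U i) (\<phi> i) (J i)" "\<And>i. C i \<in> sets (restrict_space borel M)"
    "\<And>i. C i \<subseteq> \<phi> i ` U i" "disjoint_family C" "(\<Union>i. C i) = M"
    by (rule disjoint_chart_cover[OF M]) (rule that; assumption)
  have BM: "B \<subseteq> M" using B sets.sets_into_space[of B "restrict_space borel M"] by (simp add: space_restrict_space)
  have BC: "B \<inter> C i \<in> sets (restrict_space borel M)" for i using B a(2) by auto
  have dj: "disjoint_family (\<lambda>i. B \<inter> C i)" using a(4) by (fastforce simp: disjoint_family_on_def)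
  have un: "(\<Union>i. B \<inter> C i) = B" using BM a(5) by blast
  have eq: "emeasure \<mu> (B \<inter> C i) = emeasure \<nu> (B \<inter> C i)" for i
  proof -
    have sub: "B \<inter> C i \<subseteq> \<phi> i ` U i" using a(3) by blast
    have 1: "\<forall>D\<in>sets \<mu>. D \<subseteq> \<phi> i ` U i \<longrightarrow> emeasure \<mu> D = (\<integral>\<^sup>+u. ennreal (sqrt (det (transpose (J i u) ** J i u))) * indicator {u\<in>U i. \<phi> i u \<in> D} u \<partial>lborel)"
      using \<mu> a(1)[of i] unfolding is_volume_measure_def by blast
    have 2: "\<forall>D\<in>sets \<nu>. D \<subseteq> \<phi> i ` U i \<longrightarrow> emeasure \<nu> D = (\<integral>\<^sup>+u. ennreal (sqrt (det (transpose (J i u) ** J i u))) * indicator {u\<in>U i. \<phi> i u \<in> D} u \<partial>lborel)"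
      using \<nu> a(1)[of i] unfolding is_volume_measure_def by blast
    show ?thesis using 1 2 sub BC[of i] s by simp
  qed
  have "emeasure \<mu> B = (\<Sum>i. emeasure \<mu> (B \<inter> C i))"
    using suminf_emeasure[OF _ dj, of \<mu>] BC s(1) un by (simp add: image_subset_iff)
  also have "\<dots> = (\<Sum>i. emeasure \<nu> (B \<inter> C i))" by (simp add: eq)
  also have "\<dots> = emeasure \<nu> B"
    using suminf_emeasure[OF _ dj, of \<nu>] BC s(2) un by (simp add: image_subset_iff)
  finally show "emeasure \<mu> B = emeasure \<nu> B" .
qed

text \<open>The kinematic formula identifies the volume measure; in particular it proves that one exists.\<close>

lemma volume_measure_eq:
  fixes M :: "(real ^ 'N) set"
  assumes M: "algebraic_manifold CARD('n::finite) M"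
  shows "volume_measure TYPE('n) M = completion (density (slice_measure TYPE('n) M) (\<lambda>x. ennreal (1 / alpha CARD('n) M x)))"
proof -
  let ?\<nu> = "slice_measure TYPE('n) M"
  let ?\<mu> = "density ?\<nu> (\<lambda>x. ennreal (1 / alpha CARD('n) M x))"
  have am: "(\<lambda>x. ennreal (1 / alpha CARD('n) M x)) \<in> borel_measurable (restrict_space borel M)"
    using borel_measurable_alpha[OF M] by measurable
  have "is_volume_measure TYPE('n) M ?\<mu>"
    unfolding is_volume_measure_def
  proof (intro conjI allI impI ballI)
    show "space ?\<mu> = M" "sets ?\<mu> = sets (restrict_space borel M)" by simp_all
    fix U :: "(real ^ 'n) set" and \<phi> J B
    assume lp: "local_parametrization M U \<phi> J" and "B \<in> sets ?\<mu>" and sub: "B \<subseteq> \<phi> ` U"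
    then have B: "B \<in> sets (restrict_space borel M)" by simp
    have "emeasure ?\<mu> B = (\<integral>\<^sup>+x. ennreal (1 / alpha CARD('n) M x) * indicator B x \<partial>?\<nu>)"
      using am B by (intro emeasure_density) (auto cong: measurable_cong_sets)
    also have "\<dots> = (\<integral>\<^sup>+u. ennreal (1 / alpha CARD('n) M (\<phi> u)) * slice_density \<phi> J u * indicator {u\<in>U. \<phi> u \<in> B} u \<partial>lborel)"
      by (rule nn_integral_slice_measure_chart[OF M lp B sub am])
    also have "\<dots> = (\<integral>\<^sup>+u. ennreal (sqrt (det (transpose (J u) ** J u))) * indicator {u\<in>U. \<phi> u \<in> B} u \<partial>lborel)"
    proof (rule nn_integral_cong)
      fix u
      show "ennreal (1 / alpha CARD('n) M (\<phi> u)) * slice_density \<phi> J u * indicator {u\<in>U. \<phi> u \<in> B} u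
        = ennreal (sqrt (det (transpose (J u) ** J u))) * indicator {u\<in>U. \<phi> u \<in> B} u"
      proof (cases "u \<in> U")
        case True
        have "\<phi> u \<in> M" using local_parametrizationD(3)[OF lp] True by blast
        then have "alpha CARD('n) M (\<phi> u) > 0" by (rule alpha_lower_bound(2)[OF M])
        then have "ennreal (1 / alpha CARD('n) M (\<phi> u)) * slice_density \<phi> J u = ennreal (sqrt (det (transpose (J u) ** J u)))"
          unfolding slice_density_eq_alpha(1)[OF M lp True] by (subst ennreal_mult'[symmetric]) auto
        then show ?thesis by simp
      qed simp
    qed
    finally show "emeasure ?\<mu> B = (\<integral>\<^sup>+u. ennreal (sqrt (det (transpose (J u) ** J u))) * indicator {u\<in>U. \<phi> u \<in> B} u \<partial>lborel)" .
  qed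
  then have "(THE \<mu>. is_volume_measure TYPE('n) M \<mu>) = ?\<mu>"
    using volume_measure_unique[OF M] by (intro the_equality) auto
  then show ?thesis by (simp add: volume_measure_def)
qed

section \<open>Finiteness of generic slices\<close>

text \<open>
  A point of \<open>M\<close> at which the slice is transversal is a nondegenerate common zero of the generators
  of the vanishing ideal and the \<open>n\<close> affine equations.
\<close>

lemma AE_finite_slices:
  fixes M :: "(real ^ 'N) set"
  assumes M: "algebraic_manifold CARD('n) M"
  shows "\<exists>K. AE \<omega> :: (real ^ 'N ^ 'n) \<times> (real ^ 'n) in gauss. finite (M \<inter> affine_slice \<omega>) \<and> card (M \<inter> affine_slice \<omega>) \<le> K"
proof -
  obtain V Ob where V: "open Ob" "M = nonsingular_points V \<inter> Ob" "M \<subseteq> V" "\<And>x. x \<in> M \<Longrightarrow> nonsingular_of_dim CARD('n) V x"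
    by (rule algebraic_manifold_varietyE[OF M]) (rule that; assumption)
  obtain G :: "(real ^ 'N \<Rightarrow> real) set" where G: "finite G" "\<And>g. g \<in> G \<Longrightarrow> real_polynomial_function g"
    "\<And>g x. g \<in> G \<Longrightarrow> x \<in> V \<Longrightarrow> g x = 0"
    "\<And>p x v. real_polynomial_function p \<Longrightarrow> (\<And>y. y \<in> V \<Longrightarrow> p y = 0) \<Longrightarrow> x \<in> V \<Longrightarrow>
       (\<And>g. g \<in> G \<Longrightarrow> grad g x \<bullet> v = 0) \<Longrightarrow> grad p x \<bullet> v = 0"
    apply (rule finite_gradient_generators[of V])
    subgoal premises p for G by (rule that) (fact p)+
    done
  have "\<forall>g\<in>G. \<exists>K. deg_le K g" using G(2) real_polynomial_deg_le by blast
  from bchoice[OF this] obtain Kg where Kg: "\<And>g. g \<in> G \<Longrightarrow> deg_le (Kg g) g" by blast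
  \<comment> \<open>The inserted 1 covers the affine equations.\<close>
  define d where "d = Max (insert 1 (Kg ` G))"
  have dg: "Kg g \<le> d" if "g \<in> G" for g
    using G(1) that by (auto simp: d_def intro!: Max_ge)
  have d1': "1 \<le> d" using G(1) by (auto simp: d_def intro!: Max_ge)
  obtain U :: "nat \<Rightarrow> (real ^ 'n) set" and \<phi> J where
    a: "\<And>i. local_parametrization M (U i) (\<phi> i) (J i)" "(\<Union>i. \<phi> i ` U i) = M"
    by (rule countable_atlas[OF M]) (rule that; assumption)
  let ?K = "(card G + CARD('n)) ^ CARD('N) * ((1 + CARD('N) * d) ^ CARD('N)) ^ CARD('N)"
  have ae: "AE \<omega> in gauss. \<forall>i. \<omega> \<notin> slice_map (\<phi> i) ` slice_critical (U i) (J i)"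
    unfolding AE_all_countable by (intro allI AE_gauss_of_null_lborel slice_critical_null[OF a(1)])
  have "finite (M \<inter> affine_slice \<omega>) \<and> card (M \<inter> affine_slice \<omega>) \<le> ?K"
    if \<omega>: "\<forall>i. \<omega> \<notin> slice_map (\<phi> i) ` slice_critical (U i) (J i)" for \<omega> :: "(real ^ 'N ^ 'n) \<times> (real ^ 'n)"
  proof -
    define A b where "A = fst \<omega>" and "b = snd \<omega>"
    define h where "h j y = (A *v y) $ j - b $ j" for j and y :: "real ^ 'N"
    let ?Q = "G \<union> range h"
    have blh: "bounded_linear (\<lambda>y. (A *v y) $ j)" for j
      using bounded_linear_compose[OF bounded_linear_vec_nth matrix_vector_mul_bounded_linear] .
    have rph: "real_polynomial_function (h j)" for j
      unfolding h_def[abs_def] by (intro real_polynomial_function_diff real_polynomial_function.intros(1,2) blh)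
    have degh: "deg_le d (h j)" for j
    proof -
      have "deg_le 1 (\<lambda>y. (A *v y) $ j + (- b $ j))"
        by (intro deg_le_add deg_le_const deg_le_linear bounded_linear.linear[OF blh])
      then show ?thesis using deg_le_mono[OF _ d1'] by (simp add: h_def[abs_def])
    qed
    have gradh: "grad (h j) x \<bullet> v = (A *v v) $ j" for j x v
    proof -
      have "(h j has_derivative (\<lambda>v. (A *v v) $ j)) (at x)"
        unfolding h_def[abs_def] using bounded_linear_imp_has_derivative[OF blh]
        by (auto intro!: derivative_eq_intros)
      from has_derivative_unique[OF this polynomial_has_derivative[OF rph]]
      show ?thesis by (metis)
    qed
    let ?Z = "{x. (\<forall>q\<in>?Q. q x = 0) \<and> (\<forall>v. (\<forall>q\<in>?Q. grad q x \<bullet> v = 0) \<longrightarrow> v = 0)}"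
    have Q: "finite ?Q" using G(1) by simp
    have Z: "finite ?Z \<and> card ?Z \<le> card ?Q ^ CARD('N) * ((1 + CARD('N) * d) ^ CARD('N)) ^ CARD('N)"
    proof (rule finite_common_nondegenerate_zeros[OF Q])
      show "real_polynomial_function q" if "q \<in> ?Q" for q using that G(2) rph by blast
      show "deg_le d q" if "q \<in> ?Q" for q using that degh deg_le_mono[OF Kg dg] by blast
    qed
    have "card ?Q \<le> card G + card (range h)" by (rule card_Un_le)
    also have "\<dots> \<le> card G + CARD('n)" using card_image_le[of UNIV h] by simp
    finally have cQ: "card ?Q ^ CARD('N) \<le> (card G + CARD('n)) ^ CARD('N)" by (intro power_mono) auto
    have sub: "M \<inter> affine_slice \<omega> \<subseteq> ?Z"
    proof
      fix x assume x: "x \<in> M \<inter> affine_slice \<omega>"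
      have xV: "x \<in> V" using x V(3) by blast
      have Axb: "A *v x = b" using x by (simp add: affine_slice_iff A_def b_def)
      obtain i u where u: "u \<in> U i" "x = \<phi> i u" using x a(2) by blast
      have det: "det (A ** J i u) \<noteq> 0"
      proof
        assume "det (A ** J i u) = 0"
        then have "(A, u) \<in> slice_critical (U i) (J i)" using u(1) by (simp add: slice_critical_def)
        moreover have "\<omega> = slice_map (\<phi> i) (A, u)"
          using Axb u(2) by (simp add: slice_map_def prod_eq_iff A_def b_def)
        ultimately show False using \<omega> by blast
      qed
      \<comment> \<open>The generators force \<open>v\<close> into the tangent space, so
        \<open>v = J i u *v w\<close> for some \<open>w\<close>; the affine equations give
        \<open>A *v v = 0\<close>, and transversality leaves only \<open>w = 0\<close>.\<close>
      have "v = 0" if v: "\<forall>q\<in>?Q. grad q x \<bullet> v = 0" for v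
      proof -
        have ns: "nonsingular_of_dim CARD('n) V (\<phi> i u)" using V(4) x u(2) by simp
        obtain k p W where p: "k + CARD('n) = CARD('N)" "\<And>i. i < k \<Longrightarrow> real_polynomial_function (p i)"
          "\<And>i y. i < k \<Longrightarrow> y \<in> V \<Longrightarrow> p i y = 0" "open W" "\<phi> i u \<in> W" "V \<inter> W = {y. \<forall>i<k. p i y = 0} \<inter> W"
          "inj_on (\<lambda>j. grad (p j) (\<phi> i u)) {..<k}" "independent ((\<lambda>j. grad (p j) (\<phi> i u)) ` {..<k})"
          by (rule nonsingular_of_dim_gradE[OF ns]) (rule that; assumption)
        have pM: "p i y = 0" if "i < k" "y \<in> M" for i y using p(3)[OF that(1)] V(3) that(2) by blast
        have "grad (p j) x \<bullet> v = 0" if j: "j < k" for j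
          by (rule G(4)[OF p(2)[OF j] p(3)[OF j] xV]) (use v in auto)
        then have "v \<in> grad_kernel k p (\<phi> i u)" using u(2) by (simp add: grad_kernel_def)
        then have "v \<in> range ((*v) (J i u))"
          using tangent_space_local_parametrization(2)[OF a(1) u(1) p(1,2) pM p(7,8)] by simp
        then obtain w where w: "v = J i u *v w" by blast
        have "(A *v v) $ j = 0" for j using v gradh[of j x v] by auto
        then have "A *v v = 0" by (simp add: vec_eq_iff)
        then have "(A ** J i u) *v w = 0" by (simp add: w matrix_vector_mul_assoc)
        moreover have "invertible (A ** J i u)" using det by (simp add: invertible_det_nz)
        ultimately have "w = 0" unfolding invertible_left_inverse matrix_left_invertible_ker by blast
        then show "v = 0" by (simp add: w)
      qed
      moreover have "q x = 0" if "q \<in> ?Q" for q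
        using that G(3) xV Axb by (auto simp: h_def)
      ultimately show "x \<in> ?Z" by blast
    qed
    have "finite (M \<inter> affine_slice \<omega>)" using sub Z finite_subset by blast
    moreover have "card (M \<inter> affine_slice \<omega>) \<le> card ?Z" using sub Z card_mono by blast
    ultimately show ?thesis using Z mult_le_mono1[OF cQ] by (meson order_trans)
  qed
  then have "AE \<omega> :: (real ^ 'N ^ 'n) \<times> (real ^ 'n) in gauss. finite (M \<inter> affine_slice \<omega>) \<and> card (M \<inter> affine_slice \<omega>) \<le> ?K"
    using ae by (auto elim: eventually_mono)
  then show ?thesis by blast
qed

section \<open>Chebyshev's inequality for independent samples\<close>

text \<open>After expanding the square, each mixed term factors over the product measure and
  contains the mean of \<open>Y\<close>, which is 0.\<close>

lemma second_moment_sum_PiM: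
  fixes Y :: "'a \<Rightarrow> real"
  assumes P: "prob_space P" and I: "finite I"
    and Y: "integrable P Y" "integrable P (\<lambda>x. (Y x)\<^sup>2)" "(\<integral>x. Y x \<partial>P) = 0"
  shows "integrable (PiM I (\<lambda>_. P)) (\<lambda>\<omega>. (\<Sum>i\<in>I. Y (\<omega> i))\<^sup>2)"
    "(\<integral>\<omega>. (\<Sum>i\<in>I. Y (\<omega> i))\<^sup>2 \<partial>PiM I (\<lambda>_. P)) = real (card I) * (\<integral>x. (Y x)\<^sup>2 \<partial>P)"
proof -
  interpret P: prob_space P by fact
  interpret S: product_sigma_finite "\<lambda>_. P"
    by (simp add: product_sigma_finite_def P.sigma_finite_measure_axioms)
  \<comment> \<open>The factor of \<open>Y (\<omega> i) * Y (\<omega> j)\<close> in coordinate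
    \<open>l\<close>, padded with 1 so that the product runs over all of \<open>I\<close> and
    integrates factor by factor.\<close>
  define f where "f i j l x = (if l = i then (if l = j then (Y x)\<^sup>2 else Y x) else if l = j then Y x else 1)" for i j l :: 'b and x
  have fint: "integrable P (f i j l)" for i j l
    unfolding f_def[abs_def] using Y by (cases "l = i"; cases "l = j") auto
  have prod: "Y (\<omega> i) * Y (\<omega> j) = (\<Prod>l\<in>I. f i j l (\<omega> l))" if "i \<in> I" "j \<in> I" for i j \<omega>
  proof (cases "i = j")
    case True
    have "(\<Prod>l\<in>I. f i j l (\<omega> l)) = f i j i (\<omega> i) * (\<Prod>l\<in>I - {i}. f i j l (\<omega> l))"
      using I that by (intro prod.remove) auto
    also have "(\<Prod>l\<in>I - {i}. f i j l (\<omega> l)) = 1" by (rule prod.neutral) (auto simp: f_def True)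
    finally show ?thesis using True by (simp add: f_def power2_eq_square)
  next
    case False
    have "(\<Prod>l\<in>I. f i j l (\<omega> l)) = f i j i (\<omega> i) * (\<Prod>l\<in>I - {i}. f i j l (\<omega> l))"
      using I that by (intro prod.remove) auto
    also have "(\<Prod>l\<in>I - {i}. f i j l (\<omega> l)) = f i j j (\<omega> j) * (\<Prod>l\<in>I - {i} - {j}. f i j l (\<omega> l))"
      using I that False by (intro prod.remove) auto
    also have "(\<Prod>l\<in>I - {i} - {j}. f i j l (\<omega> l)) = 1" by (rule prod.neutral) (auto simp: f_def)
    finally show ?thesis using False by (simp add: f_def)
  qed
  have int: "integrable (PiM I (\<lambda>_. P)) (\<lambda>\<omega>. Y (\<omega> i) * Y (\<omega> j))" if "i \<in> I" "j \<in> I" for i j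
    unfolding prod[OF that] by (rule S.product_integrable_prod[OF I fint])
  have val: "(\<integral>\<omega>. Y (\<omega> i) * Y (\<omega> j) \<partial>PiM I (\<lambda>_. P)) = (if i = j then (\<integral>x. (Y x)\<^sup>2 \<partial>P) else 0)" if "i \<in> I" "j \<in> I" for i j
  proof -
    have "(\<integral>\<omega>. Y (\<omega> i) * Y (\<omega> j) \<partial>PiM I (\<lambda>_. P)) = (\<Prod>l\<in>I. \<integral>x. f i j l x \<partial>P)"
      unfolding prod[OF that] by (rule S.product_integral_prod[OF I fint])
    also have "\<dots> = (\<integral>x. f i j i x \<partial>P) * (\<Prod>l\<in>I - {i}. \<integral>x. f i j l x \<partial>P)"
      using I that by (intro prod.remove) auto
    also have "\<dots> = (if i = j then (\<integral>x. (Y x)\<^sup>2 \<partial>P) else 0)"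
    proof (cases "i = j")
      case True
      have "(\<Prod>l\<in>I - {i}. \<integral>x. f i j l x \<partial>P) = 1"
        by (rule prod.neutral) (auto simp: f_def True P.prob_space)
      then show ?thesis using True by (simp add: f_def)
    qed (simp add: f_def Y(3))
    finally show ?thesis .
  qed
  have sq: "(\<Sum>i\<in>I. Y (\<omega> i))\<^sup>2 = (\<Sum>i\<in>I. \<Sum>j\<in>I. Y (\<omega> i) * Y (\<omega> j))" for \<omega>
    by (simp add: power2_eq_square sum_product)
  show "integrable (PiM I (\<lambda>_. P)) (\<lambda>\<omega>. (\<Sum>i\<in>I. Y (\<omega> i))\<^sup>2)"
    unfolding sq by (intro Bochner_Integration.integrable_sum int)
  have "(\<integral>\<omega>. (\<Sum>i\<in>I. Y (\<omega> i))\<^sup>2 \<partial>PiM I (\<lambda>_. P)) = (\<Sum>i\<in>I. \<Sum>j\<in>I. if i = j then (\<integral>x. (Y x)\<^sup>2 \<partial>P) else 0)"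
    unfolding sq using int val by (simp add: Bochner_Integration.integral_sum)
  also have "\<dots> = real (card I) * (\<integral>x. (Y x)\<^sup>2 \<partial>P)" using I by simp
  finally show "(\<integral>\<omega>. (\<Sum>i\<in>I. Y (\<omega> i))\<^sup>2 \<partial>PiM I (\<lambda>_. P)) = real (card I) * (\<integral>x. (Y x)\<^sup>2 \<partial>P)" .
qed

text \<open>Markov's inequality for the squared centered sum, whose mean is \<open>real k\<close>
  times the variance; division by the square of \<open>\<epsilon> * real k\<close> leaves one factor
  \<open>real k\<close> in the denominator.\<close>

lemma Chebyshev_empirical_mean:
  fixes X :: "'a \<Rightarrow> real"
  assumes P: "prob_space P" and X: "integrable P X" "integrable P (\<lambda>x. (X x - (\<integral>x. X x \<partial>P))\<^sup>2)"
    and e: "\<epsilon> > 0" and k: "k > (0 :: nat)"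
  shows "\<P>(\<omega> in PiM {1..k} (\<lambda>_. P). \<bar>(\<Sum>i=1..k. X (\<omega> i)) / real k - (\<integral>x. X x \<partial>P)\<bar> \<ge> \<epsilon>)
    \<le> prob_space.variance P X / (\<epsilon>\<^sup>2 * real k)"
proof -
  interpret P: prob_space P by fact
  let ?m = "\<integral>x. X x \<partial>P"
  let ?Q = "PiM {1..k} (\<lambda>_. P)"
  interpret Q: prob_space ?Q by (intro prob_space_PiM P)
  define Y where "Y x = X x - ?m" for x
  have Y: "integrable P Y" "integrable P (\<lambda>x. (Y x)\<^sup>2)" "(\<integral>x. Y x \<partial>P) = 0"
    using X by (auto simp: Y_def[abs_def] P.prob_space)
  note sm = second_moment_sum_PiM[OF P finite_atLeastAtMost[of 1 k] Y]
  let ?g = "\<lambda>\<omega>. (\<Sum>i=1..k. Y (\<omega> i))\<^sup>2"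
  have iff: "\<bar>(\<Sum>i=1..k. X (\<omega> i)) / real k - ?m\<bar> \<ge> \<epsilon> \<longleftrightarrow> (\<epsilon> * real k)\<^sup>2 \<le> ?g \<omega>" for \<omega>
  proof -
    have "(\<Sum>i=1..k. X (\<omega> i)) / real k - ?m = (\<Sum>i=1..k. Y (\<omega> i)) / real k"
      using k by (simp add: Y_def sum_subtractf field_simps)
    then have "\<bar>(\<Sum>i=1..k. X (\<omega> i)) / real k - ?m\<bar> \<ge> \<epsilon> \<longleftrightarrow> \<epsilon> * real k \<le> \<bar>\<Sum>i=1..k. Y (\<omega> i)\<bar>"
      using k by (simp add: field_simps)
    also have "\<dots> \<longleftrightarrow> (\<epsilon> * real k)\<^sup>2 \<le> \<bar>\<Sum>i=1..k. Y (\<omega> i)\<bar>\<^sup>2"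
      using e k by (intro power_mono_iff[symmetric]) auto
    finally show ?thesis by simp
  qed
  have pos: "(\<epsilon> * real k)\<^sup>2 > 0" using e k by simp
  have "\<P>(\<omega> in ?Q. (\<epsilon> * real k)\<^sup>2 \<le> ?g \<omega>) \<le> (\<integral>\<omega>. ?g \<omega> \<partial>?Q) / (\<epsilon> * real k)\<^sup>2"
    using sm(1) pos by (intro integral_Markov_inequality_measure[where A = "space ?Q"]) auto
  also have "(\<integral>\<omega>. ?g \<omega> \<partial>?Q) / (\<epsilon> * real k)\<^sup>2 = prob_space.variance P X / (\<epsilon>\<^sup>2 * real k)"
    unfolding sm(2) using k by (simp add: Y_def power2_eq_square field_simps)
  finally show ?thesis unfolding iff .
qed

section \<open>Moments of \<open>f_bar\<close> and the final estimate\<close>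

lemma f_bar_moments:
  fixes M :: "(real ^ 'N) set" and f :: "real ^ 'N \<Rightarrow> real"
  defines "P \<equiv> gaussian_measure :: ((real ^ 'N ^ 'n) \<times> (real ^ 'n)) measure"
  assumes M: "algebraic_manifold CARD('n) M" and nonneg: "\<forall>x\<in>M. 0 \<le> f x"
    and int: "integrable (volume_measure TYPE('n) M) f" and bf: "bounded (f ` M)" and bM: "bounded M"
  shows "f_bar M f \<in> borel_measurable P"
    "\<exists>C. AE \<omega> in P. \<bar>f_bar M f \<omega>\<bar> \<le> C"
    "(\<integral>\<omega>. f_bar M f \<omega> \<partial>P) = (\<integral>x. f x \<partial>volume_measure TYPE('n) M)"
proof -
  let ?\<nu> = "slice_measure TYPE('n) M"
  let ?\<alpha> = "alpha CARD('n) M"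
  define w where "w x = ennreal (1 / ?\<alpha> x)" for x
  let ?\<mu> = "density ?\<nu> w"
  have vol: "volume_measure TYPE('n) M = completion ?\<mu>"
    unfolding volume_measure_eq[OF M] w_def[abs_def] ..
  have P: "P = completion gauss" unfolding P_def by (rule gaussian_measure_eq)
  have am: "?\<alpha> \<in> borel_measurable ?\<nu>"
    using borel_measurable_alpha[OF M] by (simp cong: measurable_cong_sets)
  have wm: "w \<in> borel_measurable ?\<nu>" unfolding w_def[abs_def] using am by measurable
  have apos: "?\<alpha> x > 0" if "x \<in> M" for x by (rule alpha_lower_bound(2)[OF M that])
  have fm: "f \<in> borel_measurable (completion ?\<mu>)" using int vol by auto
  \<comment> \<open>\<open>f\<close> is measurable only for the completion. It is replaced by a
    Borel function, so the points where the two differ must be kept away from almost every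
    slice.\<close>
  obtain f' where f': "f' \<in> borel_measurable ?\<mu>" "AE x in ?\<mu>. f x = f' x"
    using completion_ex_borel_measurable_real[OF fm] by blast
  have fm': "f' \<in> borel_measurable ?\<nu>" using f'(1) by (simp cong: measurable_cong_sets)
  \<comment> \<open>The weight \<open>w\<close> is positive on \<open>M\<close>, so null sets of the
    volume are null sets of the slice measure.\<close>
  have "AE x in ?\<nu>. 0 < w x \<longrightarrow> f x = f' x" using f'(2) by (simp add: AE_density[OF wm])
  moreover have "AE x in ?\<nu>. 0 < w x" using apos by (intro AE_I2) (simp add: w_def)
  ultimately have "AE x in ?\<nu>. f x = f' x" by eventually_elim simp
  then obtain Z where Z: "{x \<in> space ?\<nu>. \<not> f x = f' x} \<subseteq> Z" "emeasure ?\<nu> Z = 0" "Z \<in> sets ?\<nu>"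
    by (rule AE_E)
  have Zs: "Z \<in> sets (restrict_space borel M)" using Z(3) by simp
  \<comment> \<open>A null set of the slice measure carries an expected number of 0 points, so
    almost every slice misses it.\<close>
  have "(\<integral>\<^sup>+\<omega>. slice_count (Z \<inter> affine_slice (\<omega> :: (real ^ 'N ^ 'n) \<times> (real ^ 'n))) \<partial>completion gauss) = 0"
    using Z(2) emeasure_slice_measure[OF M Zs] by simp
  then have "AE \<omega> :: (real ^ 'N ^ 'n) \<times> (real ^ 'n) in completion gauss. slice_count (Z \<inter> affine_slice \<omega>) = 0"
    by (subst (asm) nn_integral_0_iff_AE[OF borel_measurable_slice_count[OF M Zs]])
  then have aeZ: "AE \<omega> :: (real ^ 'N ^ 'n) \<times> (real ^ 'n) in completion gauss. Z \<inter> affine_slice \<omega> = {}"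
    by eventually_elim (simp add: slice_count_def emeasure_count_space_eq_0)
  obtain K where K: "AE \<omega> :: (real ^ 'N ^ 'n) \<times> (real ^ 'n) in gauss. finite (M \<inter> affine_slice \<omega>) \<and> card (M \<inter> affine_slice \<omega>) \<le> K"
    using AE_finite_slices[OF M] by blast
  have aeK: "AE \<omega> :: (real ^ 'N ^ 'n) \<times> (real ^ 'n) in completion gauss. finite (M \<inter> affine_slice \<omega>) \<and> card (M \<inter> affine_slice \<omega>) \<le> K"
    by (rule AE_completion[OF K])
  define g where "g x = ennreal (f' x) * w x" for x
  have gm: "g \<in> borel_measurable ?\<nu>" unfolding g_def[abs_def] using fm' wm by measurable
  define G where "G \<omega> = (\<integral>\<^sup>+x. g x \<partial>count_space (M \<inter> affine_slice \<omega>))" for \<omega> :: "(real ^ 'N ^ 'n) \<times> (real ^ 'n)"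
  have G: "G \<in> borel_measurable (completion gauss)" "(\<integral>\<^sup>+x. g x \<partial>?\<nu>) = (\<integral>\<^sup>+\<omega>. G \<omega> \<partial>completion gauss)"
    using nn_integral_slice_measure[OF M gm] unfolding G_def[abs_def] by auto
  have aeG: "AE \<omega> in completion gauss. G \<omega> = ennreal (f_bar M f \<omega>)"
    using aeZ aeK
  proof eventually_elim
    case (elim \<omega>)
    have "g x = ennreal (f x / ?\<alpha> x)" if "x \<in> M \<inter> affine_slice \<omega>" for x
    proof -
      have "f x = f' x" using that elim(1) Z(1) by auto
      then show ?thesis using nonneg apos[of x] that by (simp add: g_def w_def flip: ennreal_mult'')
    qed
    then have "G \<omega> = (\<Sum>x\<in>M \<inter> affine_slice \<omega>. ennreal (f x / ?\<alpha> x))"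
      unfolding G_def using elim(2) by (subst nn_integral_count_space_finite) auto
    also have "\<dots> = ennreal (f_bar M f \<omega>)"
      unfolding f_bar_def using nonneg apos by (intro sum_ennreal) (auto simp: less_imp_le)
    finally show ?case .
  qed
  have fb_nonneg: "0 \<le> f_bar M f \<omega>" for \<omega> :: "(real ^ 'N ^ 'n) \<times> (real ^ 'n)"
    unfolding f_bar_def using nonneg apos by (intro sum_nonneg) (auto simp: less_imp_le)
  obtain B where B: "\<And>x. x \<in> M \<Longrightarrow> \<bar>f x\<bar> \<le> B" using bf unfolding bounded_iff by auto
  obtain R where R: "\<And>x. x \<in> M \<Longrightarrow> norm x \<le> R" using bM unfolding bounded_iff by auto
  let ?q = "(real CARD('n) + 1) / 2"
  \<comment> \<open>A lower bound for \<open>alpha\<close> on the ball of radius \<open>R\<close>,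
    which contains \<open>M\<close>.\<close>
  define c where "c = Gamma ?q / sqrt pi ^ (CARD('n) + 1) / (1 + R\<^sup>2) powr ?q"
  have qpos: "?q > 0" by simp
  have "1 + R\<^sup>2 > 0" by (simp add: add_pos_nonneg)
  then have c: "c > 0" unfolding c_def by (intro divide_pos_pos Gamma_real_pos[OF qpos]) auto
  have ac: "c \<le> ?\<alpha> x" if x: "x \<in> M" for x
  proof -
    have "(norm x)\<^sup>2 \<le> R\<^sup>2" using R[OF x] by (intro power_mono) auto
    then have "(1 + (norm x)\<^sup>2) powr ?q \<le> (1 + R\<^sup>2) powr ?q"
      by (intro powr_mono2) auto
    then have "c \<le> Gamma ?q / sqrt pi ^ (CARD('n) + 1) / (1 + (norm x)\<^sup>2) powr ?q"
      unfolding c_def using Gamma_real_pos[OF qpos]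
      by (intro divide_left_mono) (auto simp: add_pos_nonneg powr_gt_zero add_nonneg_eq_0_iff)
    also have "\<dots> \<le> ?\<alpha> x" by (rule alpha_lower_bound(1)[OF M x])
    finally show ?thesis .
  qed
  \<comment> \<open>The absolute value keeps the bound nonnegative even when \<open>M\<close> is
    empty and \<open>B\<close> is unconstrained.\<close>
  have quot: "f x / ?\<alpha> x \<le> \<bar>B\<bar> / c" if x: "x \<in> M" for x
    using B[OF x] ac[OF x] c nonneg x by (intro frac_le) auto
  have "AE \<omega> :: (real ^ 'N ^ 'n) \<times> (real ^ 'n) in completion gauss. \<bar>f_bar M f \<omega>\<bar> \<le> real K * (\<bar>B\<bar> / c)"
    using aeK
  proof eventually_elim
    case (elim \<omega>)
    have "f_bar M f \<omega> \<le> real (card (M \<inter> affine_slice \<omega>)) * (\<bar>B\<bar> / c)"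
      unfolding f_bar_def by (rule sum_bounded_above) (use quot in auto)
    also have "\<dots> \<le> real K * (\<bar>B\<bar> / c)" using elim c by (intro mult_right_mono) auto
    finally show ?case using fb_nonneg[of \<omega>] by simp
  qed
  then show "\<exists>C. AE \<omega> in P. \<bar>f_bar M f \<omega>\<bar> \<le> C" unfolding P by blast
  obtain G' where G': "G' \<in> borel_measurable gauss" "AE \<omega> in gauss. G \<omega> = G' \<omega>"
    using completion_ex_borel_measurable[OF G(1)] by blast
  have "AE \<omega> in gauss. enn2real (G' \<omega>) = f_bar M f \<omega>"
    using G'(2) aeG[unfolded AE_completion_iff] by eventually_elim (metis enn2real_ennreal fb_nonneg)
  then show fb: "f_bar M f \<in> borel_measurable P"
    unfolding P using G'(1) by (intro measurable_completion_AE[of "\<lambda>\<omega>. enn2real (G' \<omega>)"]) auto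
  have "(\<integral>\<^sup>+\<omega>. ennreal (f_bar M f \<omega>) \<partial>P) = (\<integral>\<^sup>+\<omega>. G \<omega> \<partial>P)"
    unfolding P using aeG by (intro nn_integral_cong_AE) (auto elim: eventually_mono)
  also have "\<dots> = (\<integral>\<^sup>+x. g x \<partial>?\<nu>)" unfolding P G(2) ..
  also have "\<dots> = (\<integral>\<^sup>+x. ennreal (f' x) \<partial>?\<mu>)"
    unfolding g_def using fm' wm by (subst nn_integral_density) (auto simp: mult.commute)
  also have "\<dots> = (\<integral>\<^sup>+x. ennreal (f x) \<partial>?\<mu>)"
    using f'(2) by (intro nn_integral_cong_AE) (auto elim: eventually_mono)
  also have "\<dots> = (\<integral>\<^sup>+x. ennreal (f x) \<partial>completion ?\<mu>)" by (simp add: nn_integral_completion)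
  finally have eq: "(\<integral>\<^sup>+\<omega>. ennreal (f_bar M f \<omega>) \<partial>P) = (\<integral>\<^sup>+x. ennreal (f x) \<partial>volume_measure TYPE('n) M)"
    unfolding vol .
  have "(\<integral>\<omega>. f_bar M f \<omega> \<partial>P) = enn2real (\<integral>\<^sup>+\<omega>. ennreal (f_bar M f \<omega>) \<partial>P)"
    using fb fb_nonneg by (intro integral_eq_nn_integral) auto
  also have "\<dots> = (\<integral>x. f x \<partial>volume_measure TYPE('n) M)"
    unfolding eq using int nonneg
    by (intro integral_eq_nn_integral[symmetric] AE_I2) (auto simp: vol)
  finally show "(\<integral>\<omega>. f_bar M f \<omega> \<partial>P) = (\<integral>x. f x \<partial>volume_measure TYPE('n) M)" .
qed

theorem lemma1p2:
  fixes M :: "(real ^ 'N) set" and f :: "real ^ 'N \<Rightarrow> real"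
    and P :: "((real ^ 'N ^ 'n) \<times> (real ^ 'n)) measure"
  assumes "P = gaussian_measure"
    and "algebraic_manifold CARD('n) M"
    and "\<forall>x\<in>M. 0 \<le> f x"
    and "integrable (volume_measure TYPE('n) M) f"
    and "bounded (f ` M)"
    and "bounded M"
  shows "integrable P (f_bar M f) \<and>
    integrable P (\<lambda>\<omega>. (f_bar M f \<omega> - prob_space.expectation P (f_bar M f))\<^sup>2) \<and>
    (\<forall>\<epsilon>>0. \<forall>k>0.
       \<P>(\<omega> in Pi\<^sub>M {1..k} (\<lambda>_. P).
           \<bar>empirical_mean M f k \<omega> - (\<integral>x. f x \<partial>volume_measure TYPE('n) M)\<bar> \<ge> \<epsilon>)
         \<le> prob_space.variance P (f_bar M f) / (\<epsilon>\<^sup>2 * real k))"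
proof -
  note m = f_bar_moments[OF assms(2-6), folded assms(1)]
  obtain C where C: "AE \<omega> in P. \<bar>f_bar M f \<omega>\<bar> \<le> C" using m(2) by blast
  have "prob_space (gauss :: ((real ^ 'N ^ 'n) \<times> (real ^ 'n)) measure)" by (rule prob_space_gauss)
  then have ps: "prob_space P"
    unfolding assms(1) gaussian_measure_eq
    by (intro prob_spaceI) (use prob_space.emeasure_space_1 in force)
  interpret prob_space P by (rule ps)
  let ?m = "expectation (f_bar M f)"
  have 1: "integrable P (f_bar M f)"
    using C m(1) by (intro integrable_const_bound[of _ C]) auto
  have 2: "integrable P (\<lambda>\<omega>. (f_bar M f \<omega> - ?m)\<^sup>2)"
  proof (rule integrable_const_bound)
    show "AE \<omega> in P. norm ((f_bar M f \<omega> - ?m)\<^sup>2) \<le> (C + \<bar>?m\<bar>)\<^sup>2"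
      using C
    proof eventually_elim
      case (elim \<omega>)
      then have "\<bar>f_bar M f \<omega> - ?m\<bar>\<^sup>2 \<le> (C + \<bar>?m\<bar>)\<^sup>2" by (intro power_mono) auto
      then show ?case by simp
    qed
    show "(\<lambda>\<omega>. (f_bar M f \<omega> - ?m)\<^sup>2) \<in> borel_measurable P" using m(1) by measurable
  qed
  show ?thesis
    using 1 2 Chebyshev_empirical_mean[OF ps 1 2]
    unfolding empirical_mean_def m(3) by blast
qed

end
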